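(* Let $\mathfrak S=\{(0,1),(1,0),(1,1),(0,-1),(-1,0),(-1,-1)\}$ (triangular lattice). Let $J(t)$ be the unique power series with $J=t+O(t^2)$ satisfying $$J=t\,\frac{1-2J+6J^2-2J^3+J^4}{(1-J)^2}.$$ Then the generating function of walks on the slit plane, the generating function of bilateral walks on the slit plane, and the generating function of loops (steps in $\mathfrak S$) are $$S(x,y;t)=\frac{t\sqrt{(1-J)^2-2J(1+J^2)\bar x+J^2(1-J)^2\bar x^2}}{J(1-J)\big(1-t(x+\bar x+y(1+x)+\bar y(1+\bar x))\big)},$$ $$S_0(x;t)=\frac{1-J}{\sqrt{(1-J)^2-2J(1+J^2)x+J^2(1-J)^2x^2}},\qquad L(t)=\frac Jt.$$ These series are algebraic of degree $8$, $8$ and $4$ respectively. For every $(i,j)\in\mathbb Z^2$, the generating function $S_{i,j}(t)$ of walks on the slit plane ending at $(i,j)$ belongs to $\mathbb Q(J)$.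
   Context: $\bar x=1/x$, $\bar y=1/y$. A walk with steps in $\mathfrak S$ is a sequence $(w_0,\dots,w_n)$ of points of $\mathbb Z^2$ with $w_0=(0,0)$ and $w_k-w_{k-1}\in\mathfrak S$; $n$ is its length. It is on the slit plane if none of $w_1,\dots,w_n$ lies on $\mathcal H=\{(k,0):k\le0\}$; bilateral if $w_n$ lies on the $x$-axis; a loop if $w_n=(0,0)$ and no $w_k$ lies on $\{(k,0):k<0\}$. The generating function of a set of walks is $\sum_nt^n\sum_{i,j}a_{i,j}(n)x^iy^j$ with $a_{i,j}(n)$ the number of its walks of length $n$ ending at $(i,j)$ ($y$ omitted for walks ending on the $x$-axis, only $t$ for loops and for $S_{i,j}$). Degrees of algebraicity are over $\mathbb Q(x,y,t)$. *)

theory Defs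
  imports "HOL-Computational_Algebra.Computational_Algebra" "HOL-Library.Product_Plus"
begin
text \<open>A walk of length \<open>n\<close> is the list of its \<open>n + 1\<close> points.\<close>

definition walks :: "(int \<times> int) set \<Rightarrow> nat \<Rightarrow> (int \<times> int) list set" where
  "walks \<SS> n = {w. length w = Suc n \<and> w ! 0 = (0, 0) \<and> (\<forall>k\<in>{1..n}. w ! k - w ! (k - 1) \<in> \<SS>)}"

definition slit_walks :: "(int \<times> int) set \<Rightarrow> nat \<Rightarrow> (int \<times> int) list set" where
  "slit_walks \<SS> n = {w \<in> walks \<SS> n. \<forall>k\<in>{1..n}. w ! k \<notin> {(m, 0) |m. m \<le> 0}}"

definition bilateral_slit_walks :: "(int \<times> int) set \<Rightarrow> nat \<Rightarrow> (int \<times> int) list set" where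
  "bilateral_slit_walks \<SS> n = {w \<in> slit_walks \<SS> n. snd (w ! n) = 0}"

definition loops :: "(int \<times> int) set \<Rightarrow> nat \<Rightarrow> (int \<times> int) list set" where
  "loops \<SS> n = {w \<in> walks \<SS> n. w ! n = (0, 0) \<and> (\<forall>k\<in>{0..n}. w ! k \<notin> {(m, 0) |m. m < 0})}"

definition triangular_steps :: "(int \<times> int) set" where
  "triangular_steps = {(0, 1), (1, 0), (1, 1), (0, -1), (-1, 0), (-1, -1)}"

text \<open>
  The field \<open>\<rat>(x, y)\<close> is the fraction field of \<open>\<rat>[x][y]\<close>. A generating function is a power series
  in \<open>t\<close> over it, and the ambient field for algebraicity is the field of Laurent series
  \<open>\<rat>(x, y)((t))\<close>.
\<close>

type_synonym ratfun_xy = "rat poly poly fract"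

definition var_x :: ratfun_xy where
  "var_x = to_fract [:[:0, 1:]:]"

definition var_y :: ratfun_xy where
  "var_y = to_fract [:0, 1:]"

text \<open>In the following, \<open>W n\<close> is the set of the walks of length \<open>n\<close> in a given class of walks.\<close>

definition num_ending_at ::
    "(nat \<Rightarrow> (int \<times> int) list set) \<Rightarrow> int \<Rightarrow> int \<Rightarrow> nat \<Rightarrow> nat" where
  "num_ending_at W i j n = card {w \<in> W n. w ! n = (i, j)}"

text \<open>
  For finite step sets, all but finitely many pairs \<open>(i, j)\<close> have coefficient \<open>0\<close>. If all the walks
  end on the \<open>x\<close>-axis, only \<open>j = 0\<close> contributes, so that \<open>y\<close> does not occur.
\<close>

definition gf_xy :: "(nat \<Rightarrow> (int \<times> int) list set) \<Rightarrow> ratfun_xy fps" where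
  "gf_xy W = Abs_fps (\<lambda>n. \<Sum>(i, j) \<in> {(i, j). num_ending_at W i j n \<noteq> 0}.
      of_nat (num_ending_at W i j n) * var_x powi i * var_y powi j)"

definition gf_ending_at :: "(nat \<Rightarrow> (int \<times> int) list set) \<Rightarrow> int \<Rightarrow> int \<Rightarrow> rat fps" where
  "gf_ending_at W i j = Abs_fps (\<lambda>n. of_nat (num_ending_at W i j n))"

definition S_gf :: "(int \<times> int) set \<Rightarrow> ratfun_xy fps" where
  "S_gf \<SS> = gf_xy (slit_walks \<SS>)"

definition S0_gf :: "(int \<times> int) set \<Rightarrow> ratfun_xy fps" where
  "S0_gf \<SS> = gf_xy (bilateral_slit_walks \<SS>)"

definition L_gf :: "(int \<times> int) set \<Rightarrow> rat fps" where
  "L_gf \<SS> = gf_ending_at (loops \<SS>) 0 0"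

definition S_end_gf :: "(int \<times> int) set \<Rightarrow> int \<Rightarrow> int \<Rightarrow> rat fps" where
  "S_end_gf \<SS> i j = gf_ending_at (slit_walks \<SS>) i j"

text \<open>The inclusion of \<open>\<rat>[[t]]\<close> in \<open>\<rat>(x, y)[[t]]\<close>.\<close>

definition fps_of_rat_fps :: "rat fps \<Rightarrow> ratfun_xy fps" where
  "fps_of_rat_fps f = Abs_fps (\<lambda>n. of_rat (fps_nth f n))"

text \<open>The square root with constant term \<open>1\<close> of a series with constant term \<open>1\<close>.\<close>

definition fps_sqrt :: "'a :: field_char_0 fps \<Rightarrow> 'a fps" where
  "fps_sqrt f = fps_radical (\<lambda>_ _. 1) 2 f"

lemma fps_sqrt_nth_0: "fps_nth (fps_sqrt f) 0 = 1"
  by (simp add: fps_sqrt_def)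

lemma fps_sqrt_power2:
  assumes "fps_nth f 0 = 1"
  shows "fps_sqrt f ^ 2 = f"
  using power_radical[of f "\<lambda>_ _. 1" 1] assms by (simp add: fps_sqrt_def numeral_2_eq_2)

definition is_J :: "rat fps \<Rightarrow> bool" where
  "is_J J \<longleftrightarrow> fps_nth J 0 = 0 \<and> fps_nth J 1 = 1 \<and>
     J = fps_X * ((1 - 2 * J + 6 * J ^ 2 - 2 * J ^ 3 + J ^ 4) / (1 - J) ^ 2)"

definition is_subfield :: "'a :: field set \<Rightarrow> bool" where
  "is_subfield F \<longleftrightarrow> 0 \<in> F \<and> 1 \<in> F \<and> (\<forall>a\<in>F. \<forall>b\<in>F. a + b \<in> F \<and> a * b \<in> F) \<and>
     (\<forall>a\<in>F. - a \<in> F \<and> inverse a \<in> F)"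

text \<open>
  In characteristic \<open>0\<close>, every subfield contains \<open>\<rat>\<close>, so \<open>is_subfield hull {a, b, \<dots>}\<close> is the field
  \<open>\<rat>(a, b, \<dots>)\<close>.
\<close>

definition field_Q_xyt :: "ratfun_xy fls set" where
  "field_Q_xyt = is_subfield hull {fls_const var_x, fls_const var_y, fls_X}"

text \<open>
  \<open>z\<close> is algebraic over the subfield \<open>F\<close>, and the least degree of a nonzero polynomial over \<open>F\<close>
  annihilating \<open>z\<close> (the degree of its minimal polynomial) is \<open>d\<close>.
\<close>

definition algebraic_of_degree :: "'a :: field set \<Rightarrow> 'a \<Rightarrow> nat \<Rightarrow> bool" where
  "algebraic_of_degree F z d \<longleftrightarrow>
     (\<exists>p. p \<noteq> 0 \<and> set (coeffs p) \<subseteq> F \<and> poly p z = 0 \<and> degree p = d) \<and>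
     (\<forall>p. p \<noteq> 0 \<and> set (coeffs p) \<subseteq> F \<and> poly p z = 0 \<longrightarrow> d \<le> degree p)"

end

theory Submission
  imports Defs
begin

text \<open>
  Write \<open>a = 1 + x\<close>, \<open>b = 1 + 1/x\<close>, \<open>c = 1 - t (x + 1/x)\<close>. The row \<open>S\<^sub>j(x)\<close> of walks on the slit plane ending
  at height \<open>j\<close> satisfies \<open>c S\<^sub>j = t a S\<^sub>j\<^sub>-\<^sub>1 + t b S\<^sub>j\<^sub>+\<^sub>1\<close> for \<open>j \<noteq> 0\<close>, and for \<open>j = 0\<close> up to a series \<open>1 - B\<close> without
  positive powers of \<open>x\<close>, while \<open>S\<^sub>0 - 1\<close> has only positive powers of \<open>x\<close>. Hence \<open>S\<^sub>j = U\<^sup>j S\<^sub>0\<close> for \<open>j \<ge> 0\<close> and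
  \<open>S\<^sub>0 \<Delta>\<^sup>1\<^sup>/\<^sup>2 = 1 - B\<close>, where \<open>\<Delta> = c\<^sup>2 - 4 t\<^sup>2 a b\<close>, and the parametrization by \<open>J\<close> splits \<open>\<Delta>\<close> into a polynomial in
  \<open>x\<close> and one in \<open>1/x\<close>. Conversely, the coefficients of the rows so defined satisfy the step-by-step
  recurrence of the walks, which determines them.

  The series \<open>S\<^sub>i\<^sub>,\<^sub>j\<close> lie in \<open>\<rat>(J)\<close> row by row: going from one row to the next involves a division by
  \<open>1 + x\<close>, and the expansion of \<open>S\<^sub>0\<close> at \<open>x = - 1\<close> is rational in \<open>J\<close>.

  For the degrees, \<open>t = J (1 - J)\<^sup>2 / N(J)\<close> with a quartic polynomial \<open>N\<close>. The leading coefficient in \<open>t\<close>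
  of a relation gives a divisibility by \<open>N\<close>, which at \<open>x = \<infinity>\<close> concerns an even polynomial of degree at
  most 6 in \<open>J\<close> and is impossible; this gives degree 4 for the squares of \<open>S\<close> and \<open>S\<^sub>0\<close>. The final
  factor 2 comes from the value \<open>- 4 \<xi>\<close> at \<open>J = 1\<close> of the polynomial under the root in \<open>\<xi> = x\<close> or
  \<open>\<xi> = 1/x\<close>, which is not a square.
\<close>

unbundle fps_syntax

section \<open>Ring homomorphisms and power series\<close>

definition fps_map :: "('a \<Rightarrow> 'b) \<Rightarrow> 'a fps \<Rightarrow> 'b fps" where
  "fps_map h f = Abs_fps (\<lambda>n. h (fps_nth f n))"

lemma fps_map_nth [simp]: "fps_nth (fps_map h f) n = h (fps_nth f n)"
  by (simp add: fps_map_def)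

lemma fps_map_fps_map: "fps_map g (fps_map h f) = fps_map (\<lambda>a. g (h a)) f"
  by (rule fps_ext) simp

text \<open>All changes of coefficients go through this locale: the inclusion of Q, the evaluation
  of Q[x] at a point, the embedding of Q(x,y) into Laurent series, and the exchange of the roles of
  x and t.\<close>

locale unital_ring_hom =
  fixes h :: "'a::comm_ring_1 \<Rightarrow> 'b::comm_ring_1"
  assumes hom_add: "h (a + b) = h a + h b"
    and hom_mult: "h (a * b) = h a * h b"
    and hom_one: "h 1 = 1"
begin

lemma hom_zero: "h 0 = 0"
  using hom_add[of 0 0] by simp

lemma hom_uminus: "h (- a) = - h a"
  using hom_add[of a "- a"] by (simp add: hom_zero eq_neg_iff_add_eq_0 add.commute)

lemma hom_diff: "h (a - b) = h a - h b"
  using hom_add[of a "- b"] by (simp add: hom_uminus)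

lemma hom_power: "h (a ^ n) = h a ^ n"
  by (induction n) (simp_all add: hom_one hom_mult)

lemma hom_sum: "h (sum f A) = (\<Sum>i\<in>A. h (f i))"
  by (induction A rule: infinite_finite_induct) (simp_all add: hom_zero hom_add)

lemma hom_of_nat: "h (of_nat n) = of_nat n"
  by (induction n) (simp_all add: hom_zero hom_add hom_one)

lemma hom_numeral: "h (numeral n) = numeral n"
  using hom_of_nat[of "numeral n"] by simp

lemma hom_of_int: "h (of_int n) = of_int n"
  by (cases n) (simp_all add: hom_of_nat hom_uminus hom_diff hom_one)

lemmas homs = hom_add hom_mult hom_one hom_zero hom_uminus hom_diff hom_power hom_sum
  hom_of_nat hom_numeral hom_of_int

lemma unital_ring_hom_fps_map: "unital_ring_hom (fps_map h)"
  by unfold_locales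
    (rule fps_ext; simp add: homs fps_mult_nth if_distrib[of h] cong: if_cong)+

lemma fps_map_const: "fps_map h (fps_const c) = fps_const (h c)"
  by (rule fps_ext) (simp add: homs)

lemma fps_map_X: "fps_map h fps_X = fps_X"
  by (rule fps_ext) (simp add: homs fps_X_def)

lemma coeff_map_poly_hom [simp]: "coeff (map_poly h p) n = h (coeff p n)"
  by (simp add: coeff_map_poly homs)

lemma unital_ring_hom_map_poly: "unital_ring_hom (map_poly h)"
proof
  fix p q :: "'a poly"
  show "map_poly h (p + q) = map_poly h p + map_poly h q"
    by (rule poly_eqI) (simp add: homs)
  show "map_poly h (p * q) = map_poly h p * map_poly h q"
    by (rule poly_eqI) (simp add: homs coeff_mult)
  show "map_poly h 1 = 1"
    by (rule poly_eqI) (simp add: homs if_distrib[of h] cong: if_cong)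
qed

lemma map_poly_pCons_hom: "map_poly h (pCons c p) = pCons (h c) (map_poly h p)"
  by (rule poly_eqI) (simp add: homs coeff_pCons split: nat.split)

lemma hom_poly: "h (poly p c) = poly (map_poly h p) (h c)"
  by (induction p) (simp_all add: homs map_poly_pCons_hom)

lemma fps_map_of_poly: "fps_map h (fps_of_poly p) = fps_of_poly (map_poly h p)"
  by (rule fps_ext) simp

end

lemma unital_ring_hom_comp:
  assumes "unital_ring_hom g" "unital_ring_hom h"
  shows "unital_ring_hom (\<lambda>a. g (h a))"
  using assms by (simp add: unital_ring_hom_def)

lemma unital_ring_hom_of_rat: "unital_ring_hom (of_rat :: rat \<Rightarrow> 'a::field_char_0)"
  by unfold_locales (simp_all add: of_rat_add of_rat_mult)

lemma unital_ring_hom_fps_to_fls: "unital_ring_hom (fps_to_fls :: 'a::comm_ring_1 fps \<Rightarrow> 'a fls)"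
  by unfold_locales (simp_all add: fls_times_fps_to_fls)

lemma unital_ring_hom_poly_const: "unital_ring_hom (\<lambda>c::'a::comm_ring_1. [:c:])"
  by unfold_locales simp_all

locale field_hom = unital_ring_hom h for h :: "'a::field \<Rightarrow> 'b::field"
begin

lemma hom_eq_0_iff [simp]: "h a = 0 \<longleftrightarrow> a = 0"
proof
  assume "h a = 0"
  show "a = 0"
  proof (rule ccontr)
    assume "a \<noteq> 0"
    then have "h (a * inverse a) = 1" by (simp add: hom_one)
    with \<open>h a = 0\<close> show False by (simp add: hom_mult)
  qed
qed (simp add: hom_zero)

lemma hom_inj: "h a = h b \<longleftrightarrow> a = b"
  using hom_eq_0_iff[of "a - b"] by (simp add: hom_diff)

lemma hom_inverse: "h (inverse a) = inverse (h a)"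
proof (cases "a = 0")
  case False
  then have "h a * h (inverse a) = 1" by (simp flip: hom_mult add: hom_one)
  then show ?thesis by (simp add: inverse_unique)
qed (simp add: hom_zero)

lemma hom_divide: "h (a / b) = h a / h b"
  by (simp add: divide_inverse hom_mult hom_inverse)

lemma hom_powi: "h (a powi n) = h a powi n"
  by (simp add: power_int_def hom_power hom_inverse)

lemma fps_map_inj: "fps_map h f = fps_map h g \<longleftrightarrow> f = g"
  by (simp add: fps_eq_iff hom_inj)

end

lemma field_hom_of_rat:
  fixes h :: "'a::field_char_0 \<Rightarrow> 'b::field_char_0"
  assumes "field_hom h"
  shows "h (of_rat q) = of_rat q"
proof -
  interpret field_hom h by fact
  show ?thesis
    by (cases q) (simp add: of_rat_rat homs hom_divide)
qed

text \<open>In \<open>(f - g) * (f + g) = 0\<close> the second factor has constant term 2 and so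
  cannot vanish.\<close>

lemma fps_sqrt_unique:
  fixes f g :: "'a::{idom,ring_char_0} fps"
  assumes "f ^ 2 = g ^ 2" "fps_nth f 0 = 1" "fps_nth g 0 = 1"
  shows "f = g"
proof -
  have "(f - g) * (f + g) = 0"
    using assms(1) by (simp add: algebra_simps power2_eq_square)
  moreover have "f + g \<noteq> 0"
  proof
    assume "f + g = 0"
    then have "fps_nth (f + g) 0 = 0" by simp
    then show False using assms by simp
  qed
  ultimately show ?thesis by simp
qed

text \<open>Series with coefficients in Q[x] are built once and then evaluated at x, 1/x, 0 or -1
  through \<open>ev\<close>.\<close>

definition ev :: "'a::field_char_0 \<Rightarrow> rat poly \<Rightarrow> 'a" where
  "ev c p = poly (map_poly of_rat p) c"

lemma unital_ring_hom_ev: "unital_ring_hom (ev c)"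
proof -
  interpret of_rat: unital_ring_hom "of_rat :: rat \<Rightarrow> 'a" by (rule unital_ring_hom_of_rat)
  interpret map: unital_ring_hom "map_poly (of_rat :: rat \<Rightarrow> 'a)"
    by (rule of_rat.unital_ring_hom_map_poly)
  show ?thesis
    by unfold_locales (simp_all add: ev_def map.homs)
qed

lemma ev_const [simp]: "ev c [:q:] = of_rat q"
  by (cases "q = 0") (simp_all add: ev_def map_poly_pCons)

lemma ev_X [simp]: "ev c [:0, 1:] = c"
  by (simp add: ev_def map_poly_pCons)

lemma field_hom_ev:
  fixes h :: "'a::field_char_0 \<Rightarrow> 'b::field_char_0"
  assumes "field_hom h"
  shows "h (ev c p) = ev (h c) p"
proof -
  interpret field_hom h by fact
  show ?thesis
    by (simp add: ev_def hom_poly map_poly_map_poly hom_zero o_def field_hom_of_rat[OF assms])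
qed

section \<open>The equation for J\<close>

definition quartic :: "'a::comm_ring_1 \<Rightarrow> 'a" where
  "quartic z = 1 - 2 * z + 6 * z ^ 2 - 2 * z ^ 3 + z ^ 4"

text \<open>As 1 - J is a unit, the division in the defining equation can be cleared. The
  coefficient of t in J is the constant term 1 of the quotient.\<close>

lemma is_J_iff:
  "is_J J \<longleftrightarrow> fps_nth J 0 = 0 \<and> J * (1 - J) ^ 2 = fps_X * quartic J"
proof -
  have "J * (1 - J) ^ 2 = fps_X * quartic J \<longleftrightarrow> J = fps_X * (quartic J / (1 - J) ^ 2)"
    if "fps_nth J 0 = 0"
  proof -
    have u: "fps_nth ((1 - J) ^ 2) 0 \<noteq> 0"
      using that by simp
    have d: "quartic J / (1 - J) ^ 2 = quartic J * inverse ((1 - J) ^ 2)"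
      using u by (rule fps_divide_unit)
    have i: "(1 - J) ^ 2 * inverse ((1 - J) ^ 2) = 1"
      using u by (rule inverse_mult_eq_1')
    show ?thesis
    proof
      assume "J * (1 - J) ^ 2 = fps_X * quartic J"
      then have "J * ((1 - J) ^ 2 * inverse ((1 - J) ^ 2)) = fps_X * quartic J * inverse ((1 - J) ^ 2)"
        by (metis mult.assoc)
      then show "J = fps_X * (quartic J / (1 - J) ^ 2)"
        by (simp only: i d mult_1_right mult.assoc)
    next
      assume "J = fps_X * (quartic J / (1 - J) ^ 2)"
      then have "J * (1 - J) ^ 2 = fps_X * (quartic J / (1 - J) ^ 2) * (1 - J) ^ 2"
        by (rule arg_cong)
      also have "\<dots> = fps_X * quartic J * ((1 - J) ^ 2 * inverse ((1 - J) ^ 2))"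
        by (simp only: d mult.assoc mult.commute mult.left_commute)
      finally have "J * (1 - J) ^ 2 = fps_X * quartic J * ((1 - J) ^ 2 * inverse ((1 - J) ^ 2))" .
      then show "J * (1 - J) ^ 2 = fps_X * quartic J"
        by (simp only: i mult_1_right)
    qed
  qed
  moreover have "fps_nth J 1 = 1" if "fps_nth J 0 = 0" "J = fps_X * (quartic J / (1 - J) ^ 2)"
  proof -
    have "fps_nth J 1 = fps_nth (quartic J / (1 - J) ^ 2) 0"
      by (subst that(2)) simp
    also have "\<dots> = 1"
      using that(1) by (subst fps_divide_unit) (simp_all add: quartic_def fps_nth_power_0)
    finally show ?thesis .
  qed
  ultimately show ?thesis
    unfolding is_J_def quartic_def[symmetric] by blast
qed

text \<open>Existence: the equation says g(J) = t with g = X (1 - X)^2 / \<open>quartic X\<close>,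
  so J is the compositional inverse of g. Uniqueness: the difference of the equations for J and J'
  is J - J' times the cofactor \<open>e\<close>, whose constant term is 1.\<close>

lemma ex1_is_J: "\<exists>!J. is_J J"
proof -
  define g :: "rat fps" where "g = fps_X * (1 - fps_X) ^ 2 * inverse (quartic fps_X)"
  have q: "inverse (quartic (fps_X :: rat fps)) * quartic fps_X = 1"
    by (rule inverse_mult_eq_1) (simp add: quartic_def)
  have g0: "fps_nth g 0 = 0"
    by (simp add: g_def mult.assoc)
  have g1: "fps_nth g 1 \<noteq> 0"
    by (simp add: g_def mult.assoc quartic_def)
  define J where "J = fps_inv g"
  have J0: "fps_nth J 0 = 0"
    by (simp add: J_def fps_inv_def)
  have comp: "g oo J = fps_X"
    unfolding J_def using g0 g1 by (rule fps_inv_right)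
  have "g * quartic fps_X = fps_X * (1 - fps_X) ^ 2"
    by (simp only: g_def mult.assoc q mult_1_right)
  then have "(g * quartic fps_X) oo J = (fps_X * (1 - fps_X) ^ 2) oo J"
    by simp
  moreover have "quartic fps_X oo J = quartic J"
    using J0 unfolding quartic_def
    by (simp add: fps_compose_add_distrib fps_compose_sub_distrib fps_compose_mult_distrib
        fps_compose_power[symmetric] numeral_fps_const)
  ultimately have "is_J J"
    using J0 comp unfolding is_J_iff
    by (simp add: fps_compose_mult_distrib fps_compose_power[symmetric] fps_compose_sub_distrib)
  moreover have "J = J'" if "is_J J" "is_J J'" for J J'
  proof -
    define e where "e = (1 - 2 * (J + J') + (J ^ 2 + J * J' + J' ^ 2)) - fps_X *
      (- 2 + 6 * (J + J') - 2 * (J ^ 2 + J * J' + J' ^ 2) + (J + J') * (J ^ 2 + J' ^ 2))"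
    have "(J - J') * e = (J * (1 - J) ^ 2 - fps_X * quartic J) - (J' * (1 - J') ^ 2 - fps_X * quartic J')"
      unfolding e_def quartic_def by algebra
    also have "\<dots> = 0"
      using that by (simp add: is_J_iff)
    finally have "(J - J') * e = 0" .
    moreover have "fps_nth e 0 = 1"
      using that unfolding e_def is_J_iff by (simp add: power2_eq_square)
    ultimately show ?thesis by auto
  qed
  ultimately show ?thesis by blast
qed

section \<open>The rows of the generating function\<close>

text \<open>With z = J this is the polynomial under the square roots; \<open>S\<close> has it at 1/x
  and the bilateral series at x.\<close>

definition slit_poly :: "'a::comm_ring_1 \<Rightarrow> 'a \<Rightarrow> 'a" where
  "slit_poly z \<xi> = (1 - z) ^ 2 - 2 * z * (1 + z ^ 2) * \<xi> + z ^ 2 * (1 - z) ^ 2 * \<xi> ^ 2"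

lemma (in unital_ring_hom) hom_slit_poly: "h (slit_poly z \<xi>) = slit_poly (h z) (h \<xi>)"
  by (simp add: slit_poly_def homs)

lemma (in unital_ring_hom) hom_quartic: "h (quartic z) = quartic (h z)"
  by (simp add: quartic_def homs)

section \<open>The series J and the square roots over several coefficient rings\<close>

locale J_series =
  fixes J :: "rat fps"
  assumes is_J: "is_J J"
begin

definition Jc :: "'a::field_char_0 fps" where
  "Jc = fps_map of_rat J"

definition Jp :: "rat poly fps" where
  "Jp = fps_map (\<lambda>c. [:c:]) J"

lemma J_nth_0: "fps_nth J 0 = 0"
  and J_nth_1: "fps_nth J (Suc 0) = 1"
  and J_eq: "J * (1 - J) ^ 2 = fps_X * quartic J"
  using is_J is_J_iff[of J] by (auto simp: is_J_def)

lemma Jc_nth_0 [simp]: "fps_nth Jc 0 = 0"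
  and Jc_nth_1 [simp]: "fps_nth Jc (Suc 0) = 1"
  by (simp_all add: Jc_def J_nth_0 J_nth_1)

lemma Jp_nth_0 [simp]: "fps_nth Jp 0 = 0"
  by (simp add: Jp_def J_nth_0)

lemma Jc_nz [simp]: "Jc \<noteq> 0"
  by (metis Jc_nth_1 fps_zero_nth zero_neq_one)

lemma Jc_neq_1 [simp]: "1 - Jc \<noteq> 0"
proof
  assume "1 - Jc = (0 :: 'a fps)"
  then have "fps_nth (1 - Jc :: 'a fps) 0 = 0" by simp
  then show False by simp
qed

lemma Jc_neq_1' [simp]: "Jc \<noteq> 1"
  using Jc_neq_1 by auto

lemma Jc_eq: "Jc * (1 - Jc) ^ 2 = fps_X * quartic (Jc :: 'a::field_char_0 fps)"
proof -
  interpret of_rat: unital_ring_hom "of_rat :: rat \<Rightarrow> 'a" by (rule unital_ring_hom_of_rat)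
  interpret m: unital_ring_hom "fps_map (of_rat :: rat \<Rightarrow> 'a)"
    by (rule of_rat.unital_ring_hom_fps_map)
  have "fps_map of_rat (J * (1 - J) ^ 2) = (fps_map of_rat (fps_X * quartic J) :: 'a fps)"
    by (simp add: J_eq)
  then show ?thesis
    by (simp add: m.homs m.hom_quartic of_rat.fps_map_X Jc_def)
qed

definition Pp :: "rat poly fps" where
  "Pp = slit_poly Jp (fps_const [:0, 1:])"

text \<open>As \<open>\<rat>[x]\<close> is not a field, the square root of \<open>Pp\<close> is obtained from the binomial series.\<close>

definition Pp_pow :: "rat \<Rightarrow> rat poly fps" where
  "Pp_pow c = fps_map (\<lambda>c. [:c:]) (fps_binomial c) oo (Pp - 1)"

lemma Pp_nth_0: "fps_nth Pp 0 = 1"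
  by (simp add: Pp_def slit_poly_def fps_nth_power_0)

lemma Pp_pow_mult: "Pp_pow c * Pp_pow d = Pp_pow (c + d)"
proof -
  interpret c: unital_ring_hom "\<lambda>c::rat. [:c:]" by (rule unital_ring_hom_poly_const)
  interpret m: unital_ring_hom "fps_map (\<lambda>c::rat. [:c:])" by (rule c.unital_ring_hom_fps_map)
  show ?thesis
    unfolding Pp_pow_def
    by (subst fps_compose_mult_distrib[symmetric]) (simp_all add: Pp_nth_0 fps_binomial_add_mult m.homs)
qed

lemma Pp_pow_0: "Pp_pow 0 = 1"
  and Pp_pow_1: "Pp_pow 1 = Pp"
proof -
  interpret c: unital_ring_hom "\<lambda>c::rat. [:c:]" by (rule unital_ring_hom_poly_const)
  interpret m: unital_ring_hom "fps_map (\<lambda>c::rat. [:c:])" by (rule c.unital_ring_hom_fps_map)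
  show "Pp_pow 0 = 1" "Pp_pow 1 = Pp"
    by (simp_all add: Pp_pow_def m.homs fps_binomial_1 c.fps_map_X fps_compose_add_distrib Pp_nth_0)
qed

lemma Pp_pow_nth_0: "fps_nth (Pp_pow c) 0 = 1"
  by (simp add: Pp_pow_def)

text \<open>\<open>Wp\<close> is the square root in x and \<open>Hp\<close> the candidate for the
  bilateral series. Coefficients in Q[x] rather than Q(x) permit evaluation at any point and
  expansion at x = 0 and x = -1.\<close>

definition Wp :: "rat poly fps" where
  "Wp = Pp_pow (1 / 2)"

definition Hp :: "rat poly fps" where
  "Hp = (1 - Jp) * Pp_pow (- 1 / 2)"

lemma Wp_square: "Wp ^ 2 = Pp"
  by (simp add: Wp_def power2_eq_square Pp_pow_mult Pp_pow_1)

lemma Hp_mult_Wp: "Hp * Wp = 1 - Jp"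
  by (simp add: Wp_def Hp_def Pp_pow_mult mult.assoc Pp_pow_0)

lemma Wp_nth_0: "fps_nth Wp 0 = 1"
  by (simp add: Wp_def Pp_pow_nth_0)

lemma Hp_nth_0: "fps_nth Hp 0 = 1"
  by (simp add: Hp_def Pp_pow_nth_0)

definition W :: "'a::field_char_0 \<Rightarrow> 'a fps" where
  "W c = fps_map (ev c) Wp"

definition H :: "'a::field_char_0 \<Rightarrow> 'a fps" where
  "H c = fps_map (ev c) Hp"

lemma fps_map_ev_Jp: "fps_map (ev c) Jp = Jc"
  by (simp add: Jp_def Jc_def fps_map_fps_map)

lemma fps_map_ev_Pp: "fps_map (ev c) Pp = slit_poly Jc (fps_const c)"
proof -
  interpret ev: unital_ring_hom "ev c" by (rule unital_ring_hom_ev)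
  interpret m: unital_ring_hom "fps_map (ev c)" by (rule ev.unital_ring_hom_fps_map)
  show ?thesis
    by (simp add: Pp_def m.hom_slit_poly fps_map_ev_Jp ev.fps_map_const)
qed

lemma W_square: "W c ^ 2 = slit_poly Jc (fps_const c)"
proof -
  interpret ev: unital_ring_hom "ev c" by (rule unital_ring_hom_ev)
  interpret m: unital_ring_hom "fps_map (ev c)" by (rule ev.unital_ring_hom_fps_map)
  show ?thesis
    by (simp add: W_def m.hom_power[symmetric] Wp_square fps_map_ev_Pp)
qed

lemma H_mult_W: "H c * W c = 1 - Jc"
proof -
  interpret ev: unital_ring_hom "ev c" by (rule unital_ring_hom_ev)
  interpret m: unital_ring_hom "fps_map (ev c)" by (rule ev.unital_ring_hom_fps_map)
  show ?thesis
    by (simp add: W_def H_def m.hom_mult[symmetric] Hp_mult_Wp m.homs fps_map_ev_Jp)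
qed

lemma W_nth_0 [simp]: "fps_nth (W c) 0 = 1"
  and H_nth_0 [simp]: "fps_nth (H c) 0 = 1"
  using unital_ring_hom.hom_one[OF unital_ring_hom_ev[of c]]
  by (simp_all add: W_def H_def Wp_nth_0 Hp_nth_0)

lemma W_nz [simp]: "W c \<noteq> 0"
  by (metis W_nth_0 fps_zero_nth zero_neq_one)

lemma H_nz [simp]: "H c \<noteq> 0"
  by (metis H_nth_0 fps_zero_nth zero_neq_one)

lemma fps_sqrt_slit_poly: "fps_sqrt (slit_poly Jc (fps_const c)) = W c"
proof (rule fps_sqrt_unique)
  have "fps_nth (slit_poly Jc (fps_const c)) 0 = 1"
    by (simp add: slit_poly_def fps_nth_power_0)
  then show "fps_sqrt (slit_poly Jc (fps_const c)) ^ 2 = W c ^ 2"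
    by (simp add: fps_sqrt_power2 W_square)
qed (simp_all add: fps_sqrt_nth_0)

text \<open>The candidate J/t for the loops. Unlike J it is a unit, so t/J is the power series
  \<open>inverse Lc\<close>.\<close>

definition Lc :: "'a::field_char_0 fps" where
  "Lc = fps_shift 1 Jc"

lemma Jc_eq_X_Lc: "Jc = fps_X * Lc"
  by (rule fps_ext) (simp add: Lc_def)

lemma Lc_nth_0 [simp]: "fps_nth Lc 0 = 1"
  by (simp add: Lc_def)

text \<open>The series \<open>axis x\<close> is \<open>1 - B\<close>, where \<open>B\<close> counts the walks whose only visit to the slit
  after time 0 is their endpoint; \<open>disc_root x\<close> is the square root of the discriminant of the
  kernel, seen as a quadratic polynomial in \<open>y\<close>.\<close>

definition axis :: "'a::field_char_0 \<Rightarrow> 'a fps" where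
  "axis x = inverse Lc * inverse (1 - Jc) * W (inverse x)"

definition disc_root :: "'a::field_char_0 \<Rightarrow> 'a fps" where
  "disc_root x = inverse Lc * inverse (1 - Jc) ^ 2 * W (inverse x) * W x"

section \<open>The kernel quadratic and the candidate rows\<close>

definition row_c :: "'a::field_char_0 \<Rightarrow> 'a fps" where
  "row_c x = 1 - fps_X * (fps_const x + fps_const (inverse x))"

definition row_a :: "'a::field_char_0 \<Rightarrow> 'a fps" where
  "row_a x = 1 + fps_const x"

definition row_D :: "'a::field_char_0 \<Rightarrow> 'a fps" where
  "row_D x = fps_const (1 / 2) * (row_c x + disc_root x)"

text \<open>This is the solution U of t b U^2 - c U + t a = 0 that is a power series in t. The form
  2 t a / (c + \<open>disc_root x\<close>) has a unit as denominator. At 1/x it gives the solution V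
  of the equation with a and b exchanged, which governs the rows below the axis.\<close>

definition row_U :: "'a::field_char_0 \<Rightarrow> 'a fps" where
  "row_U x = fps_X * row_a x * inverse (row_D x)"

definition row :: "'a::field_char_0 \<Rightarrow> int \<Rightarrow> 'a fps" where
  "row x j = (if j \<ge> 0 then row_U x ^ nat j else row_U (inverse x) ^ nat (- j)) * H x"

lemma inverse_Lc: "Lc * inverse Lc = (1 :: 'a::field_char_0 fps)"
  by (rule inverse_mult_eq_1') simp

lemma inverse_1_minus_Jc: "(1 - Jc) * inverse (1 - Jc) = (1 :: 'a::field_char_0 fps)"
  by (rule inverse_mult_eq_1') simp

lemma axis_eq: "Jc * (1 - Jc) * axis x = fps_X * W (inverse x)"
proof -
  have "Jc * (1 - Jc) * axis x =
      fps_X * (Lc * inverse Lc) * ((1 - Jc) * inverse (1 - Jc)) * W (inverse x)"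
    by (simp only: axis_def) (subst Jc_eq_X_Lc, simp only: ac_simps)
  then show ?thesis by (simp only: inverse_Lc inverse_1_minus_Jc mult_1_right)
qed

text \<open>The factor \<open>W x\<close> of \<open>disc_root x\<close> cancels against
  \<open>H x\<close>, which is (1 - J) / \<open>W x\<close>; what remains is a series in
  1/x.\<close>

lemma disc_root_mult_H: "disc_root x * H x = axis x"
proof -
  have "disc_root x * H x =
      inverse Lc * inverse (1 - Jc) * W (inverse x) * (inverse (1 - Jc) * (H x * W x))"
    by (simp only: disc_root_def power2_eq_square ac_simps)
  also have "inverse (1 - Jc) * (H x * W x) = 1"
    by (simp only: H_mult_W inverse_1_minus_Jc mult.commute[of "inverse _"])
  finally show ?thesis by (simp only: axis_def mult_1_right)
qed

lemma disc_root_eq: "Jc * (1 - Jc) ^ 2 * disc_root x = fps_X * W (inverse x) * W x"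
proof -
  have "Jc * (1 - Jc) ^ 2 * disc_root x * H x = (1 - Jc) * (Jc * (1 - Jc) * axis x)"
    by (simp only: disc_root_mult_H[symmetric] power2_eq_square ac_simps)
  also have "\<dots> = (H x * W x) * (fps_X * W (inverse x))"
    by (simp only: axis_eq H_mult_W)
  also have "\<dots> = (fps_X * W (inverse x) * W x) * H x"
    by (simp only: ac_simps)
  finally show ?thesis by simp
qed

text \<open>The splitting of the discriminant: up to a factor free of x it is the product of a
  polynomial in x and one in 1/x. As the two points are inverse to each other, both sides are
  quadratic polynomials in u, their sum, and the equation for J makes the coefficients
  agree.\<close>

lemma slit_poly_prod:
  fixes z \<xi> \<eta> t :: "'b::idom"
  assumes "\<xi> * \<eta> = 1" "z * (1 - z) ^ 2 = t * quartic z"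
  shows "t ^ 2 * (slit_poly z \<xi> * slit_poly z \<eta>) =
    (z * (1 - z) ^ 2) ^ 2 * ((1 - t * (\<xi> + \<eta>)) ^ 2 - 4 * t ^ 2 * (1 + \<xi>) * (1 + \<eta>))"
proof -
  define A where "A = z * (1 - z) ^ 2"
  define u where "u = \<xi> + \<eta>"
  have "slit_poly z \<xi> * slit_poly z \<eta> = A ^ 2 * u ^ 2 - 2 * A * (quartic z + 2 * A) * u
      + (quartic z ^ 2 - 8 * A ^ 2)"
    using assms(1) unfolding slit_poly_def A_def u_def quartic_def by algebra
  then have "t ^ 2 * (slit_poly z \<xi> * slit_poly z \<eta>) =
      A ^ 2 * (t ^ 2 * u ^ 2 - 2 * t * u - 4 * t ^ 2 * u + 1 - 8 * t ^ 2)"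
    using assms(2) unfolding A_def[symmetric] by algebra
  also have "t ^ 2 * u ^ 2 - 2 * t * u - 4 * t ^ 2 * u + 1 - 8 * t ^ 2 =
      (1 - t * (\<xi> + \<eta>)) ^ 2 - 4 * t ^ 2 * (1 + \<xi>) * (1 + \<eta>)"
    using assms(1) unfolding u_def by algebra
  finally show ?thesis unfolding A_def .
qed

context
  fixes x :: "'a::field_char_0"
  assumes x: "x \<noteq> 0"
begin

lemma disc_root_square:
  "disc_root x ^ 2 = row_c x ^ 2 - 4 * fps_X ^ 2 * row_a x * row_a (inverse x)"
proof -
  have xx: "fps_const x * fps_const (inverse x) = 1"
    using x by simp
  have "(Jc * (1 - Jc) ^ 2) ^ 2 * disc_root x ^ 2 = (fps_X * W (inverse x) * W x) ^ 2"
    by (simp only: power_mult_distrib[symmetric] disc_root_eq)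
  also have "\<dots> = fps_X ^ 2 * (W x ^ 2 * W (inverse x) ^ 2)"
    by (simp only: power_mult_distrib ac_simps)
  also have "\<dots> = (Jc * (1 - Jc) ^ 2) ^ 2 *
      (row_c x ^ 2 - 4 * fps_X ^ 2 * row_a x * row_a (inverse x))"
    unfolding W_square slit_poly_prod[OF xx Jc_eq] row_c_def row_a_def ..
  finally show ?thesis
    by (subst (asm) mult_cancel_left) simp
qed

lemma row_D_nth_0: "fps_nth (row_D x) 0 = 1"
  by (simp add: row_D_def row_c_def disc_root_def fps_nth_power_0)

lemma inverse_row_D: "row_D x * inverse (row_D x) = 1"
  by (rule inverse_mult_eq_1') (simp add: row_D_nth_0)

lemma disc_root_inverse: "disc_root (inverse x) = disc_root x"
  by (simp add: disc_root_def mult_ac)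

lemma row_c_inverse: "row_c (inverse x) = row_c x"
  by (simp add: row_c_def add.commute)

lemma row_D_inverse: "row_D (inverse x) = row_D x"
  by (simp add: row_D_def disc_root_inverse row_c_inverse)

lemma row_U_eq: "row_D x * row_U x = fps_X * row_a x"
proof -
  have "row_D x * row_U x = fps_X * row_a x * (row_D x * inverse (row_D x))"
    by (simp only: row_U_def ac_simps)
  then show ?thesis by (simp only: inverse_row_D mult_1_right)
qed

lemma row_V_eq: "row_D x * row_U (inverse x) = fps_X * row_a (inverse x)"
proof -
  have "row_D x * row_U (inverse x) = fps_X * row_a (inverse x) * (row_D x * inverse (row_D x))"
    by (simp only: row_U_def row_D_inverse ac_simps)
  then show ?thesis by (simp only: inverse_row_D mult_1_right)
qed

text \<open>Put Q = \<open>disc_root x\<close>, so that D = (c + Q)/2. Then D^2 U V = t^2 a b = (c^2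
  - Q^2)/4, so D U V is the conjugate (c - Q)/2. The sum D + D U V is c and the difference is
  Q.\<close>

lemma row_D_eq: "row_D x * (1 + row_U x * row_U (inverse x)) = row_c x"
  and row_D_eq': "row_D x * (1 - row_U x * row_U (inverse x)) = disc_root x"
proof -
  define D Q c where "D = row_D x" "Q = disc_root x" "c = row_c x"
  have nz: "D \<noteq> 0"
    using row_D_nth_0 by (auto simp: D_Q_c_def)
  have two: "2 * D = c + Q"
  proof -
    have "2 * fps_const (1 / 2) = (1 :: 'a fps)"
      by (simp add: numeral_fps_const)
    then show ?thesis
      by (simp only: D_Q_c_def row_D_def mult.assoc[symmetric] mult_1_left)
  qed
  have uv: "D ^ 2 * (row_U x * row_U (inverse x)) = fps_X ^ 2 * row_a x * row_a (inverse x)"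
    unfolding D_Q_c_def power2_eq_square using row_U_eq row_V_eq by algebra
  have q: "Q ^ 2 = c ^ 2 - 4 * (D ^ 2 * (row_U x * row_U (inverse x)))"
    by (simp only: uv) (simp only: D_Q_c_def disc_root_square mult.assoc)
  have "4 * (D * (D * (1 + row_U x * row_U (inverse x)))) = 4 * (D * c)"
    using two q by algebra
  with nz show 1: "row_D x * (1 + row_U x * row_U (inverse x)) = row_c x"
    by (simp add: D_Q_c_def)
  show "row_D x * (1 - row_U x * row_U (inverse x)) = disc_root x"
    using two 1 unfolding D_Q_c_def by algebra
qed

lemma row_neg: "row x (- int k) = row_U (inverse x) ^ k * H x"
  by (simp add: row_def)

text \<open>With c = D (1 + U V), t a = D U and t b = D V, the geometric rows satisfy the recurrence
  identically for nonzero j. At j = 0 the powers change from V to U, and the defect D (1 - U V) H is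
  \<open>axis x\<close>.\<close>

lemma row_rec:
  "row_c x * row x j = fps_X * row_a x * row x (j - 1) + fps_X * row_a (inverse x) * row x (j + 1)
    + (if j = 0 then axis x else 0)"
proof -
  define D U V where "D = row_D x" "U = row_U x" "V = row_U (inverse x)"
  have c: "row_c x = D * (1 + U * V)" and u: "fps_X * row_a x = D * U"
    and v: "fps_X * row_a (inverse x) = D * V"
    unfolding D_U_V_def using row_D_eq row_U_eq row_V_eq by auto
  consider "j = 0" | k where "j = 1 + int k" | k where "j = - 1 - int k"
  proof -
    have "j = 0 \<or> j = 1 + int (nat (j - 1)) \<or> j = - 1 - int (nat (- j - 1))"
      by auto
    then show thesis using that by blast
  qed
  then show ?thesis
  proof cases
    case 1
    have "axis x = D * (1 - U * V) * H x"
      unfolding D_U_V_def row_D_eq' disc_root_mult_H ..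
    then show ?thesis
      unfolding c u v 1 row_def D_U_V_def[symmetric] by (simp add: algebra_simps)
  next
    case (2 k)
    then show ?thesis
      unfolding c u v row_def D_U_V_def[symmetric]
      by (simp add: nat_add_distrib algebra_simps)
  next
    case (3 k)
    then have j: "j = - int (Suc k)" "j - 1 = - int (Suc (Suc k))" "j + 1 = - int k"
      by simp_all
    have r: "row x j = V ^ Suc k * H x" "row x (j - 1) = V ^ Suc (Suc k) * H x"
      "row x (j + 1) = V ^ k * H x"
      using row_neg[of "Suc k"] row_neg[of "Suc (Suc k)"] row_neg[of k]
      by (simp_all only: j[symmetric] D_U_V_def)
    have "j \<noteq> 0" using j(1) by simp
    then show ?thesis
      unfolding c u v r by (simp add: algebra_simps)
  qed
qed

text \<open>From b = a/x follows V = U/x. This symmetry reduces the rows below the axis to those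
  above it.\<close>

lemma row_uminus: "row x (- int j) = fps_const (inverse x) ^ j * row x (int j)"
proof -
  have "row_a (inverse x) = fps_const (inverse x) * row_a x"
    using x by (simp add: row_a_def algebra_simps)
  then have "row_U (inverse x) = fps_const (inverse x) * row_U x"
    by (simp only: row_U_def row_D_inverse ac_simps)
  then show ?thesis
    by (auto simp: row_def power_mult_distrib simp flip: fps_const_power)
qed

lemma row_nth_0: "fps_nth (row x j) 0 = (if j = 0 then 1 else 0)"
  by (simp add: row_def row_U_def fps_nth_power_0)

end

end

section \<open>Counting walks that avoid a set\<close>

text \<open>One recursion serves slit walks and loops, whose forbidden half-axes differ by the
  origin. Time 0 is exempt, so that the walk may start on the forbidden set.\<close>

definition avoiding_walks ::
    "(int \<times> int) set \<Rightarrow> (int \<times> int) set \<Rightarrow> nat \<Rightarrow> (int \<times> int) list set" where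
  "avoiding_walks \<SS> F n = {w \<in> walks \<SS> n. \<forall>k\<in>{1..n}. w ! k \<notin> F}"

lemma slit_walks_eq: "slit_walks \<SS> = avoiding_walks \<SS> {(m, 0) |m. m \<le> 0}"
  by (rule ext) (simp add: slit_walks_def avoiding_walks_def)

lemma num_ending_at_loops:
  "num_ending_at (loops \<SS>) 0 0 = num_ending_at (avoiding_walks \<SS> {(m, 0) |m. m < 0}) 0 0"
proof
  fix n :: nat
  have "{0..n} = insert 0 {1..n}"
    by auto
  then have "(\<forall>k\<in>{0..n}. P k) \<longleftrightarrow> P 0 \<and> (\<forall>k\<in>{1..n}. P k)" for P
    by simp
  then have "{w \<in> loops \<SS> n. w ! n = (0, 0)} =
      {w \<in> avoiding_walks \<SS> {(m, 0) |m. m < 0} n. w ! n = (0, 0)}"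
    by (auto simp: loops_def avoiding_walks_def walks_def)
  then show "num_ending_at (loops \<SS>) 0 0 n =
      num_ending_at (avoiding_walks \<SS> {(m, 0) |m. m < 0}) 0 0 n"
    by (simp add: num_ending_at_def)
qed

lemma snoc_in_avoiding_walks:
  assumes "length v = Suc n"
  shows "v @ [p] \<in> avoiding_walks \<SS> F (Suc n) \<longleftrightarrow>
    v \<in> avoiding_walks \<SS> F n \<and> p - v ! n \<in> \<SS> \<and> p \<notin> F"
proof -
  have "{1..Suc n} = insert (Suc n) {1..n}"
    by auto
  then have all: "(\<forall>k\<in>{1..Suc n}. P k) \<longleftrightarrow> (\<forall>k\<in>{1..n}. P k) \<and> P (Suc n)" for P
    by auto
  have init: "(v @ [p]) ! k = v ! k" if "k \<le> n" for k
    using assms that by (simp add: nth_append)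
  have last: "(v @ [p]) ! Suc n = p"
    using assms by (simp add: nth_append)
  have "(\<forall>k\<in>{1..n}. (v @ [p]) ! k - (v @ [p]) ! (k - 1) \<in> \<SS>) \<longleftrightarrow>
      (\<forall>k\<in>{1..n}. v ! k - v ! (k - 1) \<in> \<SS>)"
    "(\<forall>k\<in>{1..n}. (v @ [p]) ! k \<notin> F) \<longleftrightarrow> (\<forall>k\<in>{1..n}. v ! k \<notin> F)"
    by (rule ball_cong; simp add: init le_diff_conv)+
  then show ?thesis
    using assms unfolding avoiding_walks_def walks_def all by (auto simp: init last)
qed

lemma avoiding_walks_Suc_ending:
  assumes "p \<notin> F"
  shows "{w \<in> avoiding_walks \<SS> F (Suc n). w ! Suc n = p} =
    (\<Union>s\<in>\<SS>. (\<lambda>v. v @ [p]) ` {v \<in> avoiding_walks \<SS> F n. v ! n = p - s})" (is "?L = ?R")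
proof
  show "?L \<subseteq> ?R"
  proof
    fix w assume w: "w \<in> ?L"
    then have len: "length w = Suc (Suc n)"
      by (simp add: avoiding_walks_def walks_def)
    then obtain v q where v: "w = v @ [q]" "length v = Suc n"
      by (metis length_append_singleton nat.inject rev_exhaust list.size(3) nat.distinct(1))
    with w have "q = p"
      by (auto simp: nth_append)
    with v w have "v \<in> avoiding_walks \<SS> F n" "p - v ! n \<in> \<SS>"
      using snoc_in_avoiding_walks[of v n] by auto
    moreover have "v ! n = p - (p - v ! n)"
      by simp
    ultimately show "w \<in> ?R"
      using v \<open>q = p\<close> by blast
  qed
  show "?R \<subseteq> ?L"
  proof
    fix w assume "w \<in> ?R"
    then obtain s v where "s \<in> \<SS>" "w = v @ [p]" "v \<in> avoiding_walks \<SS> F n" "v ! n = p - s"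
      by blast
    moreover from this have "length v = Suc n"
      by (simp add: avoiding_walks_def walks_def)
    ultimately show "w \<in> ?L"
      using snoc_in_avoiding_walks[of v n p] assms by (auto simp: nth_append)
  qed
qed

lemma finite_walks:
  assumes "finite \<SS>"
  shows "finite (walks \<SS> n)"
proof (induction n)
  case 0
  have "w = [(0, 0)]" if "w \<in> walks \<SS> 0" for w
    using that by (cases w) (auto simp: walks_def)
  then have "walks \<SS> 0 \<subseteq> {[(0, 0)]}" by auto
  then show ?case by (rule finite_subset) simp
next
  case (Suc n)
  have "walks \<SS> (Suc n) \<subseteq> (\<lambda>(v, s). v @ [v ! n + s]) ` (walks \<SS> n \<times> \<SS>)"
  proof
    fix w assume w: "w \<in> walks \<SS> (Suc n)"
    then have "length w = Suc (Suc n)" by (simp add: walks_def)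
    then obtain v q where v: "w = v @ [q]" "length v = Suc n"
      by (metis length_append_singleton nat.inject rev_exhaust list.size(3) nat.distinct(1))
    with w have "v @ [q] \<in> avoiding_walks \<SS> {} (Suc n)"
      by (simp add: avoiding_walks_def)
    then have "v \<in> walks \<SS> n" "q - v ! n \<in> \<SS>"
      using snoc_in_avoiding_walks[OF v(2), of q \<SS> "{}"] by (simp_all add: avoiding_walks_def)
    then show "w \<in> (\<lambda>(v, s). v @ [v ! n + s]) ` (walks \<SS> n \<times> \<SS>)"
      using v by (intro image_eqI[of _ _ "(v, q - v ! n)"]) auto
  qed
  then show ?case
    by (rule finite_subset) (use Suc assms in auto)
qed

lemma finite_avoiding_walks: "finite \<SS> \<Longrightarrow> finite (avoiding_walks \<SS> F n)"
  by (rule finite_subset[OF _ finite_walks[of \<SS> n]]) (auto simp: avoiding_walks_def)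

lemma card_avoiding_walks_Suc:
  assumes "finite \<SS>"
  shows "card {w \<in> avoiding_walks \<SS> F (Suc n). w ! Suc n = p} =
    (if p \<in> F then 0 else \<Sum>s\<in>\<SS>. card {w \<in> avoiding_walks \<SS> F n. w ! n = p - s})"
proof (cases "p \<in> F")
  case True
  then have "{w \<in> avoiding_walks \<SS> F (Suc n). w ! Suc n = p} = {}"
    by (auto simp: avoiding_walks_def)
  then show ?thesis using True by (simp only: card.empty if_True)
next
  case False
  have "card {w \<in> avoiding_walks \<SS> F (Suc n). w ! Suc n = p} =
      (\<Sum>s\<in>\<SS>. card ((\<lambda>v. v @ [p]) ` {v \<in> avoiding_walks \<SS> F n. v ! n = p - s}))"
    unfolding avoiding_walks_Suc_ending[OF False]
    using assms finite_avoiding_walks[OF assms, of F n]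
    by (intro card_UN_disjoint) auto
  then show ?thesis
    using False by (simp add: card_image inj_on_def)
qed

lemma card_avoiding_walks_0:
  "card {w \<in> avoiding_walks \<SS> F 0. w ! 0 = p} = (if p = (0, 0) then 1 else 0)"
proof -
  have "{w \<in> avoiding_walks \<SS> F 0. w ! 0 = p} = (if p = (0, 0) then {[(0, 0)]} else {})"
  proof -
    have "w = [(0, 0)]" if "length w = Suc 0" "w ! 0 = (0, 0)" for w :: "(int \<times> int) list"
      using that by (cases w) auto
    then show ?thesis
      by (auto simp: avoiding_walks_def walks_def)
  qed
  then show ?thesis by simp
qed

lemma sum_triangular_steps:
  "(\<Sum>s\<in>triangular_steps. f ((i, j) - s)) = f (i, j - 1) + f (i - 1, j) + f (i - 1, j - 1)
    + f (i, j + 1) + f (i + 1, j) + f (i + 1, j + 1)"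
  by (simp add: triangular_steps_def add.assoc)

definition triangular_sum :: "(int \<Rightarrow> int \<Rightarrow> 'a::comm_monoid_add) \<Rightarrow> int \<Rightarrow> int \<Rightarrow> 'a" where
  "triangular_sum f i j = f i (j - 1) + f (i - 1) j + f (i - 1) (j - 1)
    + f i (j + 1) + f (i + 1) j + f (i + 1) (j + 1)"

text \<open>The verification principle: numbers with the right initial values that obey the
  last-step recurrence, including the zeros on the forbidden set, must be the counts.\<close>

lemma num_ending_at_eqI:
  fixes f :: "nat \<Rightarrow> int \<Rightarrow> int \<Rightarrow> rat"
  assumes zero: "\<And>i j. f 0 i j = (if i = 0 \<and> j = 0 then 1 else 0)"
    and Suc: "\<And>n i j. f (Suc n) i j = (if (i, j) \<in> F then 0 else triangular_sum (f n) i j)"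
  shows "of_nat (num_ending_at (avoiding_walks triangular_steps F) i j n) = f n i j"
proof (induction n arbitrary: i j)
  case 0
  then show ?case
    by (simp add: num_ending_at_def card_avoiding_walks_0 zero)
next
  case (Suc n)
  have "finite triangular_steps" by (simp add: triangular_steps_def)
  then have "num_ending_at (avoiding_walks triangular_steps F) i j (Suc n) =
      (if (i, j) \<in> F then 0
       else triangular_sum (\<lambda>i j. num_ending_at (avoiding_walks triangular_steps F) i j n) i j)"
    by (simp only: num_ending_at_def card_avoiding_walks_Suc triangular_sum_def
        sum_triangular_steps[of "\<lambda>p. card {w \<in> avoiding_walks triangular_steps F n. w ! n = p}"])
  then show ?case
    by (simp add: assms(2) triangular_sum_def Suc)
qed

lemma finite_num_ending_at:
  assumes "finite (W n)"
  shows "finite {(i, j). num_ending_at W i j n \<noteq> 0}"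
proof (rule finite_subset)
  show "{(i, j). num_ending_at W i j n \<noteq> 0} \<subseteq> (\<lambda>w. w ! n) ` W n"
  proof clarify
    fix i j assume "0 < num_ending_at W i j n"
    then have "{w \<in> W n. w ! n = (i, j)} \<noteq> {}"
      unfolding num_ending_at_def by (metis card.empty less_irrefl)
    then show "(i, j) \<in> (\<lambda>w. w ! n) ` W n" by force
  qed
qed (use assms in simp)

section \<open>Laurent series in two variables\<close>

lemma field_hom_fls_const: "field_hom (fls_const :: 'a::field \<Rightarrow> 'a fls)"
  by unfold_locales (simp_all add: fls_plus_const)

lemma of_rat_fls: "(of_rat q :: 'a::field_char_0 fls) = fls_const (of_rat q)"
  by (rule field_hom_of_rat[OF field_hom_fls_const, symmetric])

lemma ev_pCons: "ev c (pCons a p) = of_rat a + c * ev c p"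
  by (cases "a = 0 \<and> p = 0") (auto simp: ev_def map_poly_pCons)

lemma ev_0 [simp]: "ev c 0 = 0"
  by (simp add: ev_def)

lemma ev_0_eq_coeff: "ev 0 p = of_rat (coeff p 0)"
  by (cases p) (simp add: ev_pCons)

text \<open>Series in \<open>\<rat>((y))((1/x))\<close>; the outer variable is \<open>1/x\<close>.\<close>

type_synonym laurent_xy = "rat fls fls"

text \<open>Taking 1/x as the outer variable makes the constant coefficient the value at x =
  infinity, where the degrees are examined later. Consequently the power x^i sits at index
  -i.\<close>

definition lx :: laurent_xy where "lx = fls_X_inv"

definition ly :: laurent_xy where "ly = fls_const fls_X"

lemma lx_nz [simp]: "lx \<noteq> 0" and ly_nz [simp]: "ly \<noteq> 0"
  by (simp_all add: lx_def ly_def)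

lemma inverse_lx: "inverse lx = fls_X"
  by (simp add: lx_def fls_inverse_X_inv)

lemma inverse_ly: "inverse ly = fls_const fls_X_inv"
  by (simp add: ly_def field_hom.hom_inverse[OF field_hom_fls_const, symmetric] fls_inverse_X)

lemma lx_times_nth [simp]: "(lx * f) $$ k = f $$ (k + 1)"
  by (simp add: lx_def fls_X_inv_times_conv_shift)

lemma inverse_lx_times_nth [simp]: "(inverse lx * f) $$ k = f $$ (k - 1)"
  by (simp add: inverse_lx fls_X_times_conv_shift)

lemma ly_times_nth [simp]: "(ly * f) $$ k $$ l = f $$ k $$ (l - 1)"
  by (simp add: ly_def fls_X_times_conv_shift)

lemma inverse_ly_times_nth [simp]: "(inverse ly * f) $$ k $$ l = f $$ k $$ (l + 1)"
  by (simp add: inverse_ly fls_X_inv_times_conv_shift)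

lemma ev_lx_nth: "ev lx p $$ k $$ l = (if k \<le> 0 \<and> l = 0 then coeff p (nat (- k)) else 0)"
proof (induction p arbitrary: k)
  case (pCons a p)
  have "nat (- k) = Suc (nat (- 1 - k))" if "k < 0"
    using that by simp
  then show ?case
    using pCons by (auto simp: ev_pCons of_rat_fls algebra_simps)
qed simp

lemma ev_inverse_lx_nth:
  "ev (inverse lx) p $$ k $$ l = (if k \<ge> 0 \<and> l = 0 then coeff p (nat k) else 0)"
proof (induction p arbitrary: k)
  case (pCons a p)
  have "nat k = Suc (nat (k - 1))" if "k > 0"
    using that by simp
  then show ?case
    using pCons by (auto simp: ev_pCons of_rat_fls algebra_simps)
qed simp

definition bev :: "rat poly poly \<Rightarrow> laurent_xy" where
  "bev p = poly (map_poly (ev lx) p) ly"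

lemma unital_ring_hom_bev: "unital_ring_hom bev"
proof -
  interpret e: unital_ring_hom "ev lx" by (rule unital_ring_hom_ev)
  interpret m: unital_ring_hom "map_poly (ev lx)" by (rule e.unital_ring_hom_map_poly)
  show ?thesis
    by unfold_locales (simp_all add: bev_def m.homs)
qed

lemma bev_nth:
  "bev p $$ k $$ l = (if k \<le> 0 \<and> l \<ge> 0 then coeff (coeff p (nat l)) (nat (- k)) else 0)"
proof (induction p arbitrary: l)
  case 0
  then show ?case by (simp add: bev_def)
next
  case (pCons a p)
  interpret e: unital_ring_hom "ev lx" by (rule unital_ring_hom_ev)
  have "nat l = Suc (nat (l - 1))" if "l > 0"
    using that by simp
  moreover have "bev (pCons a p) = ev lx a + ly * bev p"
    by (simp add: bev_def e.map_poly_pCons_hom)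
  ultimately show ?case
    using pCons by (auto simp: ev_lx_nth coeff_pCons)
qed

lemma bev_eq_0_iff [simp]: "bev p = 0 \<longleftrightarrow> p = 0"
proof
  assume "bev p = 0"
  then have "coeff (coeff p j) i = 0" for i j
    using bev_nth[of p "- int i" "int j"] by simp
  then show "p = 0"
    by (simp add: poly_eq_iff)
qed (simp add: bev_def)

text \<open>The inclusion of Q(x,y) in the Laurent series, induced by \<open>bev\<close> on
  numerators and denominators. It makes the coefficient of x^i y^j of a rational function
  accessible.\<close>

definition emb :: "ratfun_xy \<Rightarrow> laurent_xy" where
  "emb q = (THE r. \<exists>a b. b \<noteq> 0 \<and> q = Fract a b \<and> r = bev a / bev b)"

lemma emb_Fract:
  assumes "b \<noteq> 0"
  shows "emb (Fract a b) = bev a / bev b"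
proof -
  interpret b: unital_ring_hom bev by (rule unital_ring_hom_bev)
  have "bev c / bev d = bev a / bev b" if "d \<noteq> 0" "Fract a b = Fract c d" for c d
  proof -
    have "a * d = c * b"
      using assms that by (simp add: eq_fract)
    then have "bev a * bev d = bev c * bev b"
      by (metis b.hom_mult)
    then show ?thesis
      using assms that by (simp add: divide_simps)
  qed
  then show ?thesis
    unfolding emb_def using assms by (intro the_equality) blast+
qed

lemma field_hom_emb: "field_hom emb"
proof -
  interpret b: unital_ring_hom bev by (rule unital_ring_hom_bev)
  show ?thesis
  proof unfold_locales
    fix p q :: ratfun_xy
    obtain a b where p: "p = Fract a b" "b \<noteq> 0" by (cases p) auto
    obtain c d where q: "q = Fract c d" "d \<noteq> 0" by (cases q) auto
    show "emb (p + q) = emb p + emb q"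
      using p q by (simp add: emb_Fract b.homs divide_simps)
    show "emb (p * q) = emb p * emb q"
      using p q by (simp add: emb_Fract b.homs)
  next
    show "emb 1 = 1"
      by (simp add: One_fract_def emb_Fract b.homs)
  qed
qed

lemma emb_var_x: "emb var_x = lx"
proof -
  interpret e: unital_ring_hom "ev lx" by (rule unital_ring_hom_ev)
  interpret b: unital_ring_hom bev by (rule unital_ring_hom_bev)
  have "emb var_x = bev [:[:0, 1:]:] / bev 1"
    unfolding var_x_def to_fract_def by (rule emb_Fract) simp
  then show ?thesis
    by (simp add: b.homs) (simp add: bev_def e.map_poly_pCons_hom)
qed

lemma emb_var_y: "emb var_y = ly"
proof -
  interpret e: unital_ring_hom "ev lx" by (rule unital_ring_hom_ev)
  interpret b: unital_ring_hom bev by (rule unital_ring_hom_bev)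
  have "emb var_y = bev [:0, 1:] / bev 1"
    unfolding var_y_def to_fract_def by (rule emb_Fract) simp
  then show ?thesis
    by (simp add: b.homs) (simp add: bev_def e.map_poly_pCons_hom e.homs)
qed

lemma monomial_nth:
  "(lx powi i * ly powi j) $$ k $$ l = (if k = - i \<and> l = j then 1 else 0)"
proof -
  have x: "(lx powi i * f) $$ k = f $$ (k + i)" for f k
  proof (cases "i \<ge> 0")
    case True
    have "(lx ^ n * f) $$ k = f $$ (k + int n)" for n
      by (induction n arbitrary: k) (simp_all add: mult.assoc add.assoc diff_diff_eq)
    from this[of "nat i"] True show ?thesis
      by (simp add: power_int_def)
  next
    case False
    have "(inverse lx ^ n * f) $$ k = f $$ (k - int n)" for n
      by (induction n arbitrary: k) (simp_all add: mult.assoc add.assoc diff_diff_eq)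
    from this[of "nat (- i)"] False show ?thesis
      by (simp add: power_int_def)
  qed
  have y: "(ly powi j * f) $$ k $$ l = f $$ k $$ (l - j)" for f k l
  proof (cases "j \<ge> 0")
    case True
    have "(ly ^ n * f) $$ k $$ l = f $$ k $$ (l - int n)" for n
      by (induction n arbitrary: l) (simp_all add: mult.assoc add.assoc diff_diff_eq)
    from this[of "nat j"] True show ?thesis
      by (simp add: power_int_def)
  next
    case False
    have "(inverse ly ^ n * f) $$ k $$ l = f $$ k $$ (l + int n)" for n
      by (induction n arbitrary: l) (simp_all add: mult.assoc add.assoc diff_diff_eq)
    from this[of "nat (- j)"] False show ?thesis
      by (simp add: power_int_def)
  qed
  show ?thesis
    using y[of 1 "k + i" l] by (auto simp: x)
qed

lemma emb_gf_xy_nth: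
  assumes "\<And>n. finite (W n)"
  shows "fps_nth (fps_map emb (gf_xy W)) n $$ k $$ l = of_nat (num_ending_at W (- k) l n)"
proof -
  interpret emb: field_hom emb by (rule field_hom_emb)
  define A where "A = {(i, j). num_ending_at W i j n \<noteq> 0}"
  have fin: "finite A"
    unfolding A_def using assms by (rule finite_num_ending_at)
  have "emb (fps_nth (gf_xy W) n) =
      (\<Sum>(i, j)\<in>A. of_nat (num_ending_at W i j n) * (lx powi i * ly powi j))"
    by (simp add: gf_xy_def A_def emb.homs emb.hom_powi emb_var_x emb_var_y
        case_prod_unfold mult.assoc)
  moreover have "(of_nat m * f) $$ k $$ l = of_nat m * f $$ k $$ l" for m and f :: laurent_xy
    by (induction m) (simp_all add: distrib_right)
  ultimately have "emb (fps_nth (gf_xy W) n) $$ k $$ l =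
      (\<Sum>(i, j)\<in>A. of_nat (num_ending_at W i j n) * (if k = - i \<and> l = j then 1 else 0))"
    by (simp only: fls_nth_sum case_prod_unfold monomial_nth)
  also have "\<dots> = (\<Sum>p\<in>A. if p = (- k, l) then of_nat (num_ending_at W (- k) l n) else 0)"
    by (rule sum.cong) (auto split: if_splits)
  also have "\<dots> = of_nat (num_ending_at W (- k) l n)"
    using fin by (auto simp: A_def)
  finally show ?thesis by simp
qed

section \<open>The generating functions\<close>

lemma fps_map_inverse:
  assumes "field_hom h" "fps_nth f 0 \<noteq> 0"
  shows "fps_map h (inverse f) = inverse (fps_map h f)"
proof -
  interpret h: field_hom h by fact
  interpret m: unital_ring_hom "fps_map h" by (rule h.unital_ring_hom_fps_map)
  have "fps_map h f * fps_map h (inverse f) = 1"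
    by (simp only: m.hom_mult[symmetric] inverse_mult_eq_1'[OF assms(2)] m.hom_one)
  then show ?thesis
    by (rule fps_inverse_unique[symmetric])
qed

section \<open>The candidates are the generating functions\<close>

context J_series
begin

lemma Jc_rat [simp]: "(Jc :: rat fps) = J"
  by (rule fps_ext) (simp add: Jc_def)

lemma fps_map_Jc:
  fixes h :: "'a::field_char_0 \<Rightarrow> 'b::field_char_0"
  assumes "field_hom h"
  shows "fps_map h Jc = Jc"
  by (simp add: Jc_def fps_map_fps_map field_hom_of_rat[OF assms])

lemma fps_map_Lc:
  fixes h :: "'a::field_char_0 \<Rightarrow> 'b::field_char_0"
  assumes "field_hom h"
  shows "fps_map h Lc = Lc"
  by (rule fps_ext) (simp add: Lc_def flip: fps_map_Jc[OF assms])

text \<open>This is t / (J (1 - J)), the factor of \<open>axis\<close> that does not involve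
  x.\<close>

definition axis_coeff :: "rat fps" where
  "axis_coeff = inverse Lc * inverse (1 - J)"

text \<open>The variable of the polynomials stands for 1/x here, in contrast to
  \<open>Hp\<close>.\<close>

definition axp :: "rat poly fps" where
  "axp = fps_map (\<lambda>c. [:c:]) axis_coeff * Wp"

lemma field_hom_rat: "field_hom (of_rat :: rat \<Rightarrow> 'a::field_char_0)"
  using unital_ring_hom_of_rat by (simp add: field_hom_def)

lemma axis_ev: "axis x = fps_map (ev (inverse x)) axp" for x :: "'a::field_char_0"
proof -
  interpret ev: unital_ring_hom "ev (inverse x)" by (rule unital_ring_hom_ev)
  interpret m: unital_ring_hom "fps_map (ev (inverse x))" by (rule ev.unital_ring_hom_fps_map)
  interpret r: field_hom "of_rat :: rat \<Rightarrow> 'a" by (rule field_hom_rat)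
  interpret rm: unital_ring_hom "fps_map (of_rat :: rat \<Rightarrow> 'a)" by (rule r.unital_ring_hom_fps_map)
  have "fps_map (ev (inverse x)) axp = fps_map of_rat axis_coeff * W (inverse x)"
    by (simp add: axp_def m.homs W_def fps_map_fps_map)
  also have "fps_map of_rat axis_coeff = (inverse Lc * inverse (1 - Jc) :: 'a fps)"
    using fps_map_Jc[OF field_hom_rat[where 'a = 'a]] fps_map_Lc[OF field_hom_rat[where 'a = 'a]]
    by (simp add: axis_coeff_def rm.homs fps_map_inverse[OF field_hom_rat] J_nth_0)
  finally show ?thesis
    by (simp add: axis_def)
qed

lemma W_0: "W 0 = 1 - Jc"
  by (rule fps_sqrt_unique) (simp_all add: W_square slit_poly_def)

lemma H_0: "H 0 = 1"
proof -
  have "H 0 * (1 - Jc) = 1 * (1 - Jc :: 'a fps)"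
    using H_mult_W[of "0 :: 'a"] by (simp add: W_0)
  then show ?thesis
    by (simp only: mult_cancel_right Jc_neq_1) simp
qed

text \<open>At x = 0 the square root is 1 - J and cancels the numerator of \<open>Hp\<close>.
  Combinatorially, only the empty slit walk ends at the origin.\<close>

lemma coeff_Hp_0: "coeff (fps_nth Hp n) 0 = (if n = 0 then 1 else 0)"
  using arg_cong[OF H_0[where 'a = rat], of "\<lambda>f. fps_nth f n"]
  by (simp add: H_def ev_0_eq_coeff)

text \<open>At 1/x = 0 the square root is 1 - J, which leaves t/J. The formula for the loops comes
  from this value.\<close>

lemma coeff_axp_0: "coeff (fps_nth axp n) 0 = fps_nth (inverse Lc) n"
proof -
  have "fps_map (ev 0) axp = (inverse Lc :: rat fps)"
  proof -
    have "inverse (1 - J) * (1 - J) = 1"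
      by (rule inverse_mult_eq_1) (simp add: J_nth_0)
    then show ?thesis
      using axis_ev[of "0 :: rat"] by (simp add: axis_def W_0 mult.assoc)
  qed
  then have "fps_nth (fps_map (ev 0) axp) n = fps_nth (inverse Lc :: rat fps) n"
    by simp
  then show ?thesis
    by (simp add: ev_0_eq_coeff)
qed

definition slit_count :: "nat \<Rightarrow> int \<Rightarrow> int \<Rightarrow> rat" where
  "slit_count n i j = fps_nth (row lx j) n $$ (- i) $$ 0"

definition axis_count :: "nat \<Rightarrow> int \<Rightarrow> int \<Rightarrow> rat" where
  "axis_count n i j = (if i \<le> 0 \<and> j = 0 then coeff (fps_nth axp n) (nat (- i)) else 0)"

lemma axis_nth: "fps_nth (axis lx) n $$ k $$ l = axis_count n (- k) l"
  by (simp add: axis_ev ev_inverse_lx_nth axis_count_def)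

lemma H_nth: "fps_nth (H lx) n $$ k $$ l =
    (if k \<le> 0 \<and> l = 0 then coeff (fps_nth Hp n) (nat (- k)) else 0)"
  by (simp add: H_def ev_lx_nth)

lemma slit_count_axis: "slit_count n i 0 = (if i \<ge> 0 then coeff (fps_nth Hp n) (nat i) else 0)"
  by (simp add: slit_count_def row_def H_nth)

lemma slit_count_0: "slit_count 0 i j = (if i = 0 \<and> j = 0 then 1 else 0)"
  by (simp add: slit_count_def row_nth_0)

lemma slit_count_Suc:
  "slit_count (Suc n) i j = triangular_sum (slit_count n) i j + axis_count (Suc n) i j"
proof -
  have "fps_nth (row_c lx * row lx j) (Suc n) =
      fps_nth (fps_X * row_a lx * row lx (j - 1) + fps_X * row_a (inverse lx) * row lx (j + 1)
        + (if j = 0 then axis lx else 0)) (Suc n)"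
    by (simp only: row_rec[OF lx_nz])
  then have "fps_nth (row lx j) (Suc n) =
      lx * fps_nth (row lx j) n + inverse lx * fps_nth (row lx j) n
      + fps_nth (row lx (j - 1)) n + lx * fps_nth (row lx (j - 1)) n
      + fps_nth (row lx (j + 1)) n + inverse lx * fps_nth (row lx (j + 1)) n
      + (if j = 0 then fps_nth (axis lx) (Suc n) else 0)"
    by (simp add: row_c_def row_a_def left_diff_distrib distrib_right mult.assoc algebra_simps)
  then show ?thesis
    by (simp add: slit_count_def triangular_sum_def axis_nth axis_count_def)
qed

lemma slit_count_uminus: "slit_count n i (- int j) = slit_count n (i + int j) (int j)"
proof -
  have shift: "(inverse lx ^ m * f) $$ k = f $$ (k - int m)" for m f k
    by (induction m arbitrary: k) (simp_all add: mult.assoc diff_diff_eq)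
  have "fps_nth (row lx (- int j)) n = inverse lx ^ j * fps_nth (row lx (int j)) n"
    by (simp add: row_uminus[OF lx_nz])
  moreover have "- i - int j = - (i + int j)"
    by simp
  ultimately show ?thesis
    by (simp only: slit_count_def shift)
qed

text \<open>On the slit the candidate vanishes for positive lengths, because \<open>Hp\<close> has
  no negative powers of x and its constant coefficient is 1. Off the slit the term
  \<open>axis_count\<close> is zero, so the recurrence is the one of the walks.\<close>

lemma slit_count_correct:
  "of_nat (num_ending_at (slit_walks triangular_steps) i j n) = slit_count n i j"
  unfolding slit_walks_eq
proof (rule num_ending_at_eqI)
  fix n i j
  have "slit_count (Suc n) i j = 0" if "i \<le> 0" "j = 0"
    using that by (cases "i = 0") (simp_all add: slit_count_axis coeff_Hp_0)
  moreover have "slit_count (Suc n) i j = triangular_sum (slit_count n) i j"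
    if "\<not> (i \<le> 0 \<and> j = 0)"
    using that by (auto simp: slit_count_Suc axis_count_def)
  ultimately show "slit_count (Suc n) i j =
      (if (i, j) \<in> {(m, 0) |m. m \<le> 0} then 0 else triangular_sum (slit_count n) i j)"
    by auto
qed (simp add: slit_count_0)

definition slit_series :: "int \<Rightarrow> int \<Rightarrow> rat fps" where
  "slit_series i j = Abs_fps (\<lambda>n. slit_count n i j)"

lemma S_end_gf_eq: "S_end_gf triangular_steps i j = slit_series i j"
  by (rule fps_ext) (simp add: S_end_gf_def gf_ending_at_def slit_series_def slit_count_correct)

definition axis_series :: "int \<Rightarrow> int \<Rightarrow> rat fps" where
  "axis_series i j = Abs_fps (\<lambda>n. axis_count n i j)"

text \<open>At length 0 the starting point is supplied by \<open>axis_series 0 0\<close>, whose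
  constant term is 1.\<close>

lemma slit_series_eq:
  "slit_series i j = fps_X * triangular_sum slit_series i j + axis_series i j"
proof (rule fps_ext)
  fix n
  have "coeff (fps_nth axp 0) k = (if k = 0 then 1 else 0)" for k
    by (simp add: axp_def Wp_nth_0 axis_coeff_def J_nth_0 coeff_pCons split: nat.split)
  then show "fps_nth (slit_series i j) n =
      fps_nth (fps_X * triangular_sum slit_series i j + axis_series i j) n"
    by (cases n) (simp_all add: slit_series_def axis_series_def slit_count_0 axis_count_def
        slit_count_Suc triangular_sum_def)
qed

text \<open>A walk avoiding the negative half-axis is a loop followed by a walk on the slit plane. Thus
  \<open>Lc * slit_series\<close> must satisfy the recurrence of those walks, and this is what is checked.\<close>

lemma L_gf_eq: "L_gf triangular_steps = Lc"
proof -
  define q where "q n i j = fps_nth (Lc * slit_series i j) n" for n i j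
  have slit: "slit_series i 0 = (if i = 0 then 1 else 0)" if "i \<le> 0" for i
    by (rule fps_ext) (use that in \<open>simp add: slit_series_def slit_count_axis coeff_Hp_0\<close>)
  have ax: "axis_series i j = (if i = 0 then inverse Lc else 0)" if "j = 0 \<longrightarrow> i \<ge> 0" "i = 0 \<longrightarrow> j = 0" for i j
    by (rule fps_ext) (use that in \<open>auto simp add: axis_series_def axis_count_def coeff_axp_0\<close>)
  have rec: "q (Suc n) i j = triangular_sum (q n) i j + fps_nth (Lc * axis_series i j) (Suc n)"
    for n i j
  proof -
    have "Lc * slit_series i j =
        fps_X * triangular_sum (\<lambda>i j. Lc * slit_series i j) i j + Lc * axis_series i j"
      by (subst slit_series_eq) (simp add: triangular_sum_def algebra_simps)
    then have "q (Suc n) i j =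
        fps_nth (fps_X * triangular_sum (\<lambda>i j. Lc * slit_series i j) i j + Lc * axis_series i j) (Suc n)"
      by (simp only: q_def)
    then show ?thesis
      by (simp add: q_def triangular_sum_def)
  qed
  have "of_nat (num_ending_at (avoiding_walks triangular_steps {(m, 0) |m. m < 0}) i j n) = q n i j"
    for i j n
  proof (rule num_ending_at_eqI)
    fix i j
    show "q 0 i j = (if i = 0 \<and> j = 0 then 1 else 0)"
      by (simp add: q_def slit_series_def slit_count_0)
  next
    fix n i j
    show "q (Suc n) i j = (if (i, j) \<in> {(m, 0) |m. m < 0} then 0 else triangular_sum (q n) i j)"
    proof (cases "(i, j) \<in> {(m, 0) |m. m < 0}")
      case True
      then show ?thesis by (auto simp: q_def slit)
    next
      case False
      \<comment> \<open>At the origin \<open>Lc * axis_series i j\<close> is L times 1/L, which is 1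
        and contributes to length 0 only; at the other allowed points \<open>axis_series\<close> is
        zero.\<close>
      have "fps_nth (Lc * axis_series i j) (Suc n) = 0"
      proof (cases "i = 0 \<and> j = 0")
        case True
        then show ?thesis using inverse_Lc[where 'a = rat] by (simp add: ax)
      next
        case F: False
        have "axis_series i j = 0"
          by (rule fps_ext) (use False F in \<open>auto simp: axis_series_def axis_count_def\<close>)
        then show ?thesis by simp
      qed
      with False show ?thesis by (simp only: rec if_False add_0_right)
    qed
  qed
  then show ?thesis
    by (intro fps_ext) (simp add: L_gf_def gf_ending_at_def num_ending_at_loops q_def slit)
qed

definition kernel :: "'a::field \<Rightarrow> 'a \<Rightarrow> 'a" where
  "kernel x y = x + inverse x + y * (1 + x) + inverse y * (1 + inverse x)"

lemma finite_slit_walks: "finite (slit_walks triangular_steps n)"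
  unfolding slit_walks_eq by (rule finite_avoiding_walks) (simp add: triangular_steps_def)

text \<open>Multiplication by 1 - t times the step polynomial subtracts from each candidate count
  the sum over all last steps, and \<open>axis_count\<close> remains. The comparison is made on
  Laurent coefficients and pulled back by the injectivity of \<open>emb\<close>.\<close>

lemma S_gf_eq:
  "S_gf triangular_steps * (1 - fps_X * fps_const (kernel var_x var_y)) = axis var_x"
proof -
  interpret e: field_hom emb by (rule field_hom_emb)
  interpret m: unital_ring_hom "fps_map emb" by (rule e.unital_ring_hom_fps_map)
  have S: "fps_nth (fps_map emb (S_gf triangular_steps)) n $$ k $$ l = slit_count n (- k) l" for n k l
    using emb_gf_xy_nth[where W = "slit_walks triangular_steps", OF finite_slit_walks, of n k l]
    by (simp add: S_gf_def slit_count_correct)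
  have k: "emb (kernel var_x var_y) = kernel lx ly"
    by (simp add: kernel_def e.homs e.hom_inverse emb_var_x emb_var_y)
  have "fps_map emb (S_gf triangular_steps) * (1 - fps_X * fps_const (kernel lx ly)) = axis lx"
  proof (rule fps_ext, rule fls_eqI, rule fls_eqI)
    fix n k l
    have kern: "(f * kernel lx ly) $$ k $$ l = f $$ (k + 1) $$ l + f $$ (k - 1) $$ l +
        f $$ k $$ (l - 1) + f $$ (k + 1) $$ (l - 1) + f $$ k $$ (l + 1) + f $$ (k - 1) $$ (l + 1)"
      for f :: laurent_xy
    proof -
      have "f * kernel lx ly = lx * f + inverse lx * f + ly * f + ly * (lx * f) + inverse ly * f +
          inverse ly * (inverse lx * f)"
        by (simp add: kernel_def algebra_simps)
      then show ?thesis by (simp del: fps_map_nth)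
    qed
    show "fps_nth (fps_map emb (S_gf triangular_steps) * (1 - fps_X * fps_const (kernel lx ly))) n $$ k $$ l =
        fps_nth (axis lx) n $$ k $$ l"
    proof (cases n)
      case 0
      have "slit_count 0 (- k) l = axis_count 0 (- k) l"
        using arg_cong[OF slit_series_eq[of "- k" l], of "\<lambda>f. fps_nth f 0"]
        by (simp add: slit_series_def axis_series_def)
      then show ?thesis
        using 0 S[of 0 k l] by (simp add: axis_nth)
    next
      case (Suc m)
      have "fps_nth (fps_map emb (S_gf triangular_steps) * (1 - fps_X * fps_const (kernel lx ly))) n =
          fps_nth (fps_map emb (S_gf triangular_steps)) (Suc m)
          - fps_nth (fps_map emb (S_gf triangular_steps)) m * kernel lx ly"
        by (simp add: Suc right_diff_distrib mult.left_commute[of _ fps_X] del: fps_map_nth)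
      then show ?thesis
        by (simp add: kern S axis_nth Suc slit_count_Suc triangular_sum_def del: fps_map_nth)
    qed
  qed
  also have "\<dots> = fps_map emb (axis var_x)"
    by (simp add: axis_ev fps_map_fps_map field_hom_ev[OF field_hom_emb] e.hom_inverse emb_var_x)
  finally show ?thesis
    by (simp add: e.fps_map_inj[symmetric] m.homs e.fps_map_X e.fps_map_const k)
qed

lemma S0_gf_eq: "S0_gf triangular_steps = H var_x"
proof -
  interpret e: field_hom emb by (rule field_hom_emb)
  have fin: "finite (bilateral_slit_walks triangular_steps n)" for n
    by (rule finite_subset[OF _ finite_slit_walks[of n]]) (auto simp: bilateral_slit_walks_def)
  have num: "num_ending_at (bilateral_slit_walks triangular_steps) i j n =
      (if j = 0 then num_ending_at (slit_walks triangular_steps) i j n else 0)" for i j n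
  proof -
    have "{w \<in> bilateral_slit_walks triangular_steps n. w ! n = (i, j)} =
        (if j = 0 then {w \<in> slit_walks triangular_steps n. w ! n = (i, j)} else {})"
      by (auto simp: bilateral_slit_walks_def)
    then show ?thesis by (simp add: num_ending_at_def)
  qed
  have "fps_map emb (S0_gf triangular_steps) = H lx"
  proof (rule fps_ext, rule fls_eqI, rule fls_eqI)
    fix n k l
    show "fps_nth (fps_map emb (S0_gf triangular_steps)) n $$ k $$ l = fps_nth (H lx) n $$ k $$ l"
      using emb_gf_xy_nth[where W = "bilateral_slit_walks triangular_steps", OF fin, of n k l]
        slit_count_correct[of "- k" l n]
      by (cases "l = 0") (simp_all add: S0_gf_def num slit_count_axis H_nth)
  qed
  also have "H lx = fps_map emb (H var_x)"
    by (simp add: H_def fps_map_fps_map field_hom_ev[OF field_hom_emb] emb_var_x)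
  finally show ?thesis
    by (simp add: e.fps_map_inj)
qed

end

section \<open>Power series over a subfield\<close>

lemma is_subfield_hull: "is_subfield (is_subfield hull A)"
proof (rule hull_in)
  fix T :: "'a set set" assume "\<forall>F\<in>T. is_subfield F"
  then show "is_subfield (\<Inter>T)"
    unfolding is_subfield_def by blast
qed

lemma subset_is_subfield_hull: "A \<subseteq> is_subfield hull A"
  by (rule hull_subset)

locale subfield =
  fixes F :: "'a::field_char_0 set"
  assumes is_subfield: "is_subfield F"
begin

lemma zero_in: "0 \<in> F"
  and one_in: "1 \<in> F"
  and add_in: "a \<in> F \<Longrightarrow> b \<in> F \<Longrightarrow> a + b \<in> F"
  and mult_in: "a \<in> F \<Longrightarrow> b \<in> F \<Longrightarrow> a * b \<in> F"
  and uminus_in: "a \<in> F \<Longrightarrow> - a \<in> F"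
  and inverse_in: "a \<in> F \<Longrightarrow> inverse a \<in> F"
  using is_subfield by (auto simp: is_subfield_def)

lemma diff_in: "a \<in> F \<Longrightarrow> b \<in> F \<Longrightarrow> a - b \<in> F"
  using add_in[of a "- b"] uminus_in by simp

lemma divide_in: "a \<in> F \<Longrightarrow> b \<in> F \<Longrightarrow> a / b \<in> F"
  using mult_in[of a "inverse b"] inverse_in by (simp add: divide_inverse)

lemma power_in: "a \<in> F \<Longrightarrow> a ^ n \<in> F"
  by (induction n) (auto simp: one_in mult_in)

lemma sum_in: "(\<And>i. i \<in> A \<Longrightarrow> f i \<in> F) \<Longrightarrow> sum f A \<in> F"
  by (induction A rule: infinite_finite_induct) (auto simp: zero_in add_in)

lemma of_nat_in: "of_nat n \<in> F"
  by (induction n) (auto simp: zero_in one_in add_in)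

lemma numeral_in: "numeral n \<in> F"
  using of_nat_in[of "numeral n"] by simp

lemmas closed = zero_in one_in add_in mult_in uminus_in inverse_in diff_in divide_in power_in
  of_nat_in numeral_in

lemma quotient_in: "a * b \<in> F \<Longrightarrow> b \<in> F \<Longrightarrow> b \<noteq> 0 \<Longrightarrow> a \<in> F"
  using divide_in[of "a * b" b] by simp

definition series :: "'a fps set" where
  "series = {f. \<forall>n. fps_nth f n \<in> F}"

lemma seriesD: "f \<in> series \<Longrightarrow> fps_nth f n \<in> F"
  by (simp add: series_def)

lemma series_const: "c \<in> F \<Longrightarrow> fps_const c \<in> series"
  by (auto simp: series_def closed)

lemma series_X: "fps_X \<in> series"
  by (auto simp: series_def fps_X_def closed)

lemma series_add: "f \<in> series \<Longrightarrow> g \<in> series \<Longrightarrow> f + g \<in> series"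
  and series_diff: "f \<in> series \<Longrightarrow> g \<in> series \<Longrightarrow> f - g \<in> series"
  by (auto simp: series_def closed)

lemma series_mult: "f \<in> series \<Longrightarrow> g \<in> series \<Longrightarrow> f * g \<in> series"
  by (auto simp: series_def fps_mult_nth intro!: sum_in mult_in)

lemma series_one: "1 \<in> series"
  using series_const[OF one_in] by simp

lemma series_power: "f \<in> series \<Longrightarrow> f ^ n \<in> series"
  by (induction n) (auto simp: series_one series_mult)

lemma series_numeral: "numeral n \<in> series"
  using series_const[OF numeral_in] by (simp add: numeral_fps_const)

lemmas series_closed = series_const series_X series_add series_diff series_mult series_one
  series_power series_numeral

lemma series_quotient:
  assumes "f * g \<in> series" "g \<in> series" "fps_nth g 0 \<noteq> 0"
  shows "f \<in> series"
proof -
  have "fps_nth f n \<in> F" for n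
  proof (induction n rule: less_induct)
    case (less n)
    have "fps_nth (f * g) n = (\<Sum>i<n. fps_nth f i * fps_nth g (n - i)) + fps_nth f n * fps_nth g 0"
      by (simp add: fps_mult_nth atLeast0AtMost flip: lessThan_Suc_atMost)
    then have "fps_nth f n * fps_nth g 0 =
        fps_nth (f * g) n - (\<Sum>i<n. fps_nth f i * fps_nth g (n - i))"
      by simp
    also have "\<dots> \<in> F"
      using less assms by (intro diff_in sum_in mult_in) (auto simp: seriesD)
    finally show ?case
      by (rule quotient_in[OF _ seriesD[OF assms(2)] assms(3)])
  qed
  then show ?thesis by (simp add: series_def)
qed

text \<open>Coefficient n of the square is 2 f_0 f_n plus products of coefficients of smaller index,
  so f_n is obtained inside \<open>F\<close> by a division by 2 f_0.\<close>

lemma series_sqrt: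
  assumes "f ^ 2 \<in> series" "fps_nth f 0 \<in> F" "fps_nth f 0 \<noteq> 0"
  shows "f \<in> series"
proof -
  have "fps_nth f n \<in> F" for n
  proof (induction n rule: less_induct)
    case (less n)
    show ?case
    proof (cases n)
      case (Suc m)
      have "fps_nth (f ^ 2) n = (\<Sum>i\<le>Suc m. fps_nth f i * fps_nth f (Suc m - i))"
        by (simp add: power2_eq_square fps_mult_nth Suc atLeast0AtMost)
      also have "\<dots> = (\<Sum>i<m. fps_nth f (Suc i) * fps_nth f (m - i)) + fps_nth f n * (2 * fps_nth f 0)"
        by (subst sum.atMost_Suc, subst sum.atMost_shift) (simp add: Suc algebra_simps)
      finally have "fps_nth f n * (2 * fps_nth f 0) =
          fps_nth (f ^ 2) n - (\<Sum>i<m. fps_nth f (Suc i) * fps_nth f (m - i))"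
        by simp
      also have "\<dots> \<in> F"
        using less assms Suc by (intro diff_in sum_in mult_in) (auto simp: seriesD)
      finally show ?thesis
        by (rule quotient_in[OF _ mult_in[OF numeral_in assms(2)]]) (use assms(3) in simp)
    qed (use assms in simp)
  qed
  then show ?thesis by (simp add: series_def)
qed

end

text \<open>A series in t over polynomials in x is reread as a series in x over series in t. The
  result need not be a polynomial in x, as the degrees may grow with the power of t.\<close>

definition swap_poly :: "'a::comm_ring_1 poly fps \<Rightarrow> 'a fps fps" where
  "swap_poly f = Abs_fps (\<lambda>k. Abs_fps (\<lambda>n. coeff (fps_nth f n) k))"

lemma swap_poly_nth [simp]: "fps_nth (fps_nth (swap_poly f) k) n = coeff (fps_nth f n) k"
  by (simp add: swap_poly_def)

lemma fps_fps_eqI: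
  assumes "\<And>k n. fps_nth (fps_nth f k) n = fps_nth (fps_nth g k) n"
  shows "f = (g :: 'a fps fps)"
  using assms by (intro fps_ext) blast

lemma unital_ring_hom_swap_poly: "unital_ring_hom swap_poly"
proof
  fix f g :: "'a poly fps"
  show "swap_poly (f + g) = swap_poly f + swap_poly g"
    by (rule fps_fps_eqI) simp
  show "swap_poly (f * g) = swap_poly f * swap_poly g"
  proof (rule fps_fps_eqI)
    fix k n
    have "fps_nth (fps_nth (swap_poly f * swap_poly g) k) n =
        (\<Sum>a=0..k. \<Sum>b=0..n. coeff (fps_nth f b) a * coeff (fps_nth g (n - b)) (k - a))"
      by (simp add: fps_mult_nth fps_sum_nth)
    also have "\<dots> = (\<Sum>b=0..n. \<Sum>a=0..k. coeff (fps_nth f b) a * coeff (fps_nth g (n - b)) (k - a))"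
      by (rule sum.swap)
    also have "\<dots> = fps_nth (fps_nth (swap_poly (f * g)) k) n"
      by (simp add: fps_mult_nth coeff_sum coeff_mult atLeast0AtMost)
    finally show "fps_nth (fps_nth (swap_poly (f * g)) k) n =
        fps_nth (fps_nth (swap_poly f * swap_poly g) k) n" ..
  qed
  show "swap_poly (1 :: 'a poly fps) = 1"
    by (rule fps_fps_eqI) (auto simp: fps_one_nth)
qed

lemma swap_poly_inj: "swap_poly f = swap_poly g \<longleftrightarrow> f = g"
proof
  assume "swap_poly f = swap_poly g"
  then have "coeff (fps_nth f n) k = coeff (fps_nth g n) k" for n k
    by (metis swap_poly_nth)
  then show "f = g"
    by (intro fps_ext poly_eqI) blast
qed simp

lemma swap_poly_var: "swap_poly (fps_const [:0, 1:]) = fps_X"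
  by (rule fps_fps_eqI) (auto simp: fps_X_def coeff_pCons split: nat.split)

lemma swap_poly_X: "swap_poly fps_X = fps_const fps_X"
  by (rule fps_fps_eqI) (auto simp: fps_X_def)

lemma swap_poly_const: "swap_poly (fps_map (\<lambda>c. [:c:]) f) = fps_const f"
  by (rule fps_fps_eqI) (auto simp: coeff_pCons split: nat.split)

text \<open>After x is replaced by x - 1, powers of the variable stand for powers of x + 1.\<close>

definition shift_poly :: "rat poly \<Rightarrow> rat poly" where
  "shift_poly p = pcompose p [:- 1, 1:]"

lemma unital_ring_hom_shift_poly: "unital_ring_hom shift_poly"
  by unfold_locales (simp_all add: shift_poly_def pcompose_add pcompose_mult pcompose_1)

text \<open>The expansions over \<open>\<rat>((t))\<close> in powers of \<open>x\<close> and of \<open>x + 1\<close>.\<close>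

definition expand_0 :: "rat poly fps \<Rightarrow> rat fls fps" where
  "expand_0 f = fps_map fps_to_fls (swap_poly f)"

definition expand_m1 :: "rat poly fps \<Rightarrow> rat fls fps" where
  "expand_m1 f = expand_0 (fps_map shift_poly f)"

lemma unital_ring_hom_expand_0: "unital_ring_hom expand_0"
  unfolding expand_0_def
  by (intro unital_ring_hom_comp[OF _ unital_ring_hom_swap_poly]
      unital_ring_hom.unital_ring_hom_fps_map unital_ring_hom_fps_to_fls)

lemma unital_ring_hom_expand_m1: "unital_ring_hom expand_m1"
  unfolding expand_m1_def
  by (intro unital_ring_hom_comp[OF unital_ring_hom_expand_0]
      unital_ring_hom.unital_ring_hom_fps_map unital_ring_hom_shift_poly)

lemma expand_0_const: "expand_0 (fps_map (\<lambda>c. [:c:]) f) = fps_const (fps_to_fls f)"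
  by (simp add: expand_0_def swap_poly_const unital_ring_hom.fps_map_const[OF unital_ring_hom_fps_to_fls])

lemma expand_m1_const: "expand_m1 (fps_map (\<lambda>c. [:c:]) f) = fps_const (fps_to_fls f)"
  using expand_0_const[of f] by (simp add: expand_m1_def fps_map_fps_map shift_poly_def)

lemma expand_0_var: "expand_0 (fps_const [:0, 1:]) = fps_X"
  by (simp add: expand_0_def swap_poly_var unital_ring_hom.fps_map_X[OF unital_ring_hom_fps_to_fls])

lemma expand_m1_var: "expand_m1 (fps_const [:0, 1:]) = fps_X - 1"
proof -
  interpret s: unital_ring_hom shift_poly by (rule unital_ring_hom_shift_poly)
  interpret e: unital_ring_hom expand_0 by (rule unital_ring_hom_expand_0)
  have "fps_map shift_poly (fps_const [:0, 1:]) = fps_const [:0, 1:] - (1 :: rat poly fps)"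
    by (rule fps_ext) (simp add: s.hom_zero shift_poly_def pcompose_pCons one_pCons)
  then show ?thesis
    by (simp add: expand_m1_def e.homs expand_0_var)
qed

lemma expand_0_X: "expand_0 fps_X = fps_const fls_X"
  by (simp add: expand_0_def swap_poly_X unital_ring_hom.fps_map_const[OF unital_ring_hom_fps_to_fls])

lemma expand_m1_X: "expand_m1 fps_X = fps_const fls_X"
  by (simp add: expand_m1_def unital_ring_hom.fps_map_X[OF unital_ring_hom_shift_poly] expand_0_X)

lemma expand_0_nth_0: "fps_nth (expand_0 f) 0 = fps_to_fls (fps_map (ev 0) f)"
  unfolding expand_0_def by (simp, rule fps_ext) (simp add: ev_0_eq_coeff)

lemma expand_m1_nth_0: "fps_nth (expand_m1 f) 0 = fps_to_fls (fps_map (ev (- 1)) f)"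
proof -
  have "coeff (shift_poly p) 0 = ev (- 1) p" for p
  proof -
    have "coeff (shift_poly p) 0 = poly p (- 1)"
      by (simp add: shift_poly_def poly_0_coeff_0[symmetric] poly_pcompose)
    moreover have "map_poly of_rat p = p"
      by (rule poly_eqI) (simp add: coeff_map_poly)
    ultimately show ?thesis by (simp add: ev_def)
  qed
  then show ?thesis
    by (simp add: expand_m1_def expand_0_nth_0 fps_map_fps_map ev_0_eq_coeff)
qed

section \<open>Walks ending at a given point\<close>

context J_series
begin

abbreviation Jf :: "rat fls" where "Jf \<equiv> fps_to_fls J"

definition QJ :: "rat fls set" where
  "QJ = is_subfield hull {Jf}"

sublocale QJ: subfield QJ
  by unfold_locales (simp add: QJ_def is_subfield_hull)

lemma Jf_in: "Jf \<in> QJ"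
  using subset_is_subfield_hull[of "{Jf}"] by (simp add: QJ_def)

lemma Jf_nz: "Jf \<noteq> 0"
  using Jc_nz[where 'a = rat] by simp

lemma one_minus_Jf_nz: "1 - Jf \<noteq> 0"
proof -
  have "fps_to_fls (1 - J) \<noteq> 0"
    using Jc_neq_1[where 'a = rat] by (simp del: fps_to_fls_minus)
  then show ?thesis by simp
qed

lemma quartic_Jf_nz: "quartic Jf \<noteq> 0"
proof
  interpret f: unital_ring_hom "fps_to_fls :: rat fps \<Rightarrow> _" by (rule unital_ring_hom_fps_to_fls)
  assume "quartic Jf = 0"
  then have "fps_to_fls (quartic J) = 0"
    by (simp add: f.hom_quartic)
  then have "fps_nth (quartic J) 0 = 0"
    by simp
  then show False
    by (simp add: quartic_def fps_nth_power_0 J_nth_0)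
qed

lemma Jf_eq: "Jf * (1 - Jf) ^ 2 = fls_X * quartic Jf"
proof -
  interpret f: unital_ring_hom "fps_to_fls :: rat fps \<Rightarrow> _" by (rule unital_ring_hom_fps_to_fls)
  have "fps_to_fls (J * (1 - J) ^ 2) = fps_to_fls (fps_X * quartic J)"
    by (simp add: J_eq)
  then show ?thesis
    by (simp add: f.hom_mult f.hom_power f.hom_quartic)
qed

lemma fls_X_in: "fls_X \<in> QJ"
proof -
  have "fls_X * quartic Jf \<in> QJ"
    unfolding Jf_eq[symmetric] by (intro QJ.closed Jf_in)
  moreover have "quartic Jf \<in> QJ"
    unfolding quartic_def by (intro QJ.closed Jf_in)
  ultimately show ?thesis
    by (rule QJ.quotient_in) (rule quartic_Jf_nz)
qed

lemma slit_poly_series: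
  assumes "\<xi> \<in> QJ.series"
  shows "slit_poly (fps_const Jf) \<xi> \<in> QJ.series"
  unfolding slit_poly_def by (intro QJ.series_closed Jf_in assms)

text \<open>Here \<open>e\<close> is an expansion around a point. The square of \<open>e Wp\<close>
  has coefficients in Q(J), so by \<open>series_sqrt\<close> everything depends on the constant
  term, the value of the root at that point.\<close>

lemma Wp_Hp_series:
  fixes e :: "rat poly fps \<Rightarrow> rat fls fps"
  assumes "unital_ring_hom e" and J: "e Jp = fps_const Jf"
    and var: "e (fps_const [:0, 1:]) \<in> QJ.series"
    and W0: "fps_nth (e Wp) 0 \<in> QJ" "fps_nth (e Wp) 0 \<noteq> 0"
  shows "e Wp \<in> QJ.series" "e Hp \<in> QJ.series"
proof -
  interpret e: unital_ring_hom e by fact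
  have "e Wp ^ 2 = slit_poly (fps_const Jf) (e (fps_const [:0, 1:]))"
    using arg_cong[OF Wp_square, of e] by (simp add: e.homs Pp_def e.hom_slit_poly J)
  then have "e Wp ^ 2 \<in> QJ.series"
    using slit_poly_series[OF var] by simp
  then show W: "e Wp \<in> QJ.series"
    using W0 by (rule QJ.series_sqrt)
  have "e Hp * e Wp = 1 - fps_const Jf"
    using arg_cong[OF Hp_mult_Wp, of e] by (simp add: e.homs J)
  also have "\<dots> \<in> QJ.series"
    by (intro QJ.series_closed Jf_in)
  finally show "e Hp \<in> QJ.series"
    using W W0(2) by (rule QJ.series_quotient)
qed

lemma expand_0_Wp_Hp: "expand_0 Wp \<in> QJ.series" "expand_0 Hp \<in> QJ.series"
proof -
  have "fps_nth (expand_0 Wp) 0 = 1 - Jf"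
    using W_0[where 'a = rat] by (simp add: expand_0_nth_0 W_def)
  then have W: "fps_nth (expand_0 Wp) 0 \<in> QJ" "fps_nth (expand_0 Wp) 0 \<noteq> 0"
    using one_minus_Jf_nz by (auto intro: QJ.closed Jf_in)
  have "expand_0 (fps_const [:0, 1:]) \<in> QJ.series"
    by (simp add: expand_0_var QJ.series_X)
  from Wp_Hp_series[OF unital_ring_hom_expand_0 _ this W]
  show "expand_0 Wp \<in> QJ.series" "expand_0 Hp \<in> QJ.series"
    by (simp_all add: Jp_def expand_0_const)
qed

text \<open>At \<open>x = - 1\<close> the quadratic polynomial under the square root becomes the square of
  \<open>1 + J\<^sup>2\<close>, so that the Taylor coefficients there are rational in \<open>J\<close>.\<close>

lemma W_minus_1: "W (- 1) = 1 + Jc ^ 2"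
proof (rule fps_sqrt_unique)
  have c: "fps_const (- 1) = (- 1 :: 'a fps)"
    by (simp add: fps_const_neg[symmetric] del: fps_const_neg)
  show "W (- 1) ^ 2 = (1 + Jc ^ 2 :: 'a fps) ^ 2"
    unfolding W_square slit_poly_def c by algebra
qed (simp_all add: fps_nth_power_0)

lemma expand_m1_Hp: "expand_m1 Hp \<in> QJ.series"
proof -
  have W0: "fps_nth (expand_m1 Wp) 0 = 1 + Jf ^ 2"
    using W_minus_1[where 'a = rat] by (simp add: expand_m1_nth_0 W_def fps_to_fls_power)
  have "fps_nth (1 + J ^ 2) 0 \<noteq> 0"
    by (simp add: fps_nth_power_0 J_nth_0)
  then have "1 + J ^ 2 \<noteq> 0"
    by (metis fps_zero_nth)
  then have "fps_to_fls (1 + J ^ 2) \<noteq> 0"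
    by (simp del: fps_to_fls_plus)
  then have W: "fps_nth (expand_m1 Wp) 0 \<in> QJ" "fps_nth (expand_m1 Wp) 0 \<noteq> 0"
    unfolding W0 by (auto intro!: QJ.closed Jf_in simp: fps_to_fls_power)
  have "expand_m1 (fps_const [:0, 1:]) \<in> QJ.series"
    by (simp add: expand_m1_var QJ.series_X QJ.series_closed)
  from Wp_Hp_series(2)[OF unital_ring_hom_expand_m1 _ this W]
  show "expand_m1 Hp \<in> QJ.series"
    by (simp add: Jp_def expand_m1_const)
qed

lemma axis_series_in: "fps_to_fls (axis_series i j) \<in> QJ"
proof (cases "i \<le> 0 \<and> j = 0")
  case False
  then have "axis_series i j = 0"
    by (intro fps_ext) (auto simp: axis_series_def axis_count_def)
  then show ?thesis by (simp add: QJ.closed)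
next
  case True
  interpret e: unital_ring_hom expand_0 by (rule unital_ring_hom_expand_0)
  interpret f: unital_ring_hom "fps_to_fls :: rat fps \<Rightarrow> _" by (rule unital_ring_hom_fps_to_fls)
  have "J * (1 - J) * axis_coeff = fps_X * ((Lc * inverse Lc) * ((1 - J) * inverse (1 - J)))"
    using Jc_eq_X_Lc[where 'a = rat] by (simp add: axis_coeff_def mult_ac)
  also have "\<dots> = fps_X"
    using inverse_1_minus_Jc[where 'a = rat] by (simp add: inverse_Lc)
  finally have "fps_to_fls (J * (1 - J) * axis_coeff) = fls_X"
    by simp
  then have "fps_to_fls axis_coeff * (Jf * (1 - Jf)) \<in> QJ"
    using fls_X_in by (simp add: f.homs mult_ac)
  moreover have "Jf * (1 - Jf) \<noteq> 0"
    using Jf_nz one_minus_Jf_nz by (metis mult_eq_0_iff)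
  ultimately have c: "fps_to_fls axis_coeff \<in> QJ"
    by (rule QJ.quotient_in[OF _ QJ.mult_in[OF Jf_in QJ.diff_in[OF QJ.one_in Jf_in]]])
  have "expand_0 axp = fps_const (fps_to_fls axis_coeff) * expand_0 Wp"
    by (simp add: axp_def e.homs expand_0_const)
  also have "\<dots> \<in> QJ.series"
    by (intro QJ.series_closed c expand_0_Wp_Hp)
  finally have "fps_nth (expand_0 axp) (nat (- i)) \<in> QJ"
    by (rule QJ.seriesD)
  moreover have "fps_nth (expand_0 axp) (nat (- i)) = fps_to_fls (axis_series i j)"
    using True unfolding expand_0_def by simp (rule fps_ext, simp add: axis_series_def axis_count_def)
  ultimately show ?thesis by simp
qed

lemma slit_series_axis_in: "fps_to_fls (slit_series i 0) \<in> QJ"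
proof (cases "i \<ge> 0")
  case False
  then have "slit_series i 0 = 0"
    by (intro fps_ext) (auto simp: slit_series_def slit_count_axis)
  then show ?thesis by (simp add: QJ.closed)
next
  case True
  have "fps_nth (expand_0 Hp) (nat i) = fps_to_fls (slit_series i 0)"
    using True unfolding expand_0_def by simp (rule fps_ext, simp add: slit_series_def slit_count_axis)
  then show ?thesis
    using QJ.seriesD[OF expand_0_Wp_Hp(2)] by metis
qed

text \<open>Only the entries with i at least 0 are kept, since other powers of x do not fit in Q[x].
  The sum stops at n because n steps increase the abscissa by at most n.\<close>

definition pos_row :: "int \<Rightarrow> rat poly fps" where
  "pos_row j = Abs_fps (\<lambda>n. \<Sum>i\<le>n. monom (slit_count n (int i) j) i)"

lemma slit_count_support: "i > int n \<Longrightarrow> slit_count n i j = 0"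
  by (induction n arbitrary: i j)
    (simp_all add: slit_count_0 slit_count_Suc axis_count_def triangular_sum_def)

lemma swap_poly_pos_row: "swap_poly (pos_row j) = Abs_fps (\<lambda>k. slit_series (int k) j)"
  by (rule fps_fps_eqI)
    (auto simp: pos_row_def coeff_sum slit_series_def slit_count_support)

lemma pos_row_0: "pos_row 0 = Hp"
  unfolding swap_poly_inj[symmetric] swap_poly_pos_row
  by (rule fps_fps_eqI) (simp add: slit_series_def slit_count_axis)

text \<open>The induction hypothesis from row to row. Its second half is there because finding the
  next row requires a value at x = -1.\<close>

definition good_row :: "int \<Rightarrow> bool" where
  "good_row j \<longleftrightarrow> (\<forall>i. fps_to_fls (slit_series i j) \<in> QJ) \<and> expand_m1 (pos_row j) \<in> QJ.series"

lemma good_row_0: "good_row 0"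
  by (simp add: good_row_def slit_series_axis_in pos_row_0 expand_m1_Hp)

text \<open>The step recurrence only yields the sums of adjacent entries of a row; the entry at \<open>i = 0\<close> is
  then found by evaluating at \<open>x = - 1\<close>, where the factor \<open>1 + x\<close> vanishes.\<close>

lemma good_row_step:
  fixes G :: "int \<Rightarrow> rat fps"
  assumes sum: "\<And>i. of_nat (Suc m) * fps_X * (slit_series i j + slit_series (i + 1) j) = G i"
    and G: "\<And>i. fps_to_fls (G i) \<in> QJ"
    and Gp: "swap_poly g = Abs_fps (\<lambda>k. G (int k))" "expand_m1 g \<in> QJ.series"
  shows "good_row j"
proof -
  interpret s: unital_ring_hom "swap_poly :: rat poly fps \<Rightarrow> _" by (rule unital_ring_hom_swap_poly)
  interpret e: unital_ring_hom expand_m1 by (rule unital_ring_hom_expand_m1)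
  interpret f: unital_ring_hom "fps_to_fls :: rat fps \<Rightarrow> _" by (rule unital_ring_hom_fps_to_fls)
  define c where "c = fps_map (\<lambda>c. [:c:]) (slit_series 0 j)"
  define u :: "rat fls" where "u = of_nat (Suc m) * fls_X"
  have u: "u \<in> QJ" "u \<noteq> 0"
    unfolding u_def by (intro QJ.closed fls_X_in) (simp del: of_nat_Suc)
  \<comment> \<open>Multiplying the row by 1 + x forms the sums of adjacent entries, except at x^0,
    where the entry at i = 0 stands alone and is subtracted.\<close>
  have "of_nat (Suc m) * fps_X * ((1 + fps_const [:0, 1:]) * pos_row j - c) = fps_const [:0, 1:] * g"
    unfolding swap_poly_inj[symmetric] s.homs swap_poly_var swap_poly_X swap_poly_pos_row Gp(1) c_def
      swap_poly_const
  proof (rule fps_ext)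
    fix k
    have n: "(of_nat (Suc m) :: rat fps fps) = fps_const (of_nat (Suc m))"
      by (simp add: fps_of_nat del: of_nat_Suc)
    show "fps_nth (of_nat (Suc m) * fps_const fps_X *
        ((1 + fps_X) * Abs_fps (\<lambda>k. slit_series (int k) j) - fps_const (slit_series 0 j))) k =
      fps_nth (fps_X * Abs_fps (\<lambda>k. G (int k))) k"
    proof (cases k)
      case 0
      then show ?thesis by (simp add: n del: of_nat_Suc)
    next
      case (Suc l)
      have e: "int (Suc l) = int l + 1" by simp
      show ?thesis
        using sum[of "int l"] Suc
        by (simp add: n e distrib_right add.commute[of "slit_series (int l) j"] del: of_nat_Suc)
    qed
  qed
  then have "expand_m1 (of_nat (Suc m) * fps_X * ((1 + fps_const [:0, 1:]) * pos_row j - c)) =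
      expand_m1 (fps_const [:0, 1:] * g)"
    by simp
  then have eq: "fps_const u * (fps_X * expand_m1 (pos_row j) - fps_const (fps_to_fls (slit_series 0 j))) =
      (fps_X - 1) * expand_m1 g" (is "?l = ?r")
    by (simp add: e.homs expand_m1_X expand_m1_var c_def expand_m1_const u_def fps_of_nat
        fps_const_mult[symmetric] del: of_nat_Suc fps_const_mult)
  have r: "?r \<in> QJ.series"
    by (intro QJ.series_closed Gp(2))
  \<comment> \<open>In powers of x + 1 the constant coefficient no longer sees the row: it is minus
    the entry at i = 0, up to the factor \<open>u\<close>. The higher coefficients give the
    expansion of the row.\<close>
  have "fps_nth ?l 0 \<in> QJ"
    unfolding eq using r by (rule QJ.seriesD)
  then have "fps_to_fls (slit_series 0 j) * u \<in> QJ"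
    using QJ.uminus_in by (fastforce simp: mult.commute)
  then have s0: "fps_to_fls (slit_series 0 j) \<in> QJ"
    using u by (rule QJ.quotient_in)
  have "fps_nth (expand_m1 (pos_row j)) k \<in> QJ" for k
  proof -
    have "fps_nth ?l (Suc k) \<in> QJ"
      unfolding eq using r by (rule QJ.seriesD)
    then have "fps_nth (expand_m1 (pos_row j)) k * u \<in> QJ"
      by (simp add: mult.commute)
    then show ?thesis
      using u by (rule QJ.quotient_in)
  qed
  then have 1: "expand_m1 (pos_row j) \<in> QJ.series"
    by (simp add: QJ.series_def)
  have sum': "fps_to_fls (slit_series i j) + fps_to_fls (slit_series (i + 1) j) \<in> QJ" for i
  proof -
    have "fps_to_fls (of_nat (Suc m) * fps_X * (slit_series i j + slit_series (i + 1) j)) \<in> QJ"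
      by (simp only: sum G)
    then have "(fps_to_fls (slit_series i j) + fps_to_fls (slit_series (i + 1) j)) * u \<in> QJ"
      by (simp only: f.homs fps_X_to_fls u_def mult_ac)
    then show ?thesis
      using u by (rule QJ.quotient_in)
  qed
  \<comment> \<open>From the entry at i = 0 the adjacent sums determine all others, in both
    directions.\<close>
  have "fps_to_fls (slit_series i j) \<in> QJ" for i
  proof (induction i rule: int_induct[of _ 0])
    case base
    then show ?case by (rule s0)
  next
    case (step1 i)
    then show ?case
      using QJ.diff_in[OF sum'[of i]] by fastforce
  next
    case (step2 i)
    then show ?case
      using QJ.diff_in[OF sum'[of "i - 1"]] by fastforce
  qed
  with 1 show ?thesis
    by (simp add: good_row_def)
qed

text \<open>Neighbouring entries along a row, again cut off at i = 0: shifting one way brings in the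
  entry at i = -1, and shifting the other way (\<open>up_row\<close>) drops the entry at i =
  0.\<close>

definition down_row :: "int \<Rightarrow> rat poly fps" where
  "down_row j = fps_const [:0, 1:] * pos_row j + fps_map (\<lambda>c. [:c:]) (slit_series (- 1) j)"

definition up_row :: "int \<Rightarrow> rat poly fps" where
  "up_row j = fps_map (poly_shift 1) (pos_row j)"

lemma swap_poly_down_row: "swap_poly (down_row j) = Abs_fps (\<lambda>k. slit_series (int k - 1) j)"
proof (rule fps_ext)
  interpret s: unital_ring_hom "swap_poly :: rat poly fps \<Rightarrow> _" by (rule unital_ring_hom_swap_poly)
  fix k
  show "fps_nth (swap_poly (down_row j)) k = fps_nth (Abs_fps (\<lambda>k. slit_series (int k - 1) j)) k"
    by (cases k)
      (simp_all add: down_row_def s.homs swap_poly_var swap_poly_pos_row swap_poly_const)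
qed

lemma swap_poly_up_row: "swap_poly (up_row j) = Abs_fps (\<lambda>k. slit_series (int k + 1) j)"
proof (rule fps_fps_eqI)
  fix k n
  have "fps_nth (fps_nth (swap_poly (up_row j)) k) n = fps_nth (fps_nth (swap_poly (pos_row j)) (k + 1)) n"
    by (simp add: up_row_def coeff_poly_shift)
  then show "fps_nth (fps_nth (swap_poly (up_row j)) k) n =
      fps_nth (fps_nth (Abs_fps (\<lambda>k. slit_series (int k + 1) j)) k) n"
    by (simp add: swap_poly_pos_row add.commute)
qed

lemma expand_m1_down_row:
  assumes "good_row j"
  shows "expand_m1 (down_row j) \<in> QJ.series"
proof -
  interpret e: unital_ring_hom expand_m1 by (rule unital_ring_hom_expand_m1)
  show ?thesis
    unfolding e.homs expand_m1_var expand_m1_const down_row_def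
    using assms by (intro QJ.series_closed) (auto simp: good_row_def)
qed

text \<open>The shift is a division by x, which is harmless at x = -1, where x is a unit.\<close>

lemma expand_m1_up_row:
  assumes "good_row j"
  shows "expand_m1 (up_row j) \<in> QJ.series"
proof -
  interpret e: unital_ring_hom expand_m1 by (rule unital_ring_hom_expand_m1)
  interpret s: unital_ring_hom "swap_poly :: rat poly fps \<Rightarrow> _" by (rule unital_ring_hom_swap_poly)
  have "up_row j * fps_const [:0, 1:] = pos_row j - fps_map (\<lambda>c. [:c:]) (slit_series 0 j)"
    unfolding swap_poly_inj[symmetric] s.homs swap_poly_var swap_poly_const swap_poly_up_row
      swap_poly_pos_row
  proof (rule fps_ext)
    fix k
    show "fps_nth (Abs_fps (\<lambda>k. slit_series (int k + 1) j) * fps_X) k =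
        fps_nth (Abs_fps (\<lambda>k. slit_series (int k) j) - fps_const (slit_series 0 j)) k"
      by (cases k) (simp_all add: add.commute)
  qed
  then have "expand_m1 (up_row j * fps_const [:0, 1:]) =
      expand_m1 (pos_row j - fps_map (\<lambda>c. [:c:]) (slit_series 0 j))"
    by simp
  then have "expand_m1 (up_row j) * (fps_X - 1) =
      expand_m1 (pos_row j) - fps_const (fps_to_fls (slit_series 0 j))"
    by (simp add: e.homs expand_m1_var expand_m1_const)
  also have "\<dots> \<in> QJ.series"
    using assms by (intro QJ.series_closed) (auto simp: good_row_def)
  finally show ?thesis
    by (rule QJ.series_quotient) (auto intro: QJ.series_closed)
qed

text \<open>The recurrence on the axis involves rows 1 and -1. By symmetry the entry (i, -1) equals
  the entry (i + 1, 1), so each adjacent sum of row 1 occurs twice.\<close>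

lemma good_row_1: "good_row 1"
proof (rule good_row_step)
  interpret e: unital_ring_hom expand_m1 by (rule unital_ring_hom_expand_m1)
  interpret s: unital_ring_hom "swap_poly :: rat poly fps \<Rightarrow> _" by (rule unital_ring_hom_swap_poly)
  interpret f: unital_ring_hom "fps_to_fls :: rat fps \<Rightarrow> _" by (rule unital_ring_hom_fps_to_fls)
  define G where "G i = slit_series i 0 - fps_X * (slit_series (i - 1) 0 + slit_series (i + 1) 0)
      - axis_series i 0" for i
  have sym: "slit_series i (- 1) = slit_series (i + 1) 1" for i
    by (rule fps_ext) (use slit_count_uminus[of _ i 1] in \<open>simp add: slit_series_def\<close>)
  show "of_nat (Suc 1) * fps_X * (slit_series i 1 + slit_series (i + 1) 1) = G i" for i
    unfolding G_def using slit_series_eq[of i 0]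
    by (simp add: triangular_sum_def sym algebra_simps)
  show "fps_to_fls (G i) \<in> QJ" for i
    unfolding G_def f.homs fps_X_to_fls
    using slit_series_axis_in axis_series_in fls_X_in by (intro QJ.closed) auto
  define g where "g = pos_row 0 - fps_X * (down_row 0 + up_row 0)
      - fps_map (\<lambda>c. [:c:]) (axis_series 0 0)"
  show "swap_poly g = Abs_fps (\<lambda>k. G (int k))"
  proof (rule fps_ext)
    fix k
    have "axis_series (int k) 0 = (if k = 0 then axis_series 0 0 else 0)"
      by (rule fps_ext) (simp add: axis_series_def axis_count_def)
    then show "fps_nth (swap_poly g) k = fps_nth (Abs_fps (\<lambda>k. G (int k))) k"
      by (simp add: g_def G_def s.homs swap_poly_X swap_poly_pos_row swap_poly_down_row
          swap_poly_up_row swap_poly_const)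
  qed
  show "expand_m1 g \<in> QJ.series"
    unfolding g_def e.homs expand_m1_X expand_m1_const
    using good_row_0 expand_m1_up_row[OF good_row_0] expand_m1_down_row[OF good_row_0]
      fls_X_in axis_series_in
    by (intro QJ.series_closed) (auto simp: good_row_def)
qed

text \<open>For j > 0 there is no axis term, and the recurrence at height j has the adjacent sums of
  row j + 1 as its only unknowns.\<close>

lemma good_row_Suc:
  assumes "good_row (j - 1)" "good_row j" "j > 0"
  shows "good_row (j + 1)"
proof (rule good_row_step)
  interpret e: unital_ring_hom expand_m1 by (rule unital_ring_hom_expand_m1)
  interpret s: unital_ring_hom "swap_poly :: rat poly fps \<Rightarrow> _" by (rule unital_ring_hom_swap_poly)
  interpret f: unital_ring_hom "fps_to_fls :: rat fps \<Rightarrow> _" by (rule unital_ring_hom_fps_to_fls)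
  define G where "G i = slit_series i j - fps_X * (slit_series (i - 1) j + slit_series (i + 1) j
      + slit_series i (j - 1) + slit_series (i - 1) (j - 1))" for i
  have "axis_series i j = 0" for i
    by (rule fps_ext) (use assms in \<open>simp add: axis_series_def axis_count_def\<close>)
  then show "of_nat (Suc 0) * fps_X * (slit_series i (j + 1) + slit_series (i + 1) (j + 1)) = G i" for i
    unfolding G_def using slit_series_eq[of i j]
    by (simp add: triangular_sum_def algebra_simps)
  show "fps_to_fls (G i) \<in> QJ" for i
    unfolding G_def f.homs fps_X_to_fls
    using assms fls_X_in by (intro QJ.closed) (auto simp: good_row_def)
  define g where "g = pos_row j - fps_X * (down_row j + up_row j + pos_row (j - 1) + down_row (j - 1))"
  show "swap_poly g = Abs_fps (\<lambda>k. G (int k))"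
    by (rule fps_ext) (simp add: g_def G_def s.homs swap_poly_X swap_poly_pos_row swap_poly_down_row
          swap_poly_up_row)
  show "expand_m1 g \<in> QJ.series"
    unfolding g_def e.homs expand_m1_X
    using assms expand_m1_up_row expand_m1_down_row fls_X_in
    by (intro QJ.series_closed) (auto simp: good_row_def)
qed

lemma good_row_nat: "good_row (int n)"
proof (induction n rule: less_induct)
  case (less n)
  consider "n = 0" | "n = 1" | m where "n = m + 2"
    by (metis One_nat_def Suc_1 add_2_eq_Suc' not0_implies_Suc)
  then show ?case
  proof cases
    case (3 m)
    then have "good_row (int m)" "good_row (int m + 1)"
      using less[of m] less[of "m + 1"] by (simp_all add: add.commute)
    then show ?thesis
      using good_row_Suc[of "int m + 1"] 3 by (simp add: add.commute)
  qed (simp_all add: good_row_0 good_row_1)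
qed

lemma slit_series_in: "fps_to_fls (slit_series i j) \<in> QJ"
proof (cases "j \<ge> 0")
  case True
  then show ?thesis
    using good_row_nat[of "nat j"] by (simp add: good_row_def)
next
  case False
  then have "slit_series i j = slit_series (i - j) (- j)"
    by (intro fps_ext) (use slit_count_uminus[of _ i "nat (- j)"] in \<open>simp add: slit_series_def\<close>)
  then show ?thesis
    using good_row_nat[of "nat (- j)"] False by (simp add: good_row_def)
qed

end

section \<open>Divisibility by the quartic polynomial\<close>

definition zvar :: "'a::comm_ring_1 poly" where "zvar = [:0, 1:]"

lemma quartic_poly: "quartic zvar = [:1, - 2, 6, - 2, 1 :: 'a::comm_ring_1:]"
  unfolding quartic_def zvar_def
  by (simp add: power2_eq_square power3_eq_cube power4_eq_xxxx numeral_poly one_pCons)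

lemma degree_quartic: "degree (quartic zvar :: 'a::comm_ring_1 poly) = 4"
  by (simp add: quartic_poly)

lemma lead_coeff_quartic: "lead_coeff (quartic zvar :: 'a::comm_ring_1 poly) = 1"
  by (simp add: quartic_poly)

lemma quartic_nz [simp]: "quartic zvar \<noteq> (0 :: 'a::comm_ring_1 poly)"
  by (simp add: quartic_poly)

lemma smult_sum_right: "smult c (sum f A) = (\<Sum>i\<in>A. smult c (f i))"
  by (induction A rule: infinite_finite_induct) (simp_all add: smult_add_right)

lemma dvd_numeral_multD:
  fixes p q :: "'a::field_char_0 poly"
  assumes "p dvd numeral n * q"
  shows "p dvd q"
  using assms by (simp add: numeral_poly dvd_smult_iff)

text \<open>The quartic is 1 at z = 0 and 4 at z = 1, so it is coprime to z (1 - z)^2; the identity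
  in the proof is a Bezout relation with value 4.\<close>

lemma quartic_dvd_multD:
  fixes q :: "'a::field_char_0 poly"
  assumes "quartic zvar dvd zvar * (1 - zvar) ^ 2 * q"
  shows "quartic zvar dvd q"
proof -
  have "4 * q = (12 - 9 * zvar + 4 * zvar ^ 2 - zvar ^ 3) * (zvar * (1 - zvar) ^ 2 * q)
      + (4 - 4 * zvar + zvar ^ 2) * q * quartic zvar"
    unfolding quartic_def by algebra
  also have "quartic zvar dvd \<dots>"
    by (rule dvd_add[OF dvd_mult[OF assms] dvd_triv_right])
  finally show ?thesis
    by (rule dvd_numeral_multD)
qed

lemma quartic_dvd_power_multD:
  fixes q :: "'a::field_char_0 poly"
  assumes "quartic zvar dvd (zvar * (1 - zvar) ^ 2) ^ m * q"
  shows "quartic zvar dvd q"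
  using assms
proof (induction m)
  case (Suc m)
  from Suc.prems have "quartic zvar dvd zvar * (1 - zvar) ^ 2 * ((zvar * (1 - zvar) ^ 2) ^ m * q)"
    by (simp only: power_Suc mult.assoc)
  then show ?case
    by (rule Suc.IH[OF quartic_dvd_multD])
qed simp

text \<open>An even polynomial divisible by the quartic \<open>N(z)\<close> is divisible by \<open>N(z) N(- z)\<close>, of degree 8.\<close>

lemma quartic_dvd_even:
  fixes q :: "nat \<Rightarrow> 'a::field_char_0"
  assumes "quartic zvar dvd (\<Sum>i<4. smult (q i) (((1 - zvar) ^ 2) ^ i * (zvar ^ 2 * (1 - zvar) ^ 2) ^ (3 - i)))"
    and "i < 4"
  shows "q i = 0"
proof -
  define r where "r = (\<Sum>i<4. smult (q i) ((zvar ^ 2) ^ (3 - i)))"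
  have "(\<Sum>i<4. smult (q i) (((1 - zvar) ^ 2) ^ i * (zvar ^ 2 * (1 - zvar) ^ 2) ^ (3 - i))) =
      ((1 - zvar) ^ 2) ^ 3 * r"
    unfolding r_def sum_distrib_left
  proof (rule sum.cong)
    fix i :: nat assume "i \<in> {..<4}"
    then have "((1 - zvar) ^ 2) ^ 3 = ((1 - zvar) ^ 2) ^ i * ((1 - zvar :: 'a poly) ^ 2) ^ (3 - i)"
      by (simp flip: power_add)
    then show "smult (q i) (((1 - zvar) ^ 2) ^ i * (zvar ^ 2 * (1 - zvar) ^ 2) ^ (3 - i)) =
        ((1 - zvar) ^ 2) ^ 3 * smult (q i) ((zvar ^ 2) ^ (3 - i))"
      by (simp only: power_mult_distrib mult_smult_right mult_ac)
  qed simp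
  \<comment> \<open>The common factor (1 - z)^6, completed by z^3, is removed by coprimality. The
    remaining \<open>r\<close> has only even powers of z.\<close>
  with assms(1) have "quartic zvar dvd (zvar * (1 - zvar) ^ 2) ^ 3 * r"
    by (simp add: power_mult_distrib mult.assoc)
  then have 1: "quartic zvar dvd r"
    by (rule quartic_dvd_power_multD)
  then obtain s where s: "r = quartic zvar * s" ..
  interpret c: unital_ring_hom "\<lambda>p :: 'a poly. pcompose p (- zvar)"
    by unfold_locales (simp_all add: pcompose_add pcompose_mult pcompose_1)
  have "pcompose zvar (- zvar) = (- zvar :: 'a poly)"
    by (simp add: zvar_def pcompose_pCons)
  then have "pcompose r (- zvar) = r" "pcompose (quartic zvar) (- zvar) = quartic (- zvar :: 'a poly)"
    by (simp_all add: r_def c.homs c.hom_quartic pcompose_smult)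
  with s have 2: "quartic (- zvar) dvd r"
    by (metis c.hom_mult dvd_triv_left)
  \<comment> \<open>A Bezout relation with value 16 between N(z) and N(-z), multiplied by
    \<open>r\<close>: being coprime, they divide \<open>r\<close> jointly.\<close>
  have "16 * r = (8 + 29 * zvar + 10 * zvar ^ 2 + 5 * zvar ^ 3) * quartic zvar * r
      + (8 - 29 * zvar + 10 * zvar ^ 2 - 5 * zvar ^ 3) * quartic (- zvar) * r"
    unfolding quartic_def by algebra
  also have "quartic zvar * quartic (- zvar) dvd \<dots>"
  proof (rule dvd_add)
    have "quartic zvar * quartic (- zvar) dvd quartic zvar * r"
      using 2 by (rule mult_dvd_mono[OF dvd_refl])
    then show "quartic zvar * quartic (- zvar) dvd
        (8 + 29 * zvar + 10 * zvar ^ 2 + 5 * zvar ^ 3) * quartic zvar * r"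
      by (simp only: mult.assoc dvd_mult)
    have "quartic zvar * quartic (- zvar) dvd r * quartic (- zvar)"
      using 1 by (rule mult_dvd_mono[OF _ dvd_refl])
    then show "quartic zvar * quartic (- zvar) dvd
        (8 - 29 * zvar + 10 * zvar ^ 2 - 5 * zvar ^ 3) * quartic (- zvar) * r"
      by (simp only: mult.assoc mult.commute[of r] dvd_mult)
  qed
  finally have dvd: "quartic zvar * quartic (- zvar) dvd r"
    by (rule dvd_numeral_multD)
  have "quartic (- zvar) = [:1, 2, 6, 2, 1 :: 'a:]"
    unfolding quartic_def zvar_def
    by (simp add: power2_eq_square power3_eq_cube power4_eq_xxxx numeral_poly one_pCons)
  then have deg: "degree (quartic zvar * quartic (- zvar) :: 'a poly) = 8"
    by (subst degree_mult_eq) (simp_all add: quartic_poly)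
  have "r = 0"
  proof (rule ccontr)
    assume "r \<noteq> 0"
    with dvd have "8 \<le> degree r"
      using dvd_imp_degree_le[OF dvd] deg by simp
    moreover have "degree r \<le> 6"
      unfolding r_def
    proof (rule degree_sum_le)
      fix i :: nat assume "i \<in> {..<4}"
      have "degree (smult (q i) ((zvar ^ 2) ^ (3 - i))) \<le> degree ((zvar ^ 2 :: 'a poly) ^ (3 - i))"
        by (rule degree_smult_le)
      also have "\<dots> = 2 * (3 - i)"
        by (simp add: power_mult[symmetric] degree_power_eq zvar_def)
      finally show "degree (smult (q i) ((zvar ^ 2) ^ (3 - i))) \<le> 6"
        by simp
    qed simp
    ultimately show False by simp
  qed
  moreover have "coeff r (2 * (3 - i)) = q i"
  proof -
    have "coeff r (2 * (3 - i)) = (\<Sum>k<4. if k = i then q k else 0)"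
      unfolding r_def coeff_sum
    proof (rule sum.cong)
      fix k :: nat assume "k \<in> {..<4}"
      have "(zvar ^ 2) ^ (3 - k) = (monom 1 (2 * (3 - k)) :: 'a poly)"
        by (simp add: zvar_def power_mult[symmetric] monom_altdef)
      then show "coeff (smult (q k) ((zvar ^ 2) ^ (3 - k))) (2 * (3 - i)) = (if k = i then q k else 0)"
        using \<open>i < 4\<close> \<open>k \<in> {..<4}\<close> by auto
    qed simp
    then show ?thesis
      using \<open>i < 4\<close> by simp
  qed
  ultimately show ?thesis
    by simp
qed

text \<open>Over a domain, pseudo-division multiplies the dividend by a power of the leading
  coefficient of the divisor, here 1. This is applied to power series coefficients.\<close>

lemma monic_division:
  fixes f g :: "'a::idom poly"
  assumes "lead_coeff g = 1"
  obtains q r where "f = g * q + r" "r = 0 \<or> degree r < degree g"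
proof -
  obtain q r where qr: "pseudo_divmod f g = (q, r)"
    by (cases "pseudo_divmod f g")
  have "g \<noteq> 0"
    using assms by auto
  from pseudo_divmod[OF this qr] assms show thesis
    by (intro that[of q r]) auto
qed

lemma unital_ring_hom_fps_nth_0: "unital_ring_hom (\<lambda>f :: 'a::comm_ring_1 fps. fps_nth f 0)"
  by unfold_locales simp_all

text \<open>Scaling by the least valuation \<open>d\<close> turns the coefficients into power series
  that do not all vanish at 0. The quartic is monic, so the quotient also has power series
  coefficients and the constant terms can be taken. The result contradicts independence at the
  special point.\<close>

lemma quartic_dvd_specialize:
  fixes a b :: "'a::field_char_0 fps poly" and q :: "nat \<Rightarrow> 'a fls"
  assumes special: "\<And>q i. quartic zvar dvd (\<Sum>i<4. smult (q i)
        (map_poly (\<lambda>f. fps_nth f 0) a ^ i * map_poly (\<lambda>f. fps_nth f 0) b ^ (3 - i))) \<Longrightarrow>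
      i < 4 \<Longrightarrow> q i = 0"
    and dvd: "quartic zvar dvd
      (\<Sum>i<4. smult (q i) (map_poly fps_to_fls a ^ i * map_poly fps_to_fls b ^ (3 - i)))"
    and "i < 4"
  shows "q i = 0"
proof (rule ccontr)
  assume nz: "q i \<noteq> 0"
  interpret f: unital_ring_hom "fps_to_fls :: 'a fps \<Rightarrow> _" by (rule unital_ring_hom_fps_to_fls)
  interpret fm: unital_ring_hom "map_poly (fps_to_fls :: 'a fps \<Rightarrow> _)"
    by (rule f.unital_ring_hom_map_poly)
  interpret z: unital_ring_hom "\<lambda>f :: 'a fps. fps_nth f 0" by (rule unital_ring_hom_fps_nth_0)
  interpret zm: unital_ring_hom "map_poly (\<lambda>f :: 'a fps. fps_nth f 0)"
    by (rule z.unital_ring_hom_map_poly)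
  have f_smult: "map_poly fps_to_fls (smult c p) = smult (fps_to_fls c) (map_poly fps_to_fls p)"
    for c :: "'a fps" and p
    by (rule poly_eqI) (simp add: f.homs)
  have z_smult: "map_poly (\<lambda>f. fps_nth f 0) (smult c p) =
      smult (fps_nth c 0) (map_poly (\<lambda>f. fps_nth f 0) p)" for c :: "'a fps" and p
    by (rule poly_eqI) simp
  have f_Z: "map_poly fps_to_fls (quartic zvar :: 'a fps poly) = quartic zvar"
    by (simp add: fm.hom_quartic zvar_def f.map_poly_pCons_hom f.homs)
  have z_Z: "map_poly (\<lambda>f :: 'a fps. fps_nth f 0) (quartic zvar) = quartic zvar"
    by (simp add: zm.hom_quartic zvar_def z.map_poly_pCons_hom)
  define D where "D = fls_subdegree ` q ` {i. i < 4 \<and> q i \<noteq> 0}"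
  define d where "d = Min D"
  have fin: "finite D" and "D \<noteq> {}"
    using nz \<open>i < 4\<close> by (auto simp: D_def)
  then have "d \<in> D"
    unfolding d_def by (rule Min_in)
  then obtain k where k: "k < 4" "q k \<noteq> 0" "fls_subdegree (q k) = d"
    by (auto simp: D_def)
  have le: "d \<le> fls_subdegree (q j)" if "j < 4" "q j \<noteq> 0" for j
    unfolding d_def using fin that by (intro Min_le) (auto simp: D_def)
  define r where "r j = fls_regpart (fls_shift d (q j))" for j
  have r: "fps_to_fls (r j) = fls_X_intpow (- d) * q j" if "j < 4" for j
  proof -
    have "fls_shift d (q j) $$ n = 0" if "n < 0" for n
      using le[OF \<open>j < 4\<close>] that by (cases "q j = 0") auto
    then have "fps_to_fls (r j) = fls_shift d (q j)"
      unfolding r_def by (intro fls_eqI) simp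
    then show ?thesis
      using fls_X_intpow_times_conv_shift(1)[of "- d" "q j"] by simp
  qed
  define T where "T = (\<Sum>i<4. smult (r i) (a ^ i * b ^ (3 - i)))"
  obtain u s where us: "T = quartic zvar * u + s" "s = 0 \<or> degree s < degree (quartic zvar :: 'a fps poly)"
    using monic_division[OF lead_coeff_quartic] by blast
  have "map_poly fps_to_fls T = smult (fls_X_intpow (- d))
      (\<Sum>i<4. smult (q i) (map_poly fps_to_fls a ^ i * map_poly fps_to_fls b ^ (3 - i)))"
    by (simp add: T_def fm.homs f_smult r smult_sum_right cong: sum.cong_simp)
  then have "quartic zvar dvd map_poly fps_to_fls T"
    using dvd by (simp add: dvd_smult)
  moreover have "map_poly fps_to_fls T = quartic zvar * map_poly fps_to_fls u + map_poly fps_to_fls s"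
    by (simp add: us(1) fm.homs f_Z)
  ultimately have dvds: "quartic zvar dvd map_poly fps_to_fls s"
    by (metis dvd_add_right_iff dvd_triv_left)
  have "map_poly fps_to_fls s = 0"
  proof (rule ccontr)
    assume n: "map_poly fps_to_fls s \<noteq> 0"
    with us(2) have "degree s < 4"
      by (auto simp: degree_quartic)
    moreover have "degree (map_poly fps_to_fls s) \<le> degree s"
      by (rule degree_le) (simp add: coeff_eq_0 f.homs)
    moreover have "4 \<le> degree (map_poly fps_to_fls s)"
      using dvd_imp_degree_le[OF dvds n] by (simp add: degree_quartic)
    ultimately show False by simp
  qed
  then have "s = 0"
    by (metis f.coeff_map_poly_hom fps_to_fls_eq_0_iff poly_eqI coeff_0)
  then have "map_poly (\<lambda>f. fps_nth f 0) T = quartic zvar * map_poly (\<lambda>f. fps_nth f 0) u"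
    by (simp add: us(1) zm.homs z_Z)
  moreover have "map_poly (\<lambda>f. fps_nth f 0) T = (\<Sum>i<4. smult (fps_nth (r i) 0)
      (map_poly (\<lambda>f. fps_nth f 0) a ^ i * map_poly (\<lambda>f. fps_nth f 0) b ^ (3 - i)))"
    by (simp add: T_def zm.homs z_smult)
  ultimately have "fps_nth (r k) 0 = 0"
    using special[of "\<lambda>i. fps_nth (r i) 0" k] k(1) by (metis dvd_triv_left)
  then show False
    using k nth_fls_subdegree_nonzero[of "q k"] by (auto simp: r_def)
qed

text \<open>As P(1) is nonzero, 1 is a root of B and of C with the same multiplicity. Cancelling
  these factors and evaluating at 1 would make P(1) a square.\<close>

lemma square_mult_eq_square:
  fixes B C P :: "'a::field_char_0 poly"
  assumes eq: "B ^ 2 = P * C ^ 2" and nonsquare: "\<And>d. poly P 1 \<noteq> d ^ 2"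
  shows "C = 0"
proof (rule ccontr)
  assume C: "C \<noteq> 0"
  have P: "poly P 1 \<noteq> 0"
    using nonsquare[of 0] by simp
  with C eq have B: "B \<noteq> 0"
    by auto
  have "order 1 (B ^ 2) = order 1 (P * C ^ 2)"
    by (simp add: eq)
  have ord: "order 1 B = order 1 C"
  proof -
    have "P \<noteq> 0"
      using P by auto
    then show ?thesis
      using \<open>order 1 (B ^ 2) = order 1 (P * C ^ 2)\<close> B C P
      by (simp add: power2_eq_square order_mult order_0I)
  qed
  obtain B' where B': "B = [:- 1, 1:] ^ order 1 C * B'"
    using order_decomp[OF B, of 1] ord by auto
  obtain C' where C': "C = [:- 1, 1:] ^ order 1 C * C'" "\<not> [:- 1, 1:] dvd C'"
    using order_decomp[OF C, of 1] by auto
  have "([:- 1, 1:] ^ order 1 C) ^ 2 * B' ^ 2 = ([:- 1, 1:] ^ order 1 C) ^ 2 * (P * C' ^ 2)"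
    using eq by (subst (asm) B', subst (asm) C') (simp only: power_mult_distrib mult.left_commute)
  then have "B' ^ 2 = P * C' ^ 2"
    by simp
  then have "poly B' 1 ^ 2 = poly P 1 * poly C' 1 ^ 2"
    by (metis poly_mult poly_power)
  moreover have "poly C' 1 \<noteq> 0"
    using C'(2) by (simp add: poly_eq_0_iff_dvd)
  ultimately have "poly P 1 = (poly B' 1 / poly C' 1) ^ 2"
    by (simp add: power_divide)
  with nonsquare show False by blast
qed

section \<open>Linear independence\<close>

context J_series
begin

text \<open>Substitution of J for the polynomial variable. It is injective because J is nonzero with
  constant term 0, so relations in J become identities of polynomials.\<close>

definition at_J :: "'a::field_char_0 poly \<Rightarrow> 'a fps" where
  "at_J p = fps_of_poly p oo Jc"

lemma unital_ring_hom_at_J: "unital_ring_hom at_J"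
  by unfold_locales
    (simp_all add: at_J_def fps_of_poly_add fps_of_poly_mult fps_compose_add_distrib
      fps_compose_mult_distrib)

lemma at_J_zvar [simp]: "at_J zvar = Jc"
  by (simp add: at_J_def zvar_def)

lemma at_J_const [simp]: "at_J [:c:] = fps_const c"
  by (simp add: at_J_def fps_of_poly_const)

lemma at_J_smult: "at_J (smult c p) = fps_const c * at_J p"
  using unital_ring_hom.hom_mult[OF unital_ring_hom_at_J, of "[:c:]" p] by simp

lemma at_J_eq_0_iff [simp]: "at_J p = 0 \<longleftrightarrow> p = 0"
  using fps_compose_eq_0_iff[of Jc "fps_of_poly p"] fps_of_poly_eq_iff[of p 0]
  by (simp add: at_J_def)

lemma at_J_inj: "at_J p = at_J q \<longleftrightarrow> p = q"
  using at_J_eq_0_iff[of "p - q"] unital_ring_hom.hom_diff[OF unital_ring_hom_at_J, of p q] by simp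

text \<open>Substituting \<open>t = J(1-J)\<^sup>2 / quartic J\<close> in a polynomial in \<open>t\<close> and clearing denominators.\<close>

definition subst_t :: "nat \<Rightarrow> 'a::field_char_0 poly \<Rightarrow> 'a poly" where
  "subst_t M c = (\<Sum>m\<le>M. smult (coeff c m) ((zvar * (1 - zvar) ^ 2) ^ m * quartic zvar ^ (M - m)))"

lemma at_J_subst_t:
  assumes "degree c \<le> M"
  shows "at_J (subst_t M c) = fps_of_poly c * at_J (quartic zvar) ^ M"
proof -
  interpret a: unital_ring_hom "at_J :: 'a poly \<Rightarrow> _" by (rule unital_ring_hom_at_J)
  have "c = (\<Sum>m\<le>M. monom (coeff c m) m)"
  proof (rule poly_eqI)
    fix n
    show "coeff c n = coeff (\<Sum>m\<le>M. monom (coeff c m) m) n"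
      using assms by (cases "n \<le> M") (auto simp: coeff_sum coeff_eq_0)
  qed
  then have "fps_of_poly c = (\<Sum>m\<le>M. fps_const (coeff c m) * fps_X ^ m)"
    by (metis (no_types, lifting) fps_of_poly_monom fps_of_poly_sum sum.cong)
  then have "fps_of_poly c * at_J (quartic zvar) ^ M =
      (\<Sum>m\<le>M. fps_const (coeff c m) * (fps_X ^ m * at_J (quartic zvar) ^ M))"
    by (simp only: sum_distrib_right mult.assoc)
  also have "\<dots> = (\<Sum>m\<le>M. fps_const (coeff c m) *
      (at_J (zvar * (1 - zvar) ^ 2) ^ m * at_J (quartic zvar) ^ (M - m)))"
  proof (rule sum.cong)
    fix m assume "m \<in> {..M}"
    then have "at_J (quartic zvar) ^ M = at_J (quartic zvar) ^ m * (at_J (quartic zvar) ^ (M - m) :: 'a fps)"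
      by (simp flip: power_add)
    moreover have "at_J (zvar * (1 - zvar) ^ 2) = fps_X * (at_J (quartic zvar) :: 'a fps)"
      using Jc_eq[where 'a = 'a] by (simp add: a.homs a.hom_quartic)
    ultimately show "fps_const (coeff c m) * (fps_X ^ m * at_J (quartic zvar) ^ M) =
        fps_const (coeff c m) * (at_J (zvar * (1 - zvar) ^ 2) ^ m * at_J (quartic zvar) ^ (M - m))"
      by (simp only: power_mult_distrib mult.assoc)
  qed simp
  also have "\<dots> = at_J (subst_t M c)"
    by (simp add: subst_t_def a.hom_sum at_J_smult a.hom_mult a.hom_power)
  finally show ?thesis ..
qed

lemma at_J_subst_t_sum:
  fixes c :: "'i \<Rightarrow> 'a::field_char_0 poly"
  assumes "\<And>i. i \<in> I \<Longrightarrow> degree (c i) \<le> M"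
  shows "at_J (\<Sum>i\<in>I. subst_t M (c i) * p i) =
    (\<Sum>i\<in>I. fps_of_poly (c i) * at_J (p i)) * at_J (quartic zvar) ^ M"
proof -
  interpret a: unital_ring_hom "at_J :: 'a poly \<Rightarrow> _" by (rule unital_ring_hom_at_J)
  show ?thesis
    unfolding a.hom_sum a.hom_mult sum_distrib_right
    by (rule sum.cong) (simp_all only: at_J_subst_t[OF assms] mult_ac)
qed

text \<open>All terms except the one with m = M carry a factor \<open>quartic zvar\<close>, so
  modulo the quartic only the top coefficient survives.\<close>

lemma subst_t_mod: "\<exists>r. subst_t M c = smult (coeff c M) ((zvar * (1 - zvar) ^ 2) ^ M) + quartic zvar * r"
proof -
  have "quartic zvar dvd (\<Sum>m<M. smult (coeff c m) ((zvar * (1 - zvar) ^ 2) ^ m * quartic zvar ^ (M - m)))"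
  proof (rule dvd_sum)
    fix m assume "m \<in> {..<M}"
    then have "quartic zvar dvd quartic zvar ^ (M - m)"
      by (intro dvd_power) auto
    then show "quartic zvar dvd smult (coeff c m) ((zvar * (1 - zvar) ^ 2) ^ m * quartic zvar ^ (M - m))"
      by (intro dvd_smult dvd_mult)
  qed
  then obtain r where "(\<Sum>m<M. smult (coeff c m) ((zvar * (1 - zvar) ^ 2) ^ m * quartic zvar ^ (M - m))) =
      quartic zvar * r" ..
  then have "subst_t M c = smult (coeff c M) ((zvar * (1 - zvar) ^ 2) ^ M) + quartic zvar * r"
    by (simp add: subst_t_def lessThan_Suc_atMost[symmetric] add.commute)
  then show ?thesis ..
qed

text \<open>Independence of 1, a/b, (a/b)^2, (a/b)^3 modulo the quartic, in homogeneous form to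
  avoid denominators.\<close>

definition quartic_independent :: "'a::field_char_0 poly \<Rightarrow> 'a poly \<Rightarrow> bool" where
  "quartic_independent a b \<longleftrightarrow> (\<forall>q. quartic zvar dvd (\<Sum>i<4. smult (q i) (a ^ i * b ^ (3 - i))) \<longrightarrow>
    (\<forall>i<4. q i = 0))"

lemma quartic_independentD:
  assumes "quartic_independent a b" "quartic zvar dvd (\<Sum>i<4. smult (q i) (a ^ i * b ^ (3 - i)))" "i < 4"
  shows "q i = 0"
  using assms by (simp add: quartic_independent_def)

text \<open>The leading coefficient in \<open>t\<close> of a relation is a relation modulo the quartic polynomial,
  that is, over the place \<open>t = \<infinity>\<close>.\<close>

lemma independent_over_t:
  fixes a b :: "'a::field_char_0 poly"
  assumes ind: "quartic_independent a b"
    and rel: "(\<Sum>i<4. fps_of_poly (c i) * at_J (a ^ i * b ^ (3 - i))) = 0"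
    and "i < 4"
  shows "c i = 0"
proof (rule ccontr)
  assume nz: "c i \<noteq> 0"
  interpret a: unital_ring_hom "at_J :: 'a poly \<Rightarrow> _" by (rule unital_ring_hom_at_J)
  define D where "D = degree ` c ` {i. i < 4 \<and> c i \<noteq> 0}"
  define M where "M = Max D"
  have fin: "finite D" and "D \<noteq> {}"
    using nz \<open>i < 4\<close> by (auto simp: D_def)
  then have "M \<in> D"
    unfolding M_def by (rule Max_in)
  then obtain k where k: "k < 4" "c k \<noteq> 0" "degree (c k) = M"
    by (auto simp: D_def)
  have le: "degree (c j) \<le> M" if "j < 4" for j
  proof (cases "c j = 0")
    case False
    then show ?thesis
      unfolding M_def using fin that by (intro Max_ge) (auto simp: D_def)
  qed simp
  have "at_J (\<Sum>i<4. subst_t M (c i) * (a ^ i * b ^ (3 - i))) =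
      (\<Sum>i<4. fps_of_poly (c i) * at_J (a ^ i * b ^ (3 - i))) * at_J (quartic zvar) ^ M"
    by (rule at_J_subst_t_sum) (simp add: le)
  then have zero: "(\<Sum>i<4. subst_t M (c i) * (a ^ i * b ^ (3 - i))) = 0"
    by (simp add: rel)
  have "\<forall>i. \<exists>r. subst_t M (c i) =
      smult (coeff (c i) M) ((zvar * (1 - zvar) ^ 2) ^ M) + quartic zvar * r"
    using subst_t_mod by blast
  from choice[OF this] obtain r where r: "\<And>i. subst_t M (c i) =
      smult (coeff (c i) M) ((zvar * (1 - zvar) ^ 2) ^ M) + quartic zvar * r i"
    by blast
  have "(\<Sum>i<4. subst_t M (c i) * (a ^ i * b ^ (3 - i))) =
      (zvar * (1 - zvar) ^ 2) ^ M * (\<Sum>i<4. smult (coeff (c i) M) (a ^ i * b ^ (3 - i))) +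
      quartic zvar * (\<Sum>i<4. r i * (a ^ i * b ^ (3 - i)))"
    by (simp only: r distrib_right sum.distrib sum_distrib_left mult_smult_left mult_smult_right mult.assoc)
  then have "(zvar * (1 - zvar) ^ 2) ^ M * (\<Sum>i<4. smult (coeff (c i) M) (a ^ i * b ^ (3 - i))) =
      quartic zvar * - (\<Sum>i<4. r i * (a ^ i * b ^ (3 - i)))"
    by (simp only: zero mult_minus_right eq_neg_iff_add_eq_0)
  then have "quartic zvar dvd
      (zvar * (1 - zvar) ^ 2) ^ M * (\<Sum>i<4. smult (coeff (c i) M) (a ^ i * b ^ (3 - i)))"
    by (metis dvd_triv_left)
  then have "quartic zvar dvd (\<Sum>i<4. smult (coeff (c i) M) (a ^ i * b ^ (3 - i)))"
    by (rule quartic_dvd_power_multD)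
  then have "coeff (c k) M = 0"
    using quartic_independentD[OF ind, of "\<lambda>i. coeff (c i) M" k] k(1) by blast
  then show False
    using k by auto
qed

text \<open>Moving the part with \<open>w\<close> to the other side and squaring gives B^2 = P C^2
  for polynomials in J, so both parts of the relation vanish separately.\<close>

lemma independent_with_sqrt:
  fixes a b P f g :: "'a::field_char_0 poly"
  assumes ind: "quartic_independent a b"
    and w: "w ^ 2 = at_J P" and nonsquare: "\<And>d. poly P 1 \<noteq> d ^ 2"
    and fg: "f \<noteq> 0" "g \<noteq> 0"
    and rel: "at_J f * (\<Sum>i<4. fps_of_poly (c i) * at_J (a ^ i * b ^ (3 - i))) +
      w * at_J g * (\<Sum>i<4. fps_of_poly (d i) * at_J (a ^ i * b ^ (3 - i))) = 0"
    and "i < 4"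
  shows "c i = 0" "d i = 0"
proof -
  interpret a: unital_ring_hom "at_J :: 'a poly \<Rightarrow> _" by (rule unital_ring_hom_at_J)
  define M where "M = (\<Sum>i<4. degree (c i) + degree (d i))"
  have "degree (c j) + degree (d j) \<le> M" if "j < 4" for j
    unfolding M_def using that by (intro member_le_sum) auto
  then have le: "degree (c j) \<le> M" "degree (d j) \<le> M" if "j < 4" for j
    using that by fastforce+
  define C where "C = (\<Sum>i<4. fps_of_poly (c i) * at_J (a ^ i * b ^ (3 - i)))"
  define D where "D = (\<Sum>i<4. fps_of_poly (d i) * at_J (a ^ i * b ^ (3 - i)))"
  define C' where "C' = (\<Sum>i<4. subst_t M (c i) * (a ^ i * b ^ (3 - i)))"
  define D' where "D' = (\<Sum>i<4. subst_t M (d i) * (a ^ i * b ^ (3 - i)))"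
  define n :: "'a fps" where "n = at_J (quartic zvar) ^ M"
  have n: "n \<noteq> 0"
    by (simp add: n_def)
  have C': "at_J C' = C * n" and D': "at_J D' = D * n"
    unfolding C_def D_def C'_def D'_def n_def by (rule at_J_subst_t_sum; simp add: le)+
  have rel': "at_J f * C = - (w * at_J g * D)"
    using rel by (simp add: C_def D_def eq_neg_iff_add_eq_0)
  have "at_J ((f * C') ^ 2) = (at_J f * C) ^ 2 * n ^ 2"
    by (simp only: a.hom_power a.hom_mult C' power_mult_distrib mult_ac)
  also have "(at_J f * C) ^ 2 = (w * at_J g * D) ^ 2"
    by (simp only: rel' power2_minus)
  also have "\<dots> * n ^ 2 = w ^ 2 * (at_J g * D * n) ^ 2"
    by (simp only: power_mult_distrib mult.assoc)
  also have "\<dots> = at_J (P * (g * D') ^ 2)"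
    by (simp only: a.hom_power a.hom_mult D' w mult.assoc)
  finally have "(f * C') ^ 2 = P * (g * D') ^ 2"
    by (simp add: at_J_inj)
  from square_mult_eq_square[OF this nonsquare] have "D' = 0"
    using fg by simp
  then have "D = 0"
    using D' n a.hom_zero by simp
  then have "C = 0"
    using rel' fg by simp
  show "c i = 0"
    using ind \<open>C = 0\<close> \<open>i < 4\<close> unfolding C_def by (rule independent_over_t)
  show "d i = 0"
    using ind \<open>D = 0\<close> \<open>i < 4\<close> unfolding D_def by (rule independent_over_t)
qed

text \<open>A nonzero combination of 1, z, z^2, z^3 has degree less than 4.\<close>

lemma quartic_independent_L: "quartic_independent zvar (1 :: 'a::field_char_0 poly)"
  unfolding quartic_independent_def
proof (intro allI impI)
  fix q :: "nat \<Rightarrow> 'a" and i :: nat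
  assume dvd: "quartic zvar dvd (\<Sum>i<4. smult (q i) (zvar ^ i * 1 ^ (3 - i)))" and "i < 4"
  define r where "r = (\<Sum>i<4. monom (q i) i)"
  have r: "r = (\<Sum>i<4. smult (q i) (zvar ^ i * 1 ^ (3 - i)))"
    by (simp add: r_def zvar_def monom_altdef)
  have "r = 0"
  proof (rule ccontr)
    assume "r \<noteq> 0"
    with dvd have "4 \<le> degree r"
      unfolding r[symmetric] using dvd_imp_degree_le[of "quartic zvar" r] by (simp add: degree_quartic)
    moreover have "degree r \<le> 3"
      unfolding r_def
    proof (rule degree_sum_le)
      fix i :: nat assume "i \<in> {..<4}"
      then show "degree (monom (q i) i) \<le> 3"
        using degree_monom_le[of "q i" i] by simp
    qed simp
    ultimately show False by simp
  qed
  then have "coeff r i = 0" by simp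
  then show "q i = 0"
    using \<open>i < 4\<close> by (simp add: r_def coeff_sum)
qed

text \<open>At \<open>x = \<infinity>\<close>, the squares of \<open>S\<close> and \<open>x S\<^sub>0\<close> become \<open>J\<^sup>-\<^sup>2\<close> up to a factor in \<open>\<rat>(x, y, t)\<close>, which reduces
  the independence of their powers to even polynomials in \<open>J\<close>.\<close>

lemma quartic_independent_S:
  "quartic_independent (slit_poly zvar [:fls_X :: 'a::field_char_0 fls:]) (zvar ^ 2 * (1 - zvar) ^ 2)"
  unfolding quartic_independent_def
proof (intro allI impI)
  fix q :: "nat \<Rightarrow> 'a fls" and i :: nat
  define a b :: "'a fps poly"
    where "a = slit_poly zvar [:fps_X:]" "b = zvar ^ 2 * (1 - zvar) ^ 2"
  interpret f: unital_ring_hom "fps_to_fls :: 'a fps \<Rightarrow> _" by (rule unital_ring_hom_fps_to_fls)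
  interpret fm: unital_ring_hom "map_poly (fps_to_fls :: 'a fps \<Rightarrow> _)"
    by (rule f.unital_ring_hom_map_poly)
  interpret z: unital_ring_hom "\<lambda>f :: 'a fps. fps_nth f 0" by (rule unital_ring_hom_fps_nth_0)
  interpret zm: unital_ring_hom "map_poly (\<lambda>f :: 'a fps. fps_nth f 0)"
    by (rule z.unital_ring_hom_map_poly)
  have zv: "map_poly fps_to_fls zvar = (zvar :: 'a fls poly)"
    "map_poly (\<lambda>f :: 'a fps. fps_nth f 0) zvar = zvar"
    by (simp_all add: zvar_def f.map_poly_pCons_hom z.map_poly_pCons_hom f.homs)
  have f: "map_poly fps_to_fls a = slit_poly zvar [:fls_X:]"
    "map_poly fps_to_fls b = zvar ^ 2 * (1 - zvar) ^ 2"
    by (simp_all add: a_b_def fm.hom_slit_poly fm.homs zv f.map_poly_pCons_hom)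
  have z: "map_poly (\<lambda>f. fps_nth f 0) a = (1 - zvar) ^ 2"
    "map_poly (\<lambda>f. fps_nth f 0) b = zvar ^ 2 * (1 - zvar) ^ 2"
    by (simp_all add: a_b_def zm.hom_slit_poly zm.homs zv z.map_poly_pCons_hom)
      (simp add: slit_poly_def)
  assume "quartic zvar dvd
      (\<Sum>i<4. smult (q i) (slit_poly zvar [:fls_X:] ^ i * (zvar ^ 2 * (1 - zvar) ^ 2) ^ (3 - i)))" "i < 4"
  then show "q i = 0"
    unfolding f[symmetric]
    by (intro quartic_dvd_specialize[of a b q i]) (auto simp only: z intro: quartic_dvd_even)
qed

text \<open>Here x has a pole at the special point, so x^2 is first taken out of
  \<open>slit_poly\<close>; the remaining \<open>b\<close> is regular at x = infinity with value z^2
  (1 - z)^2.\<close>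

lemma quartic_independent_S0:
  "quartic_independent ((1 - zvar) ^ 2) (slit_poly zvar [:fls_X_inv :: 'a::field_char_0 fls:])"
  unfolding quartic_independent_def
proof (intro allI impI)
  fix q :: "nat \<Rightarrow> 'a fls" and i :: nat
  define a b :: "'a fps poly" where "a = (1 - zvar) ^ 2"
    "b = [:fps_X:] ^ 2 * (1 - zvar) ^ 2 - 2 * zvar * (1 + zvar ^ 2) * [:fps_X:] + zvar ^ 2 * (1 - zvar) ^ 2"
  interpret f: unital_ring_hom "fps_to_fls :: 'a fps \<Rightarrow> _" by (rule unital_ring_hom_fps_to_fls)
  interpret fm: unital_ring_hom "map_poly (fps_to_fls :: 'a fps \<Rightarrow> _)"
    by (rule f.unital_ring_hom_map_poly)
  interpret z: unital_ring_hom "\<lambda>f :: 'a fps. fps_nth f 0" by (rule unital_ring_hom_fps_nth_0)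
  interpret zm: unital_ring_hom "map_poly (\<lambda>f :: 'a fps. fps_nth f 0)"
    by (rule z.unital_ring_hom_map_poly)
  have zv: "map_poly fps_to_fls zvar = (zvar :: 'a fls poly)"
    "map_poly (\<lambda>f :: 'a fps. fps_nth f 0) zvar = zvar"
    by (simp_all add: zvar_def f.map_poly_pCons_hom z.map_poly_pCons_hom f.homs)
  have f: "map_poly fps_to_fls a = (1 - zvar) ^ 2"
    by (simp add: a_b_def fm.homs zv)
  have z: "map_poly (\<lambda>f. fps_nth f 0) a = (1 - zvar) ^ 2"
    "map_poly (\<lambda>f. fps_nth f 0) b = zvar ^ 2 * (1 - zvar) ^ 2"
    unfolding a_b_def zm.homs zv z.map_poly_pCons_hom by simp_all
  have inv: "[:fls_X:] * [:fls_X_inv:] = (1 :: 'a fls poly)"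
    by (simp add: fls_X_times_conv_shift fls_X_inv_conv_shift_1 one_pCons)
  have b: "slit_poly zvar [:fls_X_inv:] = smult (fls_X_inv ^ 2) (map_poly fps_to_fls b)"
  proof -
    have mb: "map_poly fps_to_fls b =
        [:fls_X:] ^ 2 * (1 - zvar) ^ 2 - 2 * zvar * (1 + zvar ^ 2) * [:fls_X:] + zvar ^ 2 * (1 - zvar) ^ 2"
      unfolding a_b_def fm.homs zv f.map_poly_pCons_hom by simp
    have sm: "smult (fls_X_inv ^ 2) p = [:fls_X_inv:] ^ 2 * p" for p :: "'a fls poly"
      by (simp add: power2_eq_square)
    show ?thesis
      unfolding mb sm slit_poly_def using inv by algebra
  qed
  assume "quartic zvar dvd
      (\<Sum>i<4. smult (q i) (((1 - zvar) ^ 2) ^ i * slit_poly zvar [:fls_X_inv:] ^ (3 - i)))" and i: "i < 4"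
  then have "quartic zvar dvd (\<Sum>i<4. smult (q i * (fls_X_inv ^ 2) ^ (3 - i))
      (map_poly fps_to_fls a ^ i * map_poly fps_to_fls b ^ (3 - i)))"
    by (simp add: b f smult_power mult_smult_right)
  then have "q i * (fls_X_inv ^ 2) ^ (3 - i) = 0"
    using i
    by (intro quartic_dvd_specialize[of a b "\<lambda>i. q i * (fls_X_inv ^ 2) ^ (3 - i)" i])
      (auto simp only: z intro: quartic_dvd_even)
  then show "q i = 0" by simp
qed

text \<open>At z = 1 the polynomial is -4 times the point, which has odd valuation, whereas squares
  have even valuation.\<close>

lemma slit_poly_nonsquare:
  fixes \<xi> d :: "'a::field_char_0 fls"
  assumes "odd (fls_subdegree \<xi>)"
  shows "poly (slit_poly zvar [:\<xi>:]) 1 \<noteq> d ^ 2"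
proof
  assume "poly (slit_poly zvar [:\<xi>:]) 1 = d ^ 2"
  then have eq: "(- 4) * \<xi> = d ^ 2"
    by (simp add: slit_poly_def zvar_def mult.commute)
  have "\<xi> \<noteq> 0"
    using assms by auto
  then have "d \<noteq> 0"
    using eq by auto
  have "fls_subdegree ((- 4) * \<xi>) = fls_subdegree (- 4 :: 'a fls) + fls_subdegree \<xi>"
    using \<open>\<xi> \<noteq> 0\<close> by (intro fls_subdegree_mult) auto
  also have "fls_subdegree (- 4 :: 'a fls) = 0"
    by simp
  finally have "fls_subdegree (d ^ 2) = fls_subdegree \<xi>"
    by (simp only: eq add_0_left)
  then have "fls_subdegree \<xi> = 2 * fls_subdegree d"
    using \<open>d \<noteq> 0\<close> by (simp add: fls_subdegree_pow)
  with assms show False by simp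
qed

end

section \<open>Algebraic degrees\<close>

context subfield
begin

text \<open>Gaussian elimination: a pivot \<open>p\<close> clears coordinate n in the other vectors,
  and its coefficient is recovered from theirs. All scalars stay in \<open>F\<close>.\<close>

lemma linear_dependence:
  fixes v :: "'i \<Rightarrow> nat \<Rightarrow> 'a"
  assumes "finite I" "n < card I" "\<And>i k. i \<in> I \<Longrightarrow> k < n \<Longrightarrow> v i k \<in> F"
  shows "\<exists>c. (\<forall>i. c i \<in> F) \<and> (\<exists>i\<in>I. c i \<noteq> 0) \<and> (\<forall>k<n. (\<Sum>i\<in>I. c i * v i k) = 0)"
  using assms
proof (induction n arbitrary: I v)
  case 0
  then obtain i where "i \<in> I" by (metis card.empty ex_in_conv less_irrefl)
  then show ?case
    by (intro exI[of _ "\<lambda>_. 1"]) (auto simp: one_in)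
next
  case (Suc n)
  show ?case
  proof (cases "\<forall>i\<in>I. v i n = 0")
    case True
    obtain c where "\<forall>i. c i \<in> F" "\<exists>i\<in>I. c i \<noteq> 0" "\<forall>k<n. (\<Sum>i\<in>I. c i * v i k) = 0"
      using Suc.IH[of I v] Suc.prems by auto
    then show ?thesis
      using True by (intro exI[of _ c]) (auto simp: less_Suc_eq)
  next
    case False
    then obtain p where p: "p \<in> I" "v p n \<noteq> 0" by blast
    define w where "w i k = v i k - v i n / v p n * v p k" for i k
    have "w i k \<in> F" if "i \<in> I - {p}" "k < n" for i k
      unfolding w_def using that p Suc.prems(3) by (intro closed) auto
    moreover have "n < card (I - {p})"
      using Suc.prems(1,2) p(1) by (simp add: less_diff_conv)
    ultimately obtain c where c: "\<forall>i. c i \<in> F" "\<exists>i\<in>I - {p}. c i \<noteq> 0"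
        "\<forall>k<n. (\<Sum>i\<in>I - {p}. c i * w i k) = 0"
      using Suc.IH[of "I - {p}" w] Suc.prems(1) by auto
    define s where "s = (\<Sum>i\<in>I - {p}. c i * (v i n / v p n))"
    define d where "d i = (if i = p then - s else if i \<in> I then c i else 0)" for i
    have "s \<in> F"
      unfolding s_def using c(1) p Suc.prems(3) by (intro sum_in mult_in divide_in) auto
    then have d: "d i \<in> F" for i
      using c(1) by (auto simp: d_def closed)
    have eq: "(\<Sum>i\<in>I. d i * v i k) = (\<Sum>i\<in>I - {p}. c i * w i k)" for k
    proof -
      have "(\<Sum>i\<in>I. d i * v i k) = - s * v p k + (\<Sum>i\<in>I - {p}. d i * v i k)"
        using Suc.prems(1) p(1) by (simp add: sum.remove d_def)
      also have "(\<Sum>i\<in>I - {p}. d i * v i k) = (\<Sum>i\<in>I - {p}. c i * v i k)"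
        by (rule sum.cong) (auto simp: d_def)
      also have "- s * v p k + \<dots> = (\<Sum>i\<in>I - {p}. c i * w i k)"
        by (simp add: s_def w_def right_diff_distrib sum_subtractf sum_distrib_right mult.assoc)
      finally show ?thesis .
    qed
    have "(\<Sum>i\<in>I. d i * v i k) = 0" if "k < Suc n" for k
    proof (cases "k = n")
      case True
      then show ?thesis
        using p(2) by (simp add: eq w_def)
    next
      case False
      then show ?thesis
        using that c(3) by (simp add: eq)
    qed
    moreover have "\<exists>i\<in>I. d i \<noteq> 0"
      using c(2) by (auto simp: d_def)
    ultimately show ?thesis
      using d by blast
  qed
qed

text \<open>Once z^4 lies in this span, it is closed under multiplication; for z = J this is ensured
  by the equation for J.\<close>

definition span4 :: "'a \<Rightarrow> 'a set" where
  "span4 z = {s. \<exists>f. (\<forall>k. f k \<in> F) \<and> s = (\<Sum>k<4. f k * z ^ k)}"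

lemma span4I: "(\<And>k. f k \<in> F) \<Longrightarrow> s = (\<Sum>k<4. f k * z ^ k) \<Longrightarrow> s \<in> span4 z"
  unfolding span4_def by blast

lemma span4_const: "c \<in> F \<Longrightarrow> c \<in> span4 z"
  by (rule span4I[of "\<lambda>k. if k = 0 then c else 0"]) (auto simp: closed numeral_eq_Suc)

lemma span4_add: "a \<in> span4 z \<Longrightarrow> b \<in> span4 z \<Longrightarrow> a + b \<in> span4 z"
proof -
  assume "a \<in> span4 z" "b \<in> span4 z"
  then obtain f g where "\<forall>k. f k \<in> F" "a = (\<Sum>k<4. f k * z ^ k)"
    "\<forall>k. g k \<in> F" "b = (\<Sum>k<4. g k * z ^ k)"
    by (auto simp: span4_def)
  then show ?thesis
    by (intro span4I[of "\<lambda>k. f k + g k"]) (auto simp: closed sum.distrib distrib_right)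
qed

lemma span4_scale: "c \<in> F \<Longrightarrow> a \<in> span4 z \<Longrightarrow> c * a \<in> span4 z"
proof -
  assume "c \<in> F" "a \<in> span4 z"
  then obtain f where "\<forall>k. f k \<in> F" "a = (\<Sum>k<4. f k * z ^ k)"
    by (auto simp: span4_def)
  with \<open>c \<in> F\<close> show ?thesis
    by (intro span4I[of "\<lambda>k. c * f k"]) (auto simp: closed sum_distrib_left mult.assoc)
qed

lemma span4_sum: "(\<And>i. i \<in> A \<Longrightarrow> f i \<in> span4 z) \<Longrightarrow> sum f A \<in> span4 z"
  by (induction A rule: infinite_finite_induct) (auto intro: span4_const span4_add zero_in)

context
  fixes z
  assumes z4: "z ^ 4 \<in> span4 z"
begin

lemma span4_mult_gen: "a \<in> span4 z \<Longrightarrow> z * a \<in> span4 z"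
proof -
  assume "a \<in> span4 z"
  then obtain f where f: "\<forall>k. f k \<in> F" "a = (\<Sum>k<4. f k * z ^ k)"
    by (auto simp: span4_def)
  define g where "g k = (if k = 0 then 0 else f (k - 1))" for k
  have "z * a = (\<Sum>k<4. g k * z ^ k) + f 3 * z ^ 4"
    by (simp add: f g_def numeral_eq_Suc algebra_simps)
  also have "\<dots> \<in> span4 z"
  proof (rule span4_add)
    show "(\<Sum>k<4. g k * z ^ k) \<in> span4 z"
      by (rule span4I[of g]) (use f in \<open>auto simp: g_def closed\<close>)
    show "f 3 * z ^ 4 \<in> span4 z"
      using f z4 by (intro span4_scale) auto
  qed
  finally show ?thesis .
qed

lemma span4_mult_power: "a \<in> span4 z \<Longrightarrow> z ^ k * a \<in> span4 z"
  by (induction k) (auto simp: mult.assoc intro: span4_mult_gen)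

lemma span4_mult: "a \<in> span4 z \<Longrightarrow> b \<in> span4 z \<Longrightarrow> a * b \<in> span4 z"
proof -
  assume "a \<in> span4 z" and b: "b \<in> span4 z"
  then obtain f where f: "\<forall>k. f k \<in> F" "a = (\<Sum>k<4. f k * z ^ k)"
    by (auto simp: span4_def)
  have "a * b = (\<Sum>k<4. f k * (z ^ k * b))"
    by (simp add: f sum_distrib_right mult.assoc)
  also have "\<dots> \<in> span4 z"
    using f b by (intro span4_sum span4_scale span4_mult_power) auto
  finally show ?thesis .
qed

lemma span4_gen: "z \<in> span4 z"
  using span4_mult_gen[OF span4_const[OF one_in]] by simp

lemma span4_diff: "a \<in> span4 z \<Longrightarrow> b \<in> span4 z \<Longrightarrow> a - b \<in> span4 z"
  using span4_add[of a z "- 1 * b"] span4_scale[of "- 1" b z] by (simp add: closed)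

lemma span4_power: "a \<in> span4 z \<Longrightarrow> a ^ n \<in> span4 z"
  by (induction n) (auto intro: span4_mult span4_const one_in)

lemmas span4_closed = span4_const span4_add span4_diff span4_mult span4_gen span4_power

text \<open>The five products a^i b^(4-i) lie in a span of four elements and so satisfy a linear
  relation. Since w^2 is \<open>\<tau>\<close> times a/b, it becomes a polynomial of degree at most
  4 in w^2.\<close>

lemma sqrt_annihilator:
  assumes a: "a \<in> span4 z" and b: "b \<in> span4 z" "b \<noteq> 0"
    and \<tau>: "\<tau> \<in> F" "\<tau> \<noteq> 0" and w: "w ^ 2 * b = \<tau> * a"
  obtains p where "p \<noteq> 0" "set (coeffs p) \<subseteq> F" "poly p w = 0" "degree p \<le> 8"
proof -
  have "a ^ i * b ^ (4 - i) \<in> span4 z" for i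
    using a b by (intro span4_mult span4_power)
  then have "\<forall>i. \<exists>f. (\<forall>k. f k \<in> F) \<and> a ^ i * b ^ (4 - i) = (\<Sum>k<4. f k * z ^ k)"
    by (simp add: span4_def)
  from choice[OF this] obtain v where v: "\<And>i k. v i k \<in> F"
      "\<And>i. a ^ i * b ^ (4 - i) = (\<Sum>k<4. v i k * z ^ k)"
    by blast
  obtain c where c: "\<And>i. c i \<in> F" "\<exists>i\<in>{..4::nat}. c i \<noteq> 0" "\<And>k. k < 4 \<Longrightarrow> (\<Sum>i\<le>4. c i * v i k) = 0"
    using linear_dependence[of "{..4::nat}" 4 v] v(1) by auto
  have "(\<Sum>i\<le>4. c i * (a ^ i * b ^ (4 - i))) = (\<Sum>k<4. (\<Sum>i\<le>4. c i * v i k) * z ^ k)"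
    unfolding v(2) sum_distrib_left sum_distrib_right by (subst sum.swap) (simp only: mult.assoc)
  then have rel: "(\<Sum>i\<le>4. c i * (a ^ i * b ^ (4 - i))) = 0"
    by (simp add: c(3))
  define p where "p = (\<Sum>i\<le>4. monom (c i / \<tau> ^ i) (2 * i))"
  have coeff: "coeff p n = (\<Sum>i\<le>4. if 2 * i = n then c i / \<tau> ^ i else 0)" for n
    by (simp add: p_def coeff_sum)
  have "coeff p n \<in> F" for n
    unfolding coeff using c(1) \<tau> by (intro sum_in) (auto intro: closed)
  then have F: "set (coeffs p) \<subseteq> F"
    by (auto simp: coeffs_def)
  obtain i where i: "i \<le> 4" "c i \<noteq> 0"
    using c(2) by auto
  have "coeff p (2 * i) = c i / \<tau> ^ i"
    using i(1) by (simp add: coeff)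
  then have nz: "p \<noteq> 0"
    using i \<tau> by auto
  have "poly p w * b ^ 4 = (\<Sum>i\<le>4. c i * (a ^ i * b ^ (4 - i)))"
    unfolding p_def poly_sum sum_distrib_right
  proof (rule sum.cong)
    fix i :: nat assume "i \<in> {..4}"
    then have "b ^ 4 = b ^ i * b ^ (4 - i)"
      by (simp flip: power_add)
    moreover have "w ^ (2 * i) * b ^ i = \<tau> ^ i * a ^ i"
      by (simp only: power_mult power_mult_distrib[symmetric] w)
    ultimately have "w ^ (2 * i) * b ^ 4 = \<tau> ^ i * a ^ i * b ^ (4 - i)"
      by (metis mult.assoc)
    moreover have "poly (monom (c i / \<tau> ^ i) (2 * i)) w * b ^ 4 = c i / \<tau> ^ i * (w ^ (2 * i) * b ^ 4)"
      by (simp add: poly_monom)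
    ultimately show "poly (monom (c i / \<tau> ^ i) (2 * i)) w * b ^ 4 = c i * (a ^ i * b ^ (4 - i))"
      using \<tau> by simp
  qed simp
  then have "poly p w = 0"
    using rel b(2) by simp
  moreover have "degree p \<le> 8"
    unfolding p_def
  proof (rule degree_sum_le)
    fix i :: nat assume "i \<in> {..4}"
    then show "degree (monom (c i / \<tau> ^ i) (2 * i)) \<le> 8"
      using degree_monom_le[of "c i / \<tau> ^ i" "2 * i"] by simp
  qed simp
  ultimately show thesis
    using that nz F by blast
qed

end

end

lemma algebraic_of_degreeI:
  assumes "p \<noteq> 0" "set (coeffs p) \<subseteq> F" "poly p z = 0" "degree p \<le> d"
    and "\<And>p. p \<noteq> 0 \<Longrightarrow> set (coeffs p) \<subseteq> F \<Longrightarrow> poly p z = 0 \<Longrightarrow> d \<le> degree p"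
  shows "algebraic_of_degree F z d"
  using assms unfolding algebraic_of_degree_def by (metis le_antisym)

section \<open>The field Q(x,y,t) and lower bounds for degrees\<close>

interpretation Qxyt: subfield field_Q_xyt
  by unfold_locales (simp add: field_Q_xyt_def is_subfield_hull)

lemma gens_in_Qxyt: "fls_const var_x \<in> field_Q_xyt" "fls_const var_y \<in> field_Q_xyt"
    "fls_X \<in> field_Q_xyt"
  using subset_is_subfield_hull[of "{fls_const var_x, fls_const var_y, fls_X}"]
  by (simp_all add: field_Q_xyt_def)

definition fls_of_poly :: "'a::field_char_0 poly \<Rightarrow> 'a fls" where
  "fls_of_poly p = fps_to_fls (fps_of_poly p)"

lemma unital_ring_hom_fls_of_poly: "unital_ring_hom fls_of_poly"
  by unfold_locales
    (simp_all add: fls_of_poly_def fps_of_poly_add fps_of_poly_mult fls_times_fps_to_fls)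

lemma fls_of_poly_eq_0_iff [simp]: "fls_of_poly p = 0 \<longleftrightarrow> p = 0"
  using fps_of_poly_eq_iff[of p 0] by (simp add: fls_of_poly_def)

text \<open>Quotients of polynomials in t over Q(x,y) form a field that contains the
  generators.\<close>

lemma Qxyt_subset:
  "field_Q_xyt \<subseteq> {fls_of_poly a / fls_of_poly b |a b. b \<noteq> 0}" (is "_ \<subseteq> ?R")
proof -
  interpret f: unital_ring_hom "fls_of_poly :: ratfun_xy poly \<Rightarrow> _" by (rule unital_ring_hom_fls_of_poly)
  have poly: "fls_of_poly a \<in> ?R" for a
    by (rule CollectI, rule exI[of _ a], rule exI[of _ 1]) (simp add: f.homs)
  have "is_subfield ?R"
    unfolding is_subfield_def
  proof (intro conjI ballI)
    show "0 \<in> ?R" "1 \<in> ?R"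
      using poly[of 0] poly[of 1] by (simp_all only: f.homs)
    fix r assume "r \<in> ?R"
    then obtain a b where r: "r = fls_of_poly a / fls_of_poly b" "b \<noteq> 0" by blast
    show "- r \<in> ?R"
      by (rule CollectI, rule exI[of _ "- a"], rule exI[of _ b]) (simp add: f.homs r)
    show "inverse r \<in> ?R"
    proof (cases "a = 0")
      case True
      then show ?thesis using poly[of 0] by (simp add: r f.homs)
    next
      case False
      then show ?thesis
        by (intro CollectI exI[of _ b] exI[of _ a]) (simp add: r)
    qed
    fix s assume "s \<in> ?R"
    then obtain c d where s: "s = fls_of_poly c / fls_of_poly d" "d \<noteq> 0" by blast
    show "r + s \<in> ?R"
      using r(2) s(2)
      by (intro CollectI exI[of _ "a * d + c * b"] exI[of _ "b * d"]) (simp add: r s f.homs divide_simps)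
    show "r * s \<in> ?R"
      using r(2) s(2)
      by (intro CollectI exI[of _ "a * c"] exI[of _ "b * d"]) (simp add: r s f.homs)
  qed
  moreover have "fls_const c \<in> ?R" for c
    using poly[of "[:c:]"] by (simp add: fls_of_poly_def fps_of_poly_const)
  moreover have "fls_X \<in> ?R"
    using poly[of "[:0, 1:]"] by (simp add: fls_of_poly_def)
  ultimately show ?thesis
    unfolding field_Q_xyt_def by (intro hull_minimal) auto
qed

lemma common_denominator:
  assumes "finite I" "\<And>i. i \<in> I \<Longrightarrow> v i \<in> field_Q_xyt"
  shows "\<exists>d. d \<noteq> 0 \<and> (\<forall>i\<in>I. \<exists>c. fls_of_poly c = fls_of_poly d * v i)"
  using assms
proof (induction I rule: finite_induct)
  case empty
  then show ?case by (intro exI[of _ 1]) simp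
next
  case (insert j I)
  interpret f: unital_ring_hom "fls_of_poly :: ratfun_xy poly \<Rightarrow> _" by (rule unital_ring_hom_fls_of_poly)
  obtain d where d: "d \<noteq> 0" "\<forall>i\<in>I. \<exists>c. fls_of_poly c = fls_of_poly d * v i"
    using insert by auto
  obtain a b where ab: "v j = fls_of_poly a / fls_of_poly b" "b \<noteq> 0"
    using Qxyt_subset insert.prems[of j] by blast
  have "\<exists>c. fls_of_poly c = fls_of_poly (d * b) * v i" if "i \<in> insert j I" for i
  proof (cases "i = j")
    case True
    then show ?thesis
      using ab by (intro exI[of _ "d * a"]) (simp add: f.homs)
  next
    case False
    with that d obtain c where "fls_of_poly c = fls_of_poly d * v i" by blast
    then show ?thesis
      by (intro exI[of _ "c * b"]) (simp add: f.homs)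
  qed
  then show ?case
    using d ab by (intro exI[of _ "d * b"]) simp
qed

text \<open>Clearing denominators turns an annihilating polynomial over Q(x,y,t) into a relation
  between powers of z with coefficients polynomial in t.\<close>

lemma degree_lower_bound:
  fixes z :: "ratfun_xy fps"
  assumes ind: "\<And>c i. (\<Sum>i<d. fps_of_poly (c i) * z ^ i) = 0 \<Longrightarrow> i < d \<Longrightarrow> c i = 0"
    and p: "p \<noteq> 0" "set (coeffs p) \<subseteq> field_Q_xyt" "poly p (fps_to_fls z) = 0"
  shows "d \<le> degree p"
proof (rule ccontr)
  assume "\<not> d \<le> degree p"
  then have deg: "degree p < d" by simp
  have "coeff p i \<in> field_Q_xyt" for i
  proof -
    have "coeff p i \<in> insert 0 (set (coeffs p))"
      unfolding range_coeff[symmetric] by (rule rangeI)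
    also have "\<dots> \<subseteq> field_Q_xyt"
      using p(2) Qxyt.zero_in by (rule insert_subsetI[rotated])
    finally show ?thesis .
  qed
  then obtain e where e: "e \<noteq> 0" "\<forall>i\<in>{..<d}. \<exists>c. fls_of_poly c = fls_of_poly e * coeff p i"
    using common_denominator[of "{..<d}" "coeff p"] by auto
  from bchoice[OF e(2)] obtain c where c: "\<And>i. i < d \<Longrightarrow> fls_of_poly (c i) = fls_of_poly e * coeff p i"
    by auto
  have "poly p (fps_to_fls z) = (\<Sum>i<d. coeff p i * fps_to_fls z ^ i)"
    unfolding poly_altdef using deg by (intro sum.mono_neutral_left) (auto simp: coeff_eq_0)
  then have "0 = fls_of_poly e * (\<Sum>i<d. coeff p i * fps_to_fls z ^ i)"
    using p(3) by simp
  also have "\<dots> = (\<Sum>i<d. fls_of_poly (c i) * fps_to_fls z ^ i)"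
    unfolding sum_distrib_left by (rule sum.cong) (simp_all add: c)
  also have "\<dots> = fps_to_fls (\<Sum>i<d. fps_of_poly (c i) * z ^ i)"
    using unital_ring_hom.hom_sum[OF unital_ring_hom_fps_to_fls[where 'a = ratfun_xy],
        of "\<lambda>i. fps_of_poly (c i) * z ^ i" "{..<d}"]
    by (simp add: fls_of_poly_def fls_times_fps_to_fls fps_to_fls_power)
  finally have "(\<Sum>i<d. fps_of_poly (c i) * z ^ i) = 0"
    by simp
  then have "c (degree p) = 0"
    using ind deg by blast
  then have "fls_of_poly (c (degree p)) = 0"
    by (simp only: fls_of_poly_eq_0_iff)
  then have "fls_of_poly e * coeff p (degree p) = 0"
    by (simp only: c[OF deg])
  then show False
    using e(1) p(1) by simp
qed

lemma sum_lessThan_8: "(\<Sum>i<8. f i) = (\<Sum>i<4. f (2 * i)) + (\<Sum>i<4. f (2 * i + 1))"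
  for f :: "nat \<Rightarrow> 'a::comm_monoid_add"
  by (simp add: numeral_eq_Suc add_ac)

lemma less_8_cases:
  assumes "i < (8::nat)"
  obtains k where "k < 4" "i = 2 * k" | k where "k < 4" "i = 2 * k + 1"
proof (cases "even i")
  case True
  then obtain k where "i = 2 * k" by (elim evenE)
  with assms that(1)[of k] show thesis by simp
next
  case False
  then obtain k where "i = 2 * k + 1" by (elim oddE)
  with assms that(2)[of k] show thesis by simp
qed

lemma map_emb_eq_0_iff: "map_poly emb p = 0 \<longleftrightarrow> p = 0"
proof -
  interpret e: field_hom emb by (rule field_hom_emb)
  show ?thesis
    by (auto simp: poly_eq_iff)
qed

lemma emb_relation:
  assumes "(\<Sum>i\<in>I. fps_of_poly (c i) * z ^ i) = 0"
  shows "(\<Sum>i\<in>I. fps_of_poly (map_poly emb (c i)) * fps_map emb z ^ i) = 0"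
proof -
  interpret e: field_hom emb by (rule field_hom_emb)
  interpret m: unital_ring_hom "fps_map emb" by (rule e.unital_ring_hom_fps_map)
  show ?thesis
    using arg_cong[OF assms, of "fps_map emb"] by (simp add: m.homs e.fps_map_of_poly)
qed

section \<open>Independence of the powers of the three series\<close>

context J_series
begin

lemma fps_map_emb_axis: "fps_map emb (axis var_x) = axis lx"
proof -
  interpret e: field_hom emb by (rule field_hom_emb)
  show ?thesis
    by (simp add: axis_ev fps_map_fps_map field_hom_ev[OF field_hom_emb] e.hom_inverse emb_var_x)
qed

lemma fps_map_emb_H: "fps_map emb (H var_x) = H lx"
  by (simp add: H_def fps_map_fps_map field_hom_ev[OF field_hom_emb] emb_var_x)

text \<open>Multiplying by (q k)^7 replaces s^i by (t w)^i (q k)^(7-i), and the powers of t and k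
  are absorbed in the coefficients. Even i leave products P^i b^(3-i) with a factor q, odd i leave
  them with a factor w, as \<open>independent_with_sqrt\<close> requires.\<close>

lemma S_gf_independent:
  assumes rel: "(\<Sum>i<8. fps_of_poly (c i) * S_gf triangular_steps ^ i) = 0" and "i < 8"
  shows "c i = 0"
proof -
  interpret e: field_hom emb by (rule field_hom_emb)
  interpret m: unital_ring_hom "fps_map emb" by (rule e.unital_ring_hom_fps_map)
  interpret a: unital_ring_hom "at_J :: laurent_xy poly \<Rightarrow> _" by (rule unital_ring_hom_at_J)
  define C where "C i = map_poly emb (c i)" for i
  define s where "s = fps_map emb (S_gf triangular_steps)"
  define K where "K = [:1, - kernel lx ly:]"
  define k where "k = fps_of_poly K"
  define q :: "laurent_xy fps" where "q = Jc * (1 - Jc)"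
  define w where "w = W (inverse lx)"
  define P where "P = slit_poly zvar [:inverse lx:]"
  define b :: "laurent_xy poly" where "b = zvar ^ 2 * (1 - zvar) ^ 2"
  have "s * k = axis lx"
  proof -
    have k: "emb (kernel var_x var_y) = kernel lx ly"
      by (simp add: kernel_def e.homs e.hom_inverse emb_var_x emb_var_y)
    have "k = 1 - fps_X * fps_const (kernel lx ly)"
      unfolding k_def K_def by (simp add: fps_of_poly_pCons fps_of_poly_const)
    then show ?thesis
      using arg_cong[OF S_gf_eq, of "fps_map emb"]
      by (simp add: m.homs e.fps_map_X e.fps_map_const k s_def fps_map_emb_axis)
  qed
  moreover have "q * k * s = Jc * (1 - Jc) * (s * k)"
    by (simp only: q_def mult_ac)
  ultimately have sk: "q * k * s = fps_X * w"
    by (simp only: axis_eq w_def)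
  have w2: "w ^ 2 = at_J P"
    by (simp add: w_def W_square P_def a.hom_slit_poly)
  have q2: "q ^ 2 = at_J b"
    by (simp add: q_def b_def a.homs power_mult_distrib)
  have summand: "(q * k) ^ 7 * (fps_of_poly (C i) * s ^ i) =
      fps_of_poly (C i * K ^ (7 - i) * monom 1 i) * (q ^ (7 - i) * w ^ i)" if "i < 8" for i
  proof -
    have "(q * k) ^ 7 = (q * k) ^ (7 - i) * (q * k) ^ i"
      using that by (simp flip: power_add)
    then have "(q * k) ^ 7 * (fps_of_poly (C i) * s ^ i) =
        fps_of_poly (C i) * (q * k) ^ (7 - i) * (q * k * s) ^ i"
      by (simp only: power_mult_distrib mult_ac)
    also have "\<dots> = fps_of_poly (C i * K ^ (7 - i) * monom 1 i) * (q ^ (7 - i) * w ^ i)"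
      unfolding sk by (simp only: power_mult_distrib fps_of_poly_mult fps_of_poly_power
          fps_of_poly_monom' k_def mult_ac)
    finally show ?thesis .
  qed
  have "(\<Sum>i<8. fps_of_poly (C i) * s ^ i) = 0"
    using emb_relation[OF rel] by (simp add: C_def s_def)
  then have "0 = (\<Sum>i<8. (q * k) ^ 7 * (fps_of_poly (C i) * s ^ i))"
    by (simp flip: sum_distrib_left)
  also have "\<dots> = (\<Sum>i<8. fps_of_poly (C i * K ^ (7 - i) * monom 1 i) * (q ^ (7 - i) * w ^ i))"
    by (rule sum.cong) (simp_all add: summand)
  also have "\<dots> =
      at_J (zvar * (1 - zvar)) * (\<Sum>i<4. fps_of_poly (C (2 * i) * K ^ (7 - 2 * i) * monom 1 (2 * i)) *
        at_J (P ^ i * b ^ (3 - i))) +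
      w * at_J 1 * (\<Sum>i<4. fps_of_poly (C (2 * i + 1) * K ^ (7 - (2 * i + 1)) * monom 1 (2 * i + 1)) *
        at_J (P ^ i * b ^ (3 - i)))"
    unfolding sum_lessThan_8 sum_distrib_left
  proof (intro arg_cong2[of _ _ _ _ "(+)"] sum.cong refl)
    fix i :: nat assume "i \<in> {..<4}"
    then have i: "7 - 2 * i = Suc (2 * (3 - i))" "7 - (2 * i + 1) = 2 * (3 - i)"
      by auto
    have at: "at_J (P ^ i * b ^ (3 - i)) = q ^ (2 * (3 - i)) * w ^ (2 * i)"
      by (simp only: a.hom_mult a.hom_power power_mult w2 q2) (rule mult.commute)
    show "fps_of_poly (C (2 * i) * K ^ (7 - 2 * i) * monom 1 (2 * i)) * (q ^ (7 - 2 * i) * w ^ (2 * i)) =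
        at_J (zvar * (1 - zvar)) * (fps_of_poly (C (2 * i) * K ^ (7 - 2 * i) * monom 1 (2 * i)) *
          at_J (P ^ i * b ^ (3 - i)))"
      unfolding at i by (simp add: a.homs q_def[symmetric] mult_ac)
    show "fps_of_poly (C (2 * i + 1) * K ^ (7 - (2 * i + 1)) * monom 1 (2 * i + 1)) *
          (q ^ (7 - (2 * i + 1)) * w ^ (2 * i + 1)) =
        w * at_J 1 * (fps_of_poly (C (2 * i + 1) * K ^ (7 - (2 * i + 1)) * monom 1 (2 * i + 1)) *
          at_J (P ^ i * b ^ (3 - i)))"
      unfolding at i by (simp add: a.homs mult_ac)
  qed
  finally have rel': "at_J (zvar * (1 - zvar)) *
      (\<Sum>i<4. fps_of_poly (C (2 * i) * K ^ (7 - 2 * i) * monom 1 (2 * i)) * at_J (P ^ i * b ^ (3 - i))) +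
      w * at_J 1 * (\<Sum>i<4. fps_of_poly (C (2 * i + 1) * K ^ (7 - (2 * i + 1)) * monom 1 (2 * i + 1)) *
        at_J (P ^ i * b ^ (3 - i))) = 0" ..
  have ind: "quartic_independent P b"
    unfolding P_def b_def inverse_lx by (rule quartic_independent_S)
  have nonsquare: "poly P 1 \<noteq> d ^ 2" for d
    unfolding P_def inverse_lx by (rule slit_poly_nonsquare) simp
  have nz: "zvar * (1 - zvar) \<noteq> (0 :: laurent_xy poly)"
    by (simp add: zvar_def one_pCons)
  have K: "K \<noteq> 0"
    by (simp add: K_def)
  have "C (2 * i) = 0" "C (2 * i + 1) = 0" if "i < 4" for i
    using independent_with_sqrt[OF ind w2 nonsquare nz one_neq_zero rel' that] K
    by (auto simp: monom_eq_0_iff)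
  then have "C i = 0"
    using less_8_cases[OF \<open>i < 8\<close>] by metis
  then show ?thesis
    by (simp add: C_def map_emb_eq_0_iff)
qed

text \<open>The root is now in the denominator, so the relation is multiplied by w^8. Even exponents
  leave a factor P and odd ones a factor w (1 - J).\<close>

lemma S0_gf_independent:
  assumes rel: "(\<Sum>i<8. fps_of_poly (c i) * S0_gf triangular_steps ^ i) = 0" and "i < 8"
  shows "c i = 0"
proof -
  interpret a: unital_ring_hom "at_J :: laurent_xy poly \<Rightarrow> _" by (rule unital_ring_hom_at_J)
  define C where "C i = map_poly emb (c i)" for i
  define s where "s = H lx"
  define w where "w = W lx"
  define P where "P = slit_poly zvar [:lx:]"
  define b :: "laurent_xy poly" where "b = (1 - zvar) ^ 2"
  have sw: "s * w = 1 - Jc"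
    by (simp add: s_def w_def H_mult_W)
  have w2: "w ^ 2 = at_J P"
    by (simp add: w_def W_square P_def a.hom_slit_poly)
  have q2: "(1 - Jc) ^ 2 = at_J b"
    by (simp add: b_def a.homs)
  have summand: "w ^ 8 * (fps_of_poly (C i) * s ^ i) = fps_of_poly (C i) * ((1 - Jc) ^ i * w ^ (8 - i))"
    if "i < 8" for i
  proof -
    have "w ^ 8 = w ^ i * w ^ (8 - i)"
      using that by (simp flip: power_add)
    then show ?thesis
      by (simp only: sw[symmetric] power_mult_distrib mult_ac)
  qed
  have "(\<Sum>i<8. fps_of_poly (C i) * s ^ i) = 0"
    using emb_relation[OF rel] by (simp add: C_def s_def S0_gf_eq fps_map_emb_H)
  then have "0 = (\<Sum>i<8. w ^ 8 * (fps_of_poly (C i) * s ^ i))"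
    by (simp flip: sum_distrib_left)
  also have "\<dots> = (\<Sum>i<8. fps_of_poly (C i) * ((1 - Jc) ^ i * w ^ (8 - i)))"
    by (rule sum.cong) (simp_all add: summand)
  also have "\<dots> =
      at_J P * (\<Sum>i<4. fps_of_poly (C (2 * i)) * at_J (b ^ i * P ^ (3 - i))) +
      w * at_J (1 - zvar) * (\<Sum>i<4. fps_of_poly (C (2 * i + 1)) * at_J (b ^ i * P ^ (3 - i)))"
    unfolding sum_lessThan_8 sum_distrib_left
  proof (intro arg_cong2[of _ _ _ _ "(+)"] sum.cong refl)
    fix i :: nat assume "i \<in> {..<4}"
    then have i: "8 - 2 * i = 2 + 2 * (3 - i)" "8 - (2 * i + 1) = Suc (2 * (3 - i))"
      by auto
    have at: "at_J (b ^ i * P ^ (3 - i)) = (1 - Jc) ^ (2 * i) * w ^ (2 * (3 - i))"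
      by (simp only: a.hom_mult a.hom_power power_mult w2 q2)
    show "fps_of_poly (C (2 * i)) * ((1 - Jc) ^ (2 * i) * w ^ (8 - 2 * i)) =
        at_J P * (fps_of_poly (C (2 * i)) * at_J (b ^ i * P ^ (3 - i)))"
      unfolding at i power_add w2[symmetric] by (simp only: mult_ac)
    show "fps_of_poly (C (2 * i + 1)) * ((1 - Jc) ^ (2 * i + 1) * w ^ (8 - (2 * i + 1))) =
        w * at_J (1 - zvar) * (fps_of_poly (C (2 * i + 1)) * at_J (b ^ i * P ^ (3 - i)))"
      unfolding at i by (simp add: a.homs mult_ac)
  qed
  finally have rel': "at_J P * (\<Sum>i<4. fps_of_poly (C (2 * i)) * at_J (b ^ i * P ^ (3 - i))) +
      w * at_J (1 - zvar) * (\<Sum>i<4. fps_of_poly (C (2 * i + 1)) * at_J (b ^ i * P ^ (3 - i))) = 0" ..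
  have ind: "quartic_independent b P"
    unfolding P_def b_def lx_def by (rule quartic_independent_S0)
  have nonsquare: "poly P 1 \<noteq> d ^ 2" for d
    unfolding P_def lx_def by (rule slit_poly_nonsquare) simp
  have "P \<noteq> 0"
    using nonsquare[of 0] by auto
  moreover have "1 - zvar \<noteq> (0 :: laurent_xy poly)"
    by (simp add: zvar_def one_pCons)
  ultimately have "C (2 * i) = 0" "C (2 * i + 1) = 0" if "i < 4" for i
    using independent_with_sqrt[OF ind w2 nonsquare _ _ rel' that] by auto
  then have "C i = 0"
    using less_8_cases[OF \<open>i < 8\<close>] by metis
  then show ?thesis
    by (simp add: C_def map_emb_eq_0_iff)
qed

lemma Lc_independent:
  fixes c :: "nat \<Rightarrow> 'a::field_char_0 poly"
  assumes rel: "(\<Sum>i<4. fps_of_poly (c i) * Lc ^ i) = 0" and "i < 4"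
  shows "c i = 0"
proof -
  interpret a: unital_ring_hom "at_J :: 'a poly \<Rightarrow> _" by (rule unital_ring_hom_at_J)
  have "0 = (\<Sum>i<4. fps_X ^ 3 * (fps_of_poly (c i) * Lc ^ i))"
    by (simp add: rel flip: sum_distrib_left)
  also have "\<dots> = (\<Sum>i<4. fps_of_poly (c i * monom 1 (3 - i)) * at_J (zvar ^ i * 1 ^ (3 - i)))"
  proof (rule sum.cong)
    fix i :: nat assume "i \<in> {..<4}"
    then have "(fps_X :: 'a fps) ^ 3 = fps_X ^ (3 - i) * fps_X ^ i"
      by (simp flip: power_add)
    moreover have "Jc ^ i = fps_X ^ i * (Lc ^ i :: 'a fps)"
      by (simp only: Jc_eq_X_Lc power_mult_distrib)
    ultimately show "fps_X ^ 3 * (fps_of_poly (c i) * Lc ^ i) =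
        fps_of_poly (c i * monom 1 (3 - i)) * at_J (zvar ^ i * 1 ^ (3 - i))"
      by (simp add: a.homs fps_of_poly_mult fps_of_poly_monom' mult_ac)
  qed simp
  finally have "(\<Sum>i<4. fps_of_poly (c i * monom 1 (3 - i)) * at_J (zvar ^ i * 1 ^ (3 - i))) = 0" ..
  from independent_over_t[OF quartic_independent_L this \<open>i < 4\<close>]
  show ?thesis
    by (simp add: monom_eq_0_iff)
qed

section \<open>Upper bounds for the degrees and conclusion\<close>

abbreviation Jxyt :: "ratfun_xy fls" where "Jxyt \<equiv> fps_to_fls Jc"

lemma Jxyt_eq: "Jxyt * (1 - Jxyt) ^ 2 = fls_X * quartic Jxyt"
proof -
  interpret f: unital_ring_hom "fps_to_fls :: ratfun_xy fps \<Rightarrow> _" by (rule unital_ring_hom_fps_to_fls)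
  show ?thesis
    using arg_cong[OF Jc_eq[where 'a = ratfun_xy], of fps_to_fls]
    by (simp add: f.hom_mult f.hom_power f.hom_quartic)
qed

lemma Jxyt_power_4: "Jxyt ^ 4 \<in> Qxyt.span4 Jxyt"
proof (rule Qxyt.span4I)
  define r where "r = inverse (fls_X :: ratfun_xy fls)"
  have r: "r \<in> field_Q_xyt"
    using gens_in_Qxyt(3) unfolding r_def by (rule Qxyt.inverse_in)
  have tr: "fls_X * r = 1"
    unfolding r_def by (rule right_inverse) simp
  \<comment> \<open>The equation for J divided by t and solved for J^4, with r = 1/t.\<close>
  define f :: "nat \<Rightarrow> ratfun_xy fls" where
    "f k = (if k = 0 then - 1 else if k = 1 then 2 + r else if k = 2 then - 6 - 2 * r else 2 + r)" for k
  show "f k \<in> field_Q_xyt" for k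
    unfolding f_def using r by (auto intro!: Qxyt.closed)
  have "fls_X * Jxyt ^ 4 = fls_X * (\<Sum>k<4. f k * Jxyt ^ k)"
  proof -
    have "(\<Sum>k<4. f k * Jxyt ^ k) = - 1 + (2 + r) * Jxyt + (- 6 - 2 * r) * Jxyt ^ 2 + (2 + r) * Jxyt ^ 3"
      by (simp add: f_def eval_nat_numeral)
    then show ?thesis
      using Jxyt_eq tr unfolding quartic_def by algebra
  qed
  then show "Jxyt ^ 4 = (\<Sum>k<4. f k * Jxyt ^ k)"
    by simp
qed

lemma fps_to_fls_const: "fps_to_fls (fps_const c) = fls_const c"
  by (rule fls_eqI) simp

lemma slit_poly_in_span4:
  assumes "\<xi> \<in> field_Q_xyt"
  shows "slit_poly Jxyt \<xi> \<in> Qxyt.span4 Jxyt"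
  unfolding slit_poly_def
  by (intro Qxyt.span4_closed[OF Jxyt_power_4] assms Qxyt.closed)

lemma W_square_fls: "fps_to_fls (W c) ^ 2 = slit_poly Jxyt (fls_const c)"
proof -
  interpret f: unital_ring_hom "fps_to_fls :: ratfun_xy fps \<Rightarrow> _" by (rule unital_ring_hom_fps_to_fls)
  show ?thesis
    using arg_cong[OF W_square[of c], of fps_to_fls]
    by (simp add: f.hom_power f.hom_slit_poly fps_to_fls_const)
qed

lemma Jxyt_nz: "Jxyt * (1 - Jxyt) \<noteq> 0"
proof -
  have "fps_to_fls (Jc * (1 - Jc) :: ratfun_xy fps) \<noteq> 0"
    by (subst fps_to_fls_eq_0_iff) simp
  then show ?thesis by (simp add: fls_times_fps_to_fls)
qed

definition kernel_fls :: "ratfun_xy fls" where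
  "kernel_fls = 1 - fls_X * (fls_const var_x + 1 / fls_const var_x + fls_const var_y * (1 + fls_const var_x)
    + 1 / fls_const var_y * (1 + 1 / fls_const var_x))"

lemma kernel_fls_eq: "kernel_fls = fps_to_fls (1 - fps_X * fps_const (kernel var_x var_y))"
proof -
  interpret f: field_hom "fls_const :: ratfun_xy \<Rightarrow> _" by (rule field_hom_fls_const)
  show ?thesis
    by (simp add: kernel_fls_def kernel_def fls_times_fps_to_fls fps_to_fls_const f.homs f.hom_divide
        inverse_eq_divide)
qed

lemma kernel_fls_nz: "kernel_fls \<noteq> 0"
proof -
  have "fps_nth (1 - fps_X * fps_const (kernel var_x var_y)) 0 = 1"
    by simp
  then have "1 - fps_X * fps_const (kernel var_x var_y) \<noteq> 0"
    by (metis fps_zero_nth zero_neq_one)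
  then show ?thesis
    unfolding kernel_fls_eq by (subst fps_to_fls_eq_0_iff)
qed

lemma S_gf_fls:
  "fps_to_fls (S_gf triangular_steps) * (Jxyt * (1 - Jxyt) * kernel_fls) =
    fls_X * fps_to_fls (W (inverse var_x))"
proof -
  have "S_gf triangular_steps * (Jc * (1 - Jc) * (1 - fps_X * fps_const (kernel var_x var_y))) =
      Jc * (1 - Jc) * (S_gf triangular_steps * (1 - fps_X * fps_const (kernel var_x var_y)))"
    by (simp only: mult_ac)
  also have "\<dots> = fps_X * W (inverse var_x)"
    by (simp only: S_gf_eq axis_eq)
  finally have "fps_to_fls (S_gf triangular_steps *
      (Jc * (1 - Jc) * (1 - fps_X * fps_const (kernel var_x var_y)))) =
      fps_to_fls (fps_X * W (inverse var_x))"
    by simp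
  then show ?thesis
    unfolding kernel_fls_eq fls_times_fps_to_fls by simp
qed

lemma S0_gf_fls:
  "fps_to_fls (S0_gf triangular_steps) * fps_to_fls (W var_x) = 1 - Jxyt"
  using arg_cong[OF H_mult_W[of var_x], of fps_to_fls]
  by (simp add: S0_gf_eq fls_times_fps_to_fls)

lemma algebraic_S: "algebraic_of_degree field_Q_xyt (fps_to_fls (S_gf triangular_steps)) 8"
proof -
  define s where "s = fps_to_fls (S_gf triangular_steps)"
  define \<xi> where "\<xi> = fls_const (inverse var_x)"
  have "\<xi> = inverse (fls_const var_x)"
    by (simp add: \<xi>_def field_hom.hom_inverse[OF field_hom_fls_const])
  then have \<xi>: "\<xi> \<in> field_Q_xyt"
    using gens_in_Qxyt by (simp add: Qxyt.closed)
  have K: "kernel_fls \<in> field_Q_xyt"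
    unfolding kernel_fls_def by (intro Qxyt.closed gens_in_Qxyt)
  have \<tau>: "(fls_X / kernel_fls) ^ 2 \<in> field_Q_xyt" "(fls_X / kernel_fls) ^ 2 \<noteq> 0"
    using K gens_in_Qxyt kernel_fls_nz by (auto intro!: Qxyt.closed)
  have b: "(Jxyt * (1 - Jxyt)) ^ 2 \<in> Qxyt.span4 Jxyt"
    by (intro Qxyt.span4_closed[OF Jxyt_power_4] Qxyt.closed)
  have eq: "s ^ 2 * (Jxyt * (1 - Jxyt)) ^ 2 = (fls_X / kernel_fls) ^ 2 * slit_poly Jxyt \<xi>"
  proof -
    have "s * (Jxyt * (1 - Jxyt)) = fls_X / kernel_fls * fps_to_fls (W (inverse var_x))"
      using S_gf_fls kernel_fls_nz by (simp add: s_def field_simps)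
    then show ?thesis
      by (simp only: power_mult_distrib[symmetric] \<xi>_def W_square_fls[symmetric])
  qed
  have "(Jxyt * (1 - Jxyt)) ^ 2 \<noteq> 0"
    using Jxyt_nz by (rule power_not_zero)
  then obtain p where "p \<noteq> 0" "set (coeffs p) \<subseteq> field_Q_xyt" "poly p s = 0" "degree p \<le> 8"
    by (rule Qxyt.sqrt_annihilator[OF Jxyt_power_4 slit_poly_in_span4[OF \<xi>] b _ \<tau> eq])
  then show ?thesis
    unfolding s_def
  proof (rule algebraic_of_degreeI)
    fix p assume "p \<noteq> 0" "set (coeffs p) \<subseteq> field_Q_xyt" "poly p (fps_to_fls (S_gf triangular_steps)) = 0"
    then show "8 \<le> degree p"
      by (rule degree_lower_bound[rotated]) (rule S_gf_independent)
  qed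
qed

lemma algebraic_S0: "algebraic_of_degree field_Q_xyt (fps_to_fls (S0_gf triangular_steps)) 8"
proof -
  define s where "s = fps_to_fls (S0_gf triangular_steps)"
  have a: "(1 - Jxyt) ^ 2 \<in> Qxyt.span4 Jxyt"
    by (intro Qxyt.span4_closed[OF Jxyt_power_4] Qxyt.closed)
  have eq: "s ^ 2 * slit_poly Jxyt (fls_const var_x) = 1 * (1 - Jxyt) ^ 2"
    using S0_gf_fls by (simp add: s_def W_square_fls[symmetric] flip: power_mult_distrib)
  have "slit_poly Jxyt (fls_const var_x) \<noteq> 0"
    unfolding W_square_fls[symmetric] by simp
  then obtain p where "p \<noteq> 0" "set (coeffs p) \<subseteq> field_Q_xyt" "poly p s = 0" "degree p \<le> 8"
    by (rule Qxyt.sqrt_annihilator[OF Jxyt_power_4 a slit_poly_in_span4[OF gens_in_Qxyt(1)] _ Qxyt.one_in one_neq_zero eq])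
  then show ?thesis
    unfolding s_def
  proof (rule algebraic_of_degreeI)
    fix p assume "p \<noteq> 0" "set (coeffs p) \<subseteq> field_Q_xyt" "poly p (fps_to_fls (S0_gf triangular_steps)) = 0"
    then show "8 \<le> degree p"
      by (rule degree_lower_bound[rotated]) (rule S0_gf_independent)
  qed
qed

lemma algebraic_L: "algebraic_of_degree field_Q_xyt (fps_to_fls Lc) 4"
proof -
  define l :: "ratfun_xy fls" where "l = fps_to_fls Lc"
  have J: "Jxyt = fls_X * l"
    using arg_cong[OF Jc_eq_X_Lc[where 'a = ratfun_xy], of fps_to_fls]
    by (simp add: l_def fls_times_fps_to_fls)
  \<comment> \<open>The equation for J with J = t L substituted, divided by t and arranged by powers
    of L.\<close>
  define p :: "ratfun_xy fls poly" where
    "p = [:1, - (1 + 2 * fls_X), 6 * fls_X ^ 2 + 2 * fls_X, - (2 * fls_X ^ 3 + fls_X ^ 2), fls_X ^ 4:]"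
  have "fls_X * poly p l = fls_X * quartic Jxyt - Jxyt * (1 - Jxyt) ^ 2"
    unfolding p_def J quartic_def by (simp add: algebra_simps power2_eq_square power3_eq_cube power4_eq_xxxx)
  then have root: "poly p l = 0"
    by (simp add: Jxyt_eq)
  have nz: "p \<noteq> 0" and deg: "degree p \<le> 4"
    by (simp_all add: p_def)
  have "set (coeffs p) \<subseteq> insert 0 (set [1, - (1 + 2 * fls_X), 6 * fls_X ^ 2 + 2 * fls_X,
      - (2 * fls_X ^ 3 + fls_X ^ 2), fls_X ^ 4])"
    by (auto simp: p_def cCons_def)
  also have "\<dots> \<subseteq> field_Q_xyt"
    using gens_in_Qxyt(3) by (auto intro!: Qxyt.closed)
  finally have "set (coeffs p) \<subseteq> field_Q_xyt" .
  from nz this root deg show ?thesis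
    unfolding l_def
  proof (rule algebraic_of_degreeI)
    fix p assume "p \<noteq> 0" "set (coeffs p) \<subseteq> field_Q_xyt" "poly p (fps_to_fls Lc) = 0"
    then show "4 \<le> degree p"
      by (rule degree_lower_bound[rotated]) (rule Lc_independent)
  qed
qed

lemma fps_of_rat_fps_eq: "fps_of_rat_fps f = fps_map of_rat f"
  by (rule fps_ext) (simp add: fps_of_rat_fps_def)

end

theorem theorem7p5:
  shows "(\<exists>!J. is_J J) \<and>
    (\<forall>J. is_J J \<longrightarrow>
      (let Jxy = fps_of_rat_fps J;
           Jf = fps_to_fls Jxy;
           x = fls_const var_x;
           y = fls_const var_y;
           t = fls_X
       in
        fps_to_fls (S_gf triangular_steps) =
          t * fps_to_fls (fps_sqrt ((1 - Jxy) ^ 2 - 2 * Jxy * (1 + Jxy ^ 2) * fps_const (1 / var_x)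
                + Jxy ^ 2 * (1 - Jxy) ^ 2 * fps_const (1 / var_x) ^ 2))
            / (Jf * (1 - Jf) * (1 - t * (x + 1 / x + y * (1 + x) + 1 / y * (1 + 1 / x)))) \<and>
        fps_to_fls (S0_gf triangular_steps) =
          (1 - Jf) / fps_to_fls (fps_sqrt ((1 - Jxy) ^ 2 - 2 * Jxy * (1 + Jxy ^ 2) * fps_const var_x
                + Jxy ^ 2 * (1 - Jxy) ^ 2 * fps_const var_x ^ 2)) \<and>
        fps_to_fls (L_gf triangular_steps) = fps_to_fls J / fls_X \<and>
        algebraic_of_degree field_Q_xyt (fps_to_fls (S_gf triangular_steps)) 8 \<and>
        algebraic_of_degree field_Q_xyt (fps_to_fls (S0_gf triangular_steps)) 8 \<and>
        algebraic_of_degree field_Q_xyt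
          (fps_to_fls (fps_of_rat_fps (L_gf triangular_steps))) 4 \<and>
        (\<forall>i j. fps_to_fls (S_end_gf triangular_steps i j) \<in> is_subfield hull {fps_to_fls J})))"
  unfolding Let_def
proof (intro conjI allI impI)
  show "\<exists>!J. is_J J" by (rule ex1_is_J)
next
  fix J assume "is_J J"
  then interpret J_series J by unfold_locales
  have J: "fps_of_rat_fps J = Jc"
    by (simp add: fps_of_rat_fps_eq Jc_def)
  have "(fps_to_fls (S_gf triangular_steps)) =
      fls_X * fps_to_fls (W (inverse var_x)) / (Jxyt * (1 - Jxyt) * kernel_fls)"
    using S_gf_fls Jxyt_nz kernel_fls_nz by (simp add: field_simps)
  then show "fps_to_fls (S_gf triangular_steps) =
      fls_X * fps_to_fls (fps_sqrt ((1 - fps_of_rat_fps J) ^ 2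
          - 2 * fps_of_rat_fps J * (1 + fps_of_rat_fps J ^ 2) * fps_const (1 / var_x)
          + fps_of_rat_fps J ^ 2 * (1 - fps_of_rat_fps J) ^ 2 * fps_const (1 / var_x) ^ 2))
      / (fps_to_fls (fps_of_rat_fps J) * (1 - fps_to_fls (fps_of_rat_fps J)) *
        (1 - fls_X * (fls_const var_x + 1 / fls_const var_x + fls_const var_y * (1 + fls_const var_x)
          + 1 / fls_const var_y * (1 + 1 / fls_const var_x))))"
    unfolding J slit_poly_def[symmetric] fps_sqrt_slit_poly kernel_fls_def inverse_eq_divide .
  show "fps_to_fls (S0_gf triangular_steps) =
      (1 - fps_to_fls (fps_of_rat_fps J)) / fps_to_fls (fps_sqrt ((1 - fps_of_rat_fps J) ^ 2
          - 2 * fps_of_rat_fps J * (1 + fps_of_rat_fps J ^ 2) * fps_const var_x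
          + fps_of_rat_fps J ^ 2 * (1 - fps_of_rat_fps J) ^ 2 * fps_const var_x ^ 2))"
    unfolding J slit_poly_def[symmetric] fps_sqrt_slit_poly
    by (simp add: S0_gf_fls[symmetric])
  have "Jf = fls_X * fps_to_fls Lc"
    using arg_cong[OF Jc_eq_X_Lc[where 'a = rat], of fps_to_fls] by (simp add: fls_times_fps_to_fls)
  then show "fps_to_fls (L_gf triangular_steps) = fps_to_fls J / fls_X"
    by (simp only: L_gf_eq nonzero_mult_div_cancel_left[OF fls_X_nonzero])
  show "algebraic_of_degree field_Q_xyt (fps_to_fls (S_gf triangular_steps)) 8"
    by (rule algebraic_S)
  show "algebraic_of_degree field_Q_xyt (fps_to_fls (S0_gf triangular_steps)) 8"
    by (rule algebraic_S0)
  show "algebraic_of_degree field_Q_xyt (fps_to_fls (fps_of_rat_fps (L_gf triangular_steps))) 4"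
    using algebraic_L by (simp add: L_gf_eq fps_of_rat_fps_eq fps_map_Lc[OF field_hom_rat])
  show "fps_to_fls (S_end_gf triangular_steps i j) \<in> is_subfield hull {fps_to_fls J}" for i j
    using slit_series_in[of i j] by (simp add: S_end_gf_eq QJ_def)
qed

end
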